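(* Let $f$ be a real-valued smooth function of finite type defined on a neighborhood of the origin in $\mathbb{R}^2$ with $f(0,0)=0$, $\nabla f(0,0)=0$. Choose $\kappa_1,\kappa_2\ge0$ such that the principal face $\pi(f)$ of the Newton polyhedron of $f$ lies on the line $\kappa_1t_1+\kappa_2t_2=1$. Without loss of generality (interchanging the coordinates if necessary) assume that $\kappa_2\ge\kappa_1$. Then there exists a smooth function $\psi(x_1)$ of $x_1$ near the origin with $\psi(0)=0$ such that an adapted coordinate system $(y_1,y_2)$ for $f$ near $0$ is given by $y_1:=x_1$, $y_2:=x_2-\psi(x_1)$.
   Context: Here $\mathbb{N}=\{0,1,2,\dots\}$ and $\mathbb{R}_+=[0,\infty)$. For a smooth real-valued $f$ near the origin with Taylor series $\sum_{j,k}c_{jk}x_1^jx_2^k$ at the origin, the Taylor support is $\mathcal{T}(f)=\{(j,k)\in\mathbb{N}^2:c_{jk}\neq0\}$; $f$ is of finite type (at the origin) if $\mathcal{T}(f)\neq\emptyset$. The Newton polyhedron $\mathcal{N}(f)$ is the convex hull of the union of all quadrants $(j,k)+\mathbb{R}_+^2$, $(j,k)\in\mathcal{T}(f)$, in the plane with coordinates $(t_1,t_2)$. A face is an edge (possibly unbounded) or a vertex. The distance $d(f)$ is the number $d$ such that $(d,d)$ is the point where the bisectrix $t_1=t_2$ intersects the boundary of $\mathcal{N}(f)$. The principal face $\pi(f)$ is the face of minimal dimension containing $(d,d)$. A local smooth coordinate system $y$ at the origin is given by $x=\varphi(y)$ with $\varphi$ a smooth local diffeomorphism near $0$ with $\varphi(0)=0$;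 in it $f$ is expressed as $f\circ\varphi$, and $d_y:=d(f\circ\varphi)$. The height is $h(f):=\sup d_y$, the supremum over all local smooth coordinate systems $y$ at the origin. The coordinate system $y$ is adapted to $f$ if $d_y=h(f)$. *)

theory Defs
  imports "HOL-Analysis.Analysis"
begin

primrec Ck_on :: "nat \<Rightarrow> 'a::real_normed_vector set \<Rightarrow> ('a \<Rightarrow> 'b::real_normed_vector) \<Rightarrow> bool" where
  "Ck_on 0 S f \<longleftrightarrow> continuous_on S f"
| "Ck_on (Suc n) S f \<longleftrightarrow>
     (\<forall>x\<in>S. f differentiable (at x)) \<and> (\<forall>v. Ck_on n S (\<lambda>x. frechet_derivative f (at x) v))"

(* Only meant for open S: the derivatives are the full ones, not those within S. *)
definition smooth_on :: "'a::real_normed_vector set \<Rightarrow> ('a \<Rightarrow> 'b::real_normed_vector) \<Rightarrow> bool" where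
  "smooth_on S f \<longleftrightarrow> (\<forall>n. Ck_on n S f)"

definition partial_derivative ::
  "real \<times> real \<Rightarrow> (real \<times> real \<Rightarrow> real) \<Rightarrow> real \<times> real \<Rightarrow> real" where
  "partial_derivative v f = (\<lambda>x. frechet_derivative f (at x) v)"

(* Functions are total, but everything below depends only on the germ of f at the origin. *)
definition taylor_coeff :: "(real \<times> real \<Rightarrow> real) \<Rightarrow> nat \<Rightarrow> nat \<Rightarrow> real" where
  "taylor_coeff f j k =
     (partial_derivative (1, 0) ^^ j) ((partial_derivative (0, 1) ^^ k) f) (0, 0) / (fact j * fact k)"

definition taylor_support :: "(real \<times> real \<Rightarrow> real) \<Rightarrow> (nat \<times> nat) set" where
  "taylor_support f = {(j, k). taylor_coeff f j k \<noteq> 0}"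

definition finite_type :: "(real \<times> real \<Rightarrow> real) \<Rightarrow> bool" where
  "finite_type f \<longleftrightarrow> taylor_support f \<noteq> {}"

definition newton_polyhedron :: "(real \<times> real \<Rightarrow> real) \<Rightarrow> (real \<times> real) set" where
  "newton_polyhedron f =
     convex hull (\<Union>(j, k)\<in>taylor_support f. {(t1, t2). real j \<le> t1 \<and> real k \<le> t2})"

(* For f of finite type the polyhedron is closed and stable under adding vectors of the closed
   first quadrant, so the bisectrix meets its boundary in exactly one point. *)
definition newton_distance :: "(real \<times> real \<Rightarrow> real) \<Rightarrow> real" where
  "newton_distance f = (THE d. (d, d) \<in> frontier (newton_polyhedron f))"

(* edge_of does not require compactness, so unbounded edges are included. *)
definition newton_face :: "(real \<times> real \<Rightarrow> real) \<Rightarrow> (real \<times> real) set \<Rightarrow> bool" where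
  "newton_face f F \<longleftrightarrow>
     F edge_of newton_polyhedron f \<or>
     (\<exists>v. v extreme_point_of newton_polyhedron f \<and> F = {v})"

definition principal_face :: "(real \<times> real \<Rightarrow> real) \<Rightarrow> (real \<times> real) set" where
  "principal_face f =
     (let p = (newton_distance f, newton_distance f) in
      THE F. newton_face f F \<and> p \<in> F \<and>
             (\<forall>G. newton_face f G \<and> p \<in> G \<longrightarrow> aff_dim F \<le> aff_dim G))"

(* A coordinate system y is represented by the map \<phi> with x = \<phi> y, so that f is expressed
   in it as f \<circ> \<phi>. *)
definition local_coordinates :: "(real \<times> real \<Rightarrow> real \<times> real) \<Rightarrow> bool" where
  "local_coordinates \<phi> \<longleftrightarrow>
     \<phi> (0, 0) = (0, 0) \<and>
     (\<exists>U V \<theta>. open U \<and> (0, 0) \<in> U \<and> open V \<and> homeomorphism U V \<phi> \<theta> \<and>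
              smooth_on U \<phi> \<and> smooth_on V \<theta>)"

definition height :: "(real \<times> real \<Rightarrow> real) \<Rightarrow> ereal" where
  "height f = (SUP \<phi>\<in>Collect local_coordinates. ereal (newton_distance (f \<circ> \<phi>)))"

definition adapted :: "(real \<times> real \<Rightarrow> real) \<Rightarrow> (real \<times> real \<Rightarrow> real \<times> real) \<Rightarrow> bool" where
  "adapted f \<phi> \<longleftrightarrow> local_coordinates \<phi> \<and> ereal (newton_distance (f \<circ> \<phi>)) = height f"

end

theory Submission
  imports Defs
begin

text \<open>
  The Newton distance of a germ is the largest value of \<open>M / (v + w)\<close>, where \<open>(v, w)\<close> runs
  over the weights and \<open>M\<close> is the weighted order of the germ. Having weighted order at least
  \<open>M\<close> means being \<open>O(t powr M)\<close> on the boxes \<open>\<bar>x\<bar> \<le> t powr v\<close>, \<open>\<bar>y\<bar> \<le> t powr w\<close>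
  (\<open>box_bound_if_weight_ge\<close>, \<open>weight_ge_if_box_bound\<close>). For \<open>(v, w) = (1, r)\<close> with
  \<open>r \<ge> 1\<close> this box is a thin neighbourhood of the curve \<open>y = 0\<close>, so the height asks how small
  the function can be near an arbitrary smooth curve germ, in proportion to \<open>1 + r\<close>. With all
  orders expressed through sizes on boxes, a change of coordinates amounts to a substitution into
  inequalities.

  Let \<open>x\<^sub>2 = \<eta>(x\<^sub>1)\<close> be such a curve with \<open>\<eta> \<approx> b x\<^sub>1\<^sup>q\<close> and \<open>b \<noteq> 0\<close>, and let \<open>m\<close> be the
  order of the function for the weight \<open>(1, q)\<close>. Up to the scale \<open>r = q\<close> the curve cannot be told
  from the axis. Beyond it the order grows at most at the rate \<open>n\<close>, the multiplicity of \<open>b\<close> as a root of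
  the initial form of weight \<open>(1, q)\<close>. If \<open>n (1 + q) \<le> m\<close>, then \<open>n\<close> is at most the Newton
  distance and the ratio of order and \<open>1 + r\<close> never exceeds that distance (\<open>weighted_order_le\<close>).
  Roots violating this inequality are the bad roots. In their absence, apart from the root
  \<open>0\<close>, no curve transversal to the \<open>x\<^sub>2\<close>-axis yields more than the Newton distance.

  For each \<open>q\<close> there is at most one bad root, because two of them would have too many
  multiplicities for the degree of the initial form (\<open>bad_root_unique\<close>). A shear by
  \<open>b x\<^sub>1\<^sup>q\<close> moves the bad root \<open>b\<close> to \<open>0\<close>, and terms of order above \<open>q\<close> leave the initial
  form of weight \<open>(1, q)\<close> alone. So \<open>\<psi>\<close> is built coefficient by coefficient: the \<open>q\<close>-th one
  is the bad root of the function sheared by the earlier terms, and the resulting formal series is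
  realised by a smooth function through a series of rational functions due to Peano
  (\<open>borel_summation\<close>, \<open>adapting_shear\<close>).

  It remains to treat curves tangent to the \<open>x\<^sub>2\<close>-axis, that is \<open>x\<^sub>1 \<approx> b x\<^sub>2\<^sup>q\<close> with
  \<open>q \<ge> 2\<close>. The initial forms of weight \<open>(q, 1)\<close> are the same for \<open>f\<close> and for the sheared
  function, and a nonzero bad root of one of them forces the principal face of \<open>f\<close> to be an edge with
  normal \<open>(q, 1)\<close>. This contradicts \<open>\<kappa>2 \<ge> \<kappa>1\<close> (\<open>swapped_bad_root_principal_face\<close>).
\<close>

section \<open>Smooth functions and germs\<close>

lemma Ck_on_subset: "Ck_on n S f \<Longrightarrow> T \<subseteq> S \<Longrightarrow> Ck_on n T f"
  by (induction n arbitrary: f) (auto intro: continuous_on_subset)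

lemma Ck_on_cong:
  assumes "open S" "Ck_on n S f" "\<And>x. x \<in> S \<Longrightarrow> f x = g x"
  shows "Ck_on n S g"
  using assms(2,3)
proof (induction n arbitrary: f g)
  case 0
  then show ?case by (auto cong: continuous_on_cong)
next
  case (Suc n)
  have der: "(g has_derivative frechet_derivative f (at x)) (at x)" if "x \<in> S" for x
  proof -
    have "(f has_derivative frechet_derivative f (at x)) (at x)"
      using Suc.prems(1) that frechet_derivative_works by auto
    then show ?thesis
      by (rule has_derivative_transform_within_open[OF _ \<open>open S\<close> that]) (use Suc.prems(2) in auto)
  qed
  have "frechet_derivative f (at x) v = frechet_derivative g (at x) v" if "x \<in> S" for x v
    using frechet_derivative_at[OF der[OF that]] by simp
  then have "Ck_on n S (\<lambda>x. frechet_derivative g (at x) v)" for v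
    using Suc.IH[of "\<lambda>x. frechet_derivative f (at x) v"] Suc.prems(1) by simp
  then show ?case
    using der by (auto simp: differentiable_def)
qed

lemma Ck_on_SucI:
  assumes "open S" "\<And>x. x \<in> S \<Longrightarrow> (f has_derivative f' x) (at x)"
    and "\<And>v. Ck_on n S (\<lambda>x. f' x v)"
  shows "Ck_on (Suc n) S f"
proof -
  have "Ck_on n S (\<lambda>x. frechet_derivative f (at x) v)" for v
    by (rule Ck_on_cong[OF assms(1) assms(3)[of v]])
      (simp add: frechet_derivative_at[OF assms(2), symmetric])
  then show ?thesis using assms(2) by (auto simp: differentiable_def)
qed

lemma Ck_on_SucD:
  assumes "Ck_on (Suc n) S f" "x \<in> S"
  shows "(f has_derivative frechet_derivative f (at x)) (at x)"
  using assms frechet_derivative_works by auto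

lemma Ck_on_Suc_le: "Ck_on (Suc n) S f \<Longrightarrow> Ck_on n S f"
proof (induction n arbitrary: f)
  case 0
  then have "\<And>x. x \<in> S \<Longrightarrow> continuous (at x) f"
    using differentiable_imp_continuous_within by auto
  then show ?case by (simp add: continuous_at_imp_continuous_on)
qed auto

lemma Ck_on_const: "Ck_on n S (\<lambda>x. c)"
proof (induction n arbitrary: c)
  case (Suc n)
  then show ?case by simp
qed auto

lemma Ck_on_add:
  assumes "open S" "Ck_on n S f" "Ck_on n S g"
  shows "Ck_on n S (\<lambda>x. f x + g x)"
  using assms(2,3)
proof (induction n arbitrary: f g)
  case 0 then show ?case by (auto intro: continuous_intros)
next
  case (Suc n)
  have "Ck_on n S (\<lambda>x. frechet_derivative f (at x) v + frechet_derivative g (at x) v)" for v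
    using Suc.prems by (intro Suc.IH) simp_all
  then show ?case
    by (intro Ck_on_SucI[OF \<open>open S\<close> has_derivative_add[OF Ck_on_SucD[OF Suc.prems(1)] Ck_on_SucD[OF Suc.prems(2)]]])
qed

lemma Ck_on_sum:
  assumes "open S" "finite A" "\<And>i. i \<in> A \<Longrightarrow> Ck_on n S (f i)"
  shows "Ck_on n S (\<lambda>x. \<Sum>i\<in>A. f i x)"
  using assms(2,3)
  by (induction A rule: finite_induct) (simp_all add: Ck_on_add[OF assms(1)] Ck_on_const)

lemma Ck_on_bounded_linear:
  assumes "open S" "bounded_linear L" "Ck_on n S f"
  shows "Ck_on n S (\<lambda>x. L (f x))"
  using assms(3)
proof (induction n arbitrary: f)
  case 0 then show ?case by (simp add: bounded_linear.continuous_on[OF assms(2)])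
next
  case (Suc n)
  have "Ck_on n S (\<lambda>x. L (frechet_derivative f (at x) v))" for v
    using Suc.prems by (intro Suc.IH) simp
  then show ?case
    by (intro Ck_on_SucI[OF \<open>open S\<close> bounded_linear.has_derivative[OF assms(2) Ck_on_SucD[OF Suc.prems]]])
qed

lemma Ck_on_scaleR:
  fixes a :: "'a::real_normed_vector \<Rightarrow> real"
  assumes "open S" "Ck_on n S a" "Ck_on n S f"
  shows "Ck_on n S (\<lambda>x. a x *\<^sub>R f x)"
  using assms(2,3)
proof (induction n arbitrary: a f)
  case 0 then show ?case by (auto intro: continuous_intros)
next
  case (Suc n)
  have "Ck_on n S (\<lambda>x. a x *\<^sub>R frechet_derivative f (at x) v + frechet_derivative a (at x) v *\<^sub>R f x)" for v
    using Ck_on_Suc_le[OF Suc.prems(1)] Ck_on_Suc_le[OF Suc.prems(2)] Suc.prems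
    by (intro Ck_on_add[OF \<open>open S\<close>] Suc.IH) simp_all
  then show ?case
    by (intro Ck_on_SucI[OF \<open>open S\<close> has_derivative_scaleR[OF Ck_on_SucD[OF Suc.prems(1)] Ck_on_SucD[OF Suc.prems(2)]]])
qed

lemma Ck_on_bounded_linear_id:
  assumes "open S" "bounded_linear L" shows "Ck_on n S L"
proof (cases n)
  case 0 then show ?thesis using assms by (simp add: linear_continuous_on)
next
  case (Suc m)
  then show ?thesis
    using Ck_on_SucI[OF assms(1), of L "\<lambda>x. L"] assms
    by (simp add: bounded_linear_imp_has_derivative Ck_on_const)
qed

text \<open>The chain rule writes the derivative of the composition as a sum over the basis of products
  of a directional derivative of the outer function, taken at the inner one, with a coordinate of
  the derivative of the inner one. Each factor falls under the induction hypothesis or an earlier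
  closure property.\<close>

lemma Ck_on_compose:
  fixes \<Phi> :: "'a::real_normed_vector \<Rightarrow> 'b::euclidean_space"
  assumes "open S" "Ck_on n S \<Phi>" "Ck_on n T f" "\<Phi> ` S \<subseteq> T"
  shows "Ck_on n S (\<lambda>x. f (\<Phi> x))"
  using assms(2,3)
proof (induction n arbitrary: f)
  case 0
  then have "continuous_on S \<Phi>" "continuous_on T f" by simp_all
  then show ?case using assms(4) continuous_on_compose2[of T f S \<Phi>] by simp
next
  case (Suc n)
  define f' where "f' x v = (\<Sum>e\<in>Basis. (frechet_derivative \<Phi> (at x) v \<bullet> e) *\<^sub>R frechet_derivative f (at (\<Phi> x)) e)" for x v
  have der: "((\<lambda>x. f (\<Phi> x)) has_derivative f' x) (at x)" if "x \<in> S" for x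
  proof -
    have f: "(f has_derivative frechet_derivative f (at (\<Phi> x))) (at (\<Phi> x))"
      using that assms(4) Ck_on_SucD[OF Suc.prems(2)] by auto
    have "((\<lambda>x. f (\<Phi> x)) has_derivative (\<lambda>v. frechet_derivative f (at (\<Phi> x)) (frechet_derivative \<Phi> (at x) v))) (at x)"
      using has_derivative_compose[OF Ck_on_SucD[OF Suc.prems(1) that] f] .
    moreover have "f' x = (\<lambda>v. frechet_derivative f (at (\<Phi> x)) (frechet_derivative \<Phi> (at x) v))"
    proof
      fix v
      interpret linear "frechet_derivative f (at (\<Phi> x))"
        using f has_derivative_linear by blast
      have "f' x v = frechet_derivative f (at (\<Phi> x))
          (\<Sum>e\<in>Basis. (frechet_derivative \<Phi> (at x) v \<bullet> e) *\<^sub>R e)"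
        unfolding f'_def by (simp only: sum scale)
      then show "f' x v = frechet_derivative f (at (\<Phi> x)) (frechet_derivative \<Phi> (at x) v)"
        by (simp only: euclidean_representation)
    qed
    ultimately show ?thesis by (simp only: )
  qed
  have "Ck_on n S (\<lambda>x. f' x v)" for v
    unfolding f'_def
  proof (intro Ck_on_sum[OF \<open>open S\<close>] Ck_on_scaleR[OF \<open>open S\<close>])
    fix e :: 'b assume "e \<in> Basis"
    show "Ck_on n S (\<lambda>x. frechet_derivative \<Phi> (at x) v \<bullet> e)"
      using Suc.prems(1) by (intro Ck_on_bounded_linear[OF \<open>open S\<close> bounded_linear_inner_left]) simp
    show "Ck_on n S (\<lambda>x. frechet_derivative f (at (\<Phi> x)) e)"
      using Suc.IH[of "\<lambda>y. frechet_derivative f (at y) e", OF Ck_on_Suc_le[OF Suc.prems(1)]] Suc.prems(2) by simp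
  qed simp
  then show ?case by (intro Ck_on_SucI[OF \<open>open S\<close> der])
qed

definition smooth_germ :: "(real \<times> real \<Rightarrow> 'b::real_normed_vector) \<Rightarrow> bool" where
  "smooth_germ f \<longleftrightarrow> (\<exists>U. open U \<and> (0, 0) \<in> U \<and> smooth_on U f)"

lemma smooth_germ_compose:
  fixes \<Phi> :: "real \<times> real \<Rightarrow> real \<times> real"
  assumes "smooth_germ f" "smooth_germ \<Phi>" "\<Phi> (0, 0) = (0, 0)"
  shows "smooth_germ (\<lambda>x. f (\<Phi> x))"
proof -
  from assms obtain U V where U: "open U" "(0, 0) \<in> U" "smooth_on U \<Phi>"
    and V: "open V" "(0, 0) \<in> V" "smooth_on V f" by (auto simp: smooth_germ_def)
  have "Ck_on 0 U \<Phi>" using U(3) unfolding smooth_on_def by blast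
  then have "continuous_on U \<Phi>" by simp
  then have op: "open (U \<inter> \<Phi> -` V)"
    using U(1) V(1) by (simp add: continuous_on_open_vimage Int_commute)
  have "smooth_on (U \<inter> \<Phi> -` V) (\<lambda>x. f (\<Phi> x))"
    unfolding smooth_on_def
  proof
    fix n
    have "Ck_on n (U \<inter> \<Phi> -` V) \<Phi>" "Ck_on n V f"
      using U(3) V(3) Ck_on_subset[of n U \<Phi>] unfolding smooth_on_def by auto
    then show "Ck_on n (U \<inter> \<Phi> -` V) (\<lambda>x. f (\<Phi> x))"
      by (rule Ck_on_compose[OF op]) auto
  qed
  then show ?thesis unfolding smooth_germ_def
    using op U V assms(3) by (intro exI[of _ "U \<inter> \<Phi> -` V"]) auto
qed

lemma smooth_germ_linear: "bounded_linear f \<Longrightarrow> smooth_germ f"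
  unfolding smooth_germ_def smooth_on_def by (intro exI[of _ UNIV]) (simp add: Ck_on_bounded_linear_id)

lemma smooth_germ_bounded_linear: "bounded_linear L \<Longrightarrow> smooth_germ f \<Longrightarrow> smooth_germ (\<lambda>x. L (f x))"
  unfolding smooth_germ_def smooth_on_def by (blast intro: Ck_on_bounded_linear)

lemma smooth_on_shear:
  assumes "open I" "smooth_on I \<psi>"
  shows "smooth_on (I \<times> UNIV) (\<lambda>z :: real \<times> real. (fst z, snd z + \<psi> (fst z)))"
  unfolding smooth_on_def
proof
  fix n
  have op: "open (I \<times> (UNIV :: real set))" using assms by (simp add: open_Times)
  have "Ck_on n I \<psi>" using assms(2) by (simp add: smooth_on_def)
  then have "Ck_on n (I \<times> UNIV) (\<lambda>z :: real \<times> real. \<psi> (fst z))"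
    by (rule Ck_on_compose[OF op Ck_on_bounded_linear_id[OF op bounded_linear_fst]]) auto
  then have "Ck_on n (I \<times> UNIV) (\<lambda>z :: real \<times> real. (0 :: real, \<psi> (fst z)))"
    by (rule Ck_on_bounded_linear[OF op bounded_linear_Pair[OF bounded_linear_zero bounded_linear_ident]])
  from Ck_on_add[OF op Ck_on_bounded_linear_id[OF op bounded_linear_ident] this]
  show "Ck_on n (I \<times> UNIV) (\<lambda>z :: real \<times> real. (fst z, snd z + \<psi> (fst z)))"
    by (simp add: plus_prod_def)
qed

lemma smooth_germ_shear:
  assumes "smooth_germ g" "open I" "(0::real) \<in> I" "smooth_on I \<psi>" "\<psi> 0 = 0"
  shows "smooth_germ (\<lambda>(x, y). g (x, \<psi> x + y))"
proof -
  have "open (I \<times> (UNIV :: real set))" using assms by (simp add: open_Times)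
  then have "smooth_germ (\<lambda>z :: real \<times> real. (fst z, snd z + \<psi> (fst z)))"
    unfolding smooth_germ_def
    using smooth_on_shear[OF assms(2,4)] assms(3) by (intro exI[of _ "I \<times> UNIV"]) auto
  from smooth_germ_compose[OF assms(1) this] assms(5) show ?thesis
    by (simp add: case_prod_unfold add.commute)
qed

section \<open>Taylor expansion in two variables\<close>

text \<open>An asymptotic expansion with square partial sums, a form that is symmetric in the two variables:
  exchanging them in the function transposes the coefficients.\<close>

definition has_taylor :: "(real \<times> real \<Rightarrow> real) \<Rightarrow> (nat \<Rightarrow> nat \<Rightarrow> real) \<Rightarrow> bool" where
  "has_taylor g c \<longleftrightarrow>
     (\<forall>N. \<exists>C \<delta>. 0 < \<delta> \<and> (\<forall>x y. \<bar>x\<bar> \<le> \<delta> \<longrightarrow> \<bar>y\<bar> \<le> \<delta> \<longrightarrow>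
        \<bar>g (x, y) - (\<Sum>j<N. \<Sum>k<N. c j k * x ^ j * y ^ k)\<bar> \<le> C * (\<bar>x\<bar> ^ N + \<bar>y\<bar> ^ N)))"

lemma smooth_on_partial: "smooth_on U f \<Longrightarrow> smooth_on U (partial_derivative v f)"
  unfolding smooth_on_def partial_derivative_def
proof
  fix n assume "\<forall>n. Ck_on n U f"
  then have "Ck_on (Suc n) U f" by blast
  then show "Ck_on n U (\<lambda>x. frechet_derivative f (at x) v)"
    by (simp del: split_paired_All)
qed

lemma smooth_on_partial_power: "smooth_on U f \<Longrightarrow> smooth_on U ((partial_derivative v ^^ n) f)"
  by (induction n) (auto intro: smooth_on_partial)

lemma smooth_on_has_derivative:
  assumes "smooth_on U f" "x \<in> U"
  shows "(f has_derivative frechet_derivative f (at x)) (at x)"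
proof -
  have "Ck_on (Suc 0) U f" using assms by (simp only: smooth_on_def)
  then show ?thesis using Ck_on_SucD assms(2) by blast
qed

lemma DERIV_partial_snd:
  assumes "smooth_on U f" "(x, y) \<in> U"
  shows "((\<lambda>t. f (x, t)) has_field_derivative partial_derivative (0, 1) f (x, y)) (at y)"
proof -
  let ?D = "frechet_derivative f (at (x, y))"
  have D: "(f has_derivative ?D) (at (x, y))" using smooth_on_has_derivative assms by blast
  have "((\<lambda>t. (x, t)) has_derivative (\<lambda>h. (0, h))) (at y)"
    by (auto intro!: derivative_eq_intros)
  from has_derivative_compose[OF this D]
  have "((\<lambda>t. f (x, t)) has_derivative (\<lambda>h. ?D (0, h))) (at y)" .
  moreover have "(\<lambda>h. ?D (0, h)) = (*) (?D (0, 1))"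
  proof
    fix h show "?D (0, h) = ?D (0, 1) * h"
      using linear_scale[OF has_derivative_linear[OF D], of h "(0, 1)"] by (simp add: mult.commute)
  qed
  ultimately show ?thesis by (simp only: has_field_derivative_def partial_derivative_def)
qed

lemma DERIV_partial_fst:
  assumes "smooth_on U f" "(x, y) \<in> U"
  shows "((\<lambda>t. f (t, y)) has_field_derivative partial_derivative (1, 0) f (x, y)) (at x)"
proof -
  let ?D = "frechet_derivative f (at (x, y))"
  have D: "(f has_derivative ?D) (at (x, y))" using smooth_on_has_derivative assms by blast
  have "((\<lambda>t. (t, y)) has_derivative (\<lambda>h. (h, 0))) (at x)"
    by (auto intro!: derivative_eq_intros)
  from has_derivative_compose[OF this D]
  have "((\<lambda>t. f (t, y)) has_derivative (\<lambda>h. ?D (h, 0))) (at x)" .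
  moreover have "(\<lambda>h. ?D (h, 0)) = (*) (?D (1, 0))"
  proof
    fix h show "?D (h, 0) = ?D (1, 0) * h"
      using linear_scale[OF has_derivative_linear[OF D], of h "(1, 0)"] by (simp add: mult.commute)
  qed
  ultimately show ?thesis by (simp only: has_field_derivative_def partial_derivative_def)
qed

lemma smooth_on_bounded_box:
  fixes f :: "real \<times> real \<Rightarrow> real"
  assumes "smooth_on U f" "{-\<delta>..\<delta>} \<times> {-\<delta>..\<delta>} \<subseteq> U"
  shows "\<exists>B \<ge> 0. \<forall>x y. \<bar>x\<bar> \<le> \<delta> \<longrightarrow> \<bar>y\<bar> \<le> \<delta> \<longrightarrow> \<bar>f (x, y)\<bar> \<le> B"
proof -
  have "Ck_on 0 U f" using assms(1) unfolding smooth_on_def by blast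
  then have "continuous_on ({-\<delta>..\<delta>} \<times> {-\<delta>..\<delta>}) f"
    using assms(2) continuous_on_subset by auto
  then have "bounded (f ` ({-\<delta>..\<delta>} \<times> {-\<delta>..\<delta>}))"
    by (intro compact_imp_bounded compact_continuous_image compact_Times) auto
  then obtain B where B: "\<And>z. z \<in> {-\<delta>..\<delta>} \<times> {-\<delta>..\<delta>} \<Longrightarrow> \<bar>f z\<bar> \<le> B"
    by (auto simp: bounded_iff)
  have "\<bar>f (x, y)\<bar> \<le> max B 0" if "\<bar>x\<bar> \<le> \<delta>" "\<bar>y\<bar> \<le> \<delta>" for x y
    using B[of "(x, y)"] that by (force simp: abs_le_iff)
  then show ?thesis by (intro exI[of _ "max B 0"]) auto
qed

text \<open>Two applications of the one-dimensional Taylor formula, one for each variable. Expanding first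
  in the second variable produces exactly the iterated derivatives, in exactly the order, that
  the Taylor coefficients are made of.\<close>

lemma has_taylor_smooth:
  assumes "smooth_germ g"
  shows "has_taylor g (taylor_coeff g)"
  unfolding has_taylor_def
proof
  fix N
  from assms obtain U where U: "open U" "(0, 0) \<in> U" "smooth_on U g" by (auto simp: smooth_germ_def)
  define G where "G k = (partial_derivative (0, 1) ^^ k) g" for k
  define H where "H k j = (partial_derivative (1, 0) ^^ j) (G k)" for k j
  have smG: "smooth_on U (G k)" and smH: "smooth_on U (H k j)" for k j
    unfolding G_def H_def by (intro smooth_on_partial_power U)+
  obtain A B where AB: "open A" "open B" "(0, 0) \<in> A \<times> B" "A \<times> B \<subseteq> U"
    using open_prod_elim[OF U(1,2)] by blast
  then obtain a b where ab: "a > 0" "b > 0" "cball 0 a \<subseteq> A" "cball 0 b \<subseteq> B"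
    by (metis mem_Times_iff fst_conv snd_conv open_contains_cball)
  define \<delta> where "\<delta> = min 1 (min a b)"
  have \<delta>: "\<delta> > 0" "\<delta> \<le> 1" using ab by (auto simp: \<delta>_def)
  have sub: "{-\<delta>..\<delta>} \<times> {-\<delta>..\<delta>} \<subseteq> U"
  proof -
    have "{-\<delta>..\<delta>} \<subseteq> cball 0 a" "{-\<delta>..\<delta>} \<subseteq> cball 0 b" by (auto simp: \<delta>_def)
    then show ?thesis using ab AB by blast
  qed
  have inU: "(x, y) \<in> U" if "\<bar>x\<bar> \<le> \<delta>" "\<bar>y\<bar> \<le> \<delta>" for x y
    using sub that by (auto simp: abs_le_iff)
  obtain B where B: "B \<ge> 0" "\<And>x y. \<bar>x\<bar> \<le> \<delta> \<Longrightarrow> \<bar>y\<bar> \<le> \<delta> \<Longrightarrow> \<bar>G N (x, y)\<bar> \<le> B"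
    using smooth_on_bounded_box[OF smG sub] by metis
  have "\<forall>k. \<exists>B\<ge>0. \<forall>x y. \<bar>x\<bar> \<le> \<delta> \<longrightarrow> \<bar>y\<bar> \<le> \<delta> \<longrightarrow> \<bar>H k N (x, y)\<bar> \<le> B"
    using smooth_on_bounded_box[OF smH sub] by blast
  then obtain K where K: "\<And>k. K k \<ge> 0"
    "\<And>k x y. \<bar>x\<bar> \<le> \<delta> \<Longrightarrow> \<bar>y\<bar> \<le> \<delta> \<Longrightarrow> \<bar>H k N (x, y)\<bar> \<le> K k"
    by metis
  define C where "C = B + (\<Sum>k<N. K k)"
  have C: "C \<ge> B" "C \<ge> (\<Sum>k<N. K k)" using B K by (auto simp: C_def intro: sum_nonneg)
  have tc: "taylor_coeff g j k = H k j (0, 0) / (fact j * fact k)" for j k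
    by (simp add: taylor_coeff_def H_def G_def)
  have main: "\<bar>g (x, y) - (\<Sum>j<N. \<Sum>k<N. taylor_coeff g j k * x ^ j * y ^ k)\<bar> \<le> C * (\<bar>x\<bar> ^ N + \<bar>y\<bar> ^ N)"
    if x: "\<bar>x\<bar> \<le> \<delta>" and y: "\<bar>y\<bar> \<le> \<delta>" for x y
  proof -
    \<comment> \<open>Expand first in the second variable at height 0, then each coefficient in the first.\<close>
    have derG: "((\<lambda>t. G m (x, t)) has_field_derivative G (Suc m) (x, t)) (at t)" if "\<bar>t\<bar> \<le> \<bar>y\<bar>" for m t
      using DERIV_partial_snd[OF smG inU[of x t], of m] x y that by (simp add: G_def)
    then obtain t where t: "\<bar>t\<bar> \<le> \<bar>y\<bar>"
      "G 0 (x, y) = (\<Sum>m<N. G m (x, 0) / fact m * y ^ m) + G N (x, t) / fact N * y ^ N"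
      using Maclaurin_bi_le[of "\<lambda>m t. G m (x, t)" "\<lambda>t. G 0 (x, t)" N y] by auto
    have "\<forall>k. \<exists>s. \<bar>s\<bar> \<le> \<bar>x\<bar> \<and> G k (x, 0) = (\<Sum>m<N. H k m (0, 0) / fact m * x ^ m) + H k N (s, 0) / fact N * x ^ N"
    proof
      fix k
      have "((\<lambda>t. H k m (t, 0)) has_field_derivative H k (Suc m) (t, 0)) (at t)" if "\<bar>t\<bar> \<le> \<bar>x\<bar>" for m t
        using DERIV_partial_fst[OF smH inU[of t 0], of k m] x \<delta> that by (simp add: H_def)
      then show "\<exists>s. \<bar>s\<bar> \<le> \<bar>x\<bar> \<and> G k (x, 0) = (\<Sum>m<N. H k m (0, 0) / fact m * x ^ m) + H k N (s, 0) / fact N * x ^ N"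
        using Maclaurin_bi_le[of "\<lambda>m t. H k m (t, 0)" "\<lambda>t. G k (t, 0)" N x] by (auto simp: H_def)
    qed
    from choice[OF this] obtain s where s: "\<And>k. \<bar>s k\<bar> \<le> \<bar>x\<bar>"
      "\<And>k. G k (x, 0) = (\<Sum>m<N. H k m (0, 0) / fact m * x ^ m) + H k N (s k, 0) / fact N * x ^ N"
      by blast
    have "g (x, y) = (\<Sum>k<N. ((\<Sum>j<N. H k j (0, 0) / fact j * x ^ j) + H k N (s k, 0) / fact N * x ^ N) / fact k * y ^ k)
        + G N (x, t) / fact N * y ^ N"
      using t(2) s(2) by (simp add: G_def)
    also have "\<dots> = (\<Sum>k<N. \<Sum>j<N. taylor_coeff g j k * x ^ j * y ^ k)
        + (\<Sum>k<N. H k N (s k, 0) / fact N * x ^ N / fact k * y ^ k) + G N (x, t) / fact N * y ^ N"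
    proof -
      have "((\<Sum>j<N. H k j (0, 0) / fact j * x ^ j) + r) / fact k * y ^ k
          = (\<Sum>j<N. taylor_coeff g j k * x ^ j * y ^ k) + r / fact k * y ^ k" for k r
      proof -
        have "(\<Sum>j<N. H k j (0, 0) / fact j * x ^ j) / fact k * y ^ k
            = (\<Sum>j<N. taylor_coeff g j k * x ^ j * y ^ k)"
          unfolding sum_divide_distrib sum_distrib_right by (intro sum.cong refl) (simp add: tc)
        then show ?thesis by (simp only: add_divide_distrib distrib_right)
      qed
      then show ?thesis by (simp only: sum.distrib)
    qed
    also have "(\<Sum>k<N. \<Sum>j<N. taylor_coeff g j k * x ^ j * y ^ k) = (\<Sum>j<N. \<Sum>k<N. taylor_coeff g j k * x ^ j * y ^ k)"
      by (rule sum.swap)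
    finally have "\<bar>g (x, y) - (\<Sum>j<N. \<Sum>k<N. taylor_coeff g j k * x ^ j * y ^ k)\<bar>
       = \<bar>(\<Sum>k<N. H k N (s k, 0) / fact N * x ^ N / fact k * y ^ k) + G N (x, t) / fact N * y ^ N\<bar>"
      by simp
    also have "\<dots> \<le> (\<Sum>k<N. \<bar>H k N (s k, 0) / fact N * x ^ N / fact k * y ^ k\<bar>) + \<bar>G N (x, t) / fact N * y ^ N\<bar>"
      by (rule order.trans[OF abs_triangle_ineq add_right_mono[OF sum_abs]])
    also have "\<dots> \<le> (\<Sum>k<N. K k * \<bar>x\<bar> ^ N) + B * \<bar>y\<bar> ^ N"
    proof (intro add_mono sum_mono)
      have fa: "1 \<le> (fact k :: real)" for k by simp
      fix k assume "k \<in> {..<N}"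
      have "\<bar>H k N (s k, 0)\<bar> \<le> K k" using K(2)[of "s k" 0 k] s(1)[of k] x \<delta> by simp
      moreover have "\<bar>y\<bar> ^ k \<le> 1" using y \<delta> by (intro power_le_one) auto
      ultimately have "\<bar>H k N (s k, 0)\<bar> / fact N * \<bar>x\<bar> ^ N / fact k * \<bar>y\<bar> ^ k \<le> K k / 1 * \<bar>x\<bar> ^ N / 1 * 1"
        using fa K(1)[of k] by (intro mult_mono frac_le order.refl) (auto intro!: divide_nonneg_nonneg mult_nonneg_nonneg)
      then show "\<bar>H k N (s k, 0) / fact N * x ^ N / fact k * y ^ k\<bar> \<le> K k * \<bar>x\<bar> ^ N"
        by (simp add: abs_mult power_abs)
    next
      have "\<bar>G N (x, t)\<bar> / fact N * \<bar>y\<bar> ^ N \<le> B / 1 * \<bar>y\<bar> ^ N"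
        using B(1) B(2)[of x t] x y t(1) by (intro mult_mono frac_le order.refl) auto
      then show "\<bar>G N (x, t) / fact N * y ^ N\<bar> \<le> B * \<bar>y\<bar> ^ N"
        by (simp add: abs_mult power_abs)
    qed
    also have "\<dots> = (\<Sum>k<N. K k) * \<bar>x\<bar> ^ N + B * \<bar>y\<bar> ^ N"
      by (simp add: sum_distrib_right)
    also have "\<dots> \<le> C * (\<bar>x\<bar> ^ N + \<bar>y\<bar> ^ N)"
      unfolding distrib_left by (intro add_mono mult_right_mono C) auto
    finally show ?thesis .
  qed
  then show "\<exists>C \<delta>. 0 < \<delta> \<and> (\<forall>x y. \<bar>x\<bar> \<le> \<delta> \<longrightarrow> \<bar>y\<bar> \<le> \<delta> \<longrightarrow>
        \<bar>g (x, y) - (\<Sum>j<N. \<Sum>k<N. taylor_coeff g j k * x ^ j * y ^ k)\<bar> \<le> C * (\<bar>x\<bar> ^ N + \<bar>y\<bar> ^ N))"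
    using \<delta>(1) by blast
qed

section \<open>Weighted orders as bounds on boxes\<close>

text \<open>All norms on polynomials of bounded degree are equivalent; here with a direct proof by induction
  on the degree.\<close>

lemma poly_coeff_bound:
  "\<exists>B\<ge>0. \<forall>(a :: nat \<Rightarrow> real) C. (\<forall>s. 0 \<le> s \<longrightarrow> s \<le> 1 \<longrightarrow> \<bar>\<Sum>k<K. a k * s ^ k\<bar> \<le> C) \<longrightarrow> (\<forall>k<K. \<bar>a k\<bar> \<le> B * C)"
proof (induction K)
  case 0
  then show ?case by auto
next
  case (Suc K)
  then obtain B where B: "B \<ge> 0"
    "\<And>(a :: nat \<Rightarrow> real) C k. (\<And>s. 0 \<le> s \<Longrightarrow> s \<le> 1 \<Longrightarrow> \<bar>\<Sum>k<K. a k * s ^ k\<bar> \<le> C) \<Longrightarrow> k < K \<Longrightarrow> \<bar>a k\<bar> \<le> B * C"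
    by blast
  define B1 where "B1 = B * (1 + 2 ^ K)"
  have B1: "B1 \<ge> 0" using B(1) by (simp add: B1_def)
  have "\<bar>a k\<bar> \<le> (B1 + 1 + K * B1) * C"
    if p: "\<And>s. 0 \<le> s \<Longrightarrow> s \<le> 1 \<Longrightarrow> \<bar>\<Sum>k<Suc K. a k * s ^ k\<bar> \<le> C" and k: "k < Suc K" for a :: "nat \<Rightarrow> real" and C k
  proof -
    have C: "C \<ge> 0" using p[of 0] by linarith
    have low: "\<bar>a k\<bar> \<le> B1 * C" if k: "k < K" for k
    proof -
      let ?b = "\<lambda>k. a k * (1 - 2 ^ K / 2 ^ k)"
      have "\<bar>\<Sum>k<K. ?b k * s ^ k\<bar> \<le> (1 + 2 ^ K) * C" if s: "0 \<le> s" "s \<le> 1" for s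
      proof -
        \<comment> \<open>Subtracting the dilated polynomial removes the top coefficient.\<close>
        have "(\<Sum>k<K. ?b k * s ^ k) = (\<Sum>k<Suc K. ?b k * s ^ k)" by simp
        also have "\<dots> = (\<Sum>k<Suc K. a k * s ^ k - 2 ^ K * (a k * (s / 2) ^ k))"
          by (intro sum.cong refl) (simp add: power_divide algebra_simps)
        also have "\<dots> = (\<Sum>k<Suc K. a k * s ^ k) - 2 ^ K * (\<Sum>k<Suc K. a k * (s / 2) ^ k)"
          by (simp only: sum_subtractf sum_distrib_left)
        finally have eq: "(\<Sum>k<K. ?b k * s ^ k) = (\<Sum>k<Suc K. a k * s ^ k) - 2 ^ K * (\<Sum>k<Suc K. a k * (s / 2) ^ k)" .
        have "\<bar>2 ^ K * (\<Sum>k<Suc K. a k * (s / 2) ^ k)\<bar> \<le> 2 ^ K * C"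
          unfolding abs_mult using p[of "s / 2"] s by (intro mult_mono) auto
        with p[OF s] show ?thesis unfolding eq by (simp only: distrib_right mult_1_left)
      qed
      from B(2)[OF this k] have "\<bar>a k\<bar> * \<bar>1 - 2 ^ K / 2 ^ k\<bar> \<le> B1 * C"
        by (simp add: abs_mult B1_def mult.assoc)
      moreover have "1 \<le> \<bar>1 - 2 ^ K / 2 ^ k :: real\<bar>"
      proof -
        have "2 ^ Suc k \<le> (2 ^ K :: real)" using k by (intro power_increasing) auto
        then have "2 \<le> (2 ^ K / 2 ^ k :: real)" by (simp add: le_divide_eq)
        then show ?thesis by linarith
      qed
      ultimately show ?thesis using mult_left_mono[of 1 "\<bar>1 - 2 ^ K / 2 ^ k\<bar>" "\<bar>a k\<bar>"] by simp
    qed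
    have KB: "0 \<le> K * (B1 * C)" "0 \<le> B1 * C" using B1 C by auto
    show ?thesis
    proof (cases "k < K")
      case True
      then show ?thesis using low[of k] C KB by (simp add: algebra_simps)
    next
      case False
      then have [simp]: "k = K" using k by simp
      have "a K = (\<Sum>k<Suc K. a k * 1 ^ k) - (\<Sum>k<K. a k)" by simp
      moreover have "\<bar>\<Sum>k<K. a k\<bar> \<le> (\<Sum>k<K. B1 * C)"
        by (rule order.trans[OF sum_abs]) (intro sum_mono low, simp)
      ultimately have "\<bar>a K\<bar> \<le> C + K * (B1 * C)" using p[of 1] by simp
      then show ?thesis using KB by (simp add: algebra_simps)
    qed
  qed
  moreover have "B1 + 1 + K * B1 \<ge> 0" using B1 by simp
  ultimately show ?case by blast
qed

lemma poly2_coeff_bound: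
  "\<exists>B\<ge>0. \<forall>(c :: nat \<Rightarrow> nat \<Rightarrow> real) C. (\<forall>s u. 0 \<le> s \<longrightarrow> s \<le> 1 \<longrightarrow> 0 \<le> u \<longrightarrow> u \<le> 1 \<longrightarrow> \<bar>\<Sum>j<K. \<Sum>k<K. c j k * s ^ j * u ^ k\<bar> \<le> C)
      \<longrightarrow> (\<forall>j<K. \<forall>k<K. \<bar>c j k\<bar> \<le> B * C)"
proof -
  obtain B where B: "B \<ge> 0"
    "\<And>(a :: nat \<Rightarrow> real) C k. (\<And>s. 0 \<le> s \<Longrightarrow> s \<le> 1 \<Longrightarrow> \<bar>\<Sum>k<K. a k * s ^ k\<bar> \<le> C) \<Longrightarrow> k < K \<Longrightarrow> \<bar>a k\<bar> \<le> B * C"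
    using poly_coeff_bound[of K] by blast
  have "\<bar>c j k\<bar> \<le> (B * B) * C"
    if c: "\<And>s u. 0 \<le> s \<Longrightarrow> s \<le> 1 \<Longrightarrow> 0 \<le> u \<Longrightarrow> u \<le> 1 \<Longrightarrow> \<bar>\<Sum>j<K. \<Sum>k<K. c j k * s ^ j * u ^ k\<bar> \<le> C"
      and jk: "j < K" "k < K" for c :: "nat \<Rightarrow> nat \<Rightarrow> real" and C j k
  proof -
    have 1: "\<bar>\<Sum>k<K. c j k * u ^ k\<bar> \<le> B * C" if u: "0 \<le> u" "u \<le> 1" for u
    proof (rule B(2)[OF _ jk(1)])
      fix s :: real assume "0 \<le> s" "s \<le> 1"
      from c[OF this u] show "\<bar>\<Sum>j<K. (\<Sum>k<K. c j k * u ^ k) * s ^ j\<bar> \<le> C"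
        unfolding sum_distrib_right by (simp only: mult_ac)
    qed
    show ?thesis using B(2)[OF 1 jk(2)] by (simp add: mult.assoc)
  qed
  then show ?thesis using B(1) by (intro exI[of _ "B * B"]) simp
qed

text \<open>The analytic form of having order at least \<open>M\<close> for the weights \<open>v\<close> and \<open>w\<close>.\<close>

definition box_bound :: "(real \<times> real \<Rightarrow> real) \<Rightarrow> real \<Rightarrow> real \<Rightarrow> real \<Rightarrow> bool" where
  "box_bound g v w M \<longleftrightarrow>
     (\<exists>C \<delta>. 0 < \<delta> \<and> (\<forall>t x y. 0 < t \<longrightarrow> t \<le> \<delta> \<longrightarrow> \<bar>x\<bar> \<le> t powr v \<longrightarrow> \<bar>y\<bar> \<le> t powr w \<longrightarrow>
        \<bar>g (x, y)\<bar> \<le> C * t powr M))"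

definition weight_ge :: "(nat \<Rightarrow> nat \<Rightarrow> real) \<Rightarrow> real \<Rightarrow> real \<Rightarrow> real \<Rightarrow> bool" where
  "weight_ge c v w M \<longleftrightarrow> (\<forall>j k. c j k \<noteq> 0 \<longrightarrow> M \<le> v * real j + w * real k)"

lemma le_zero_if_le_small_powr:
  fixes a K e \<delta> :: real
  assumes "0 < e" "0 < \<delta>" "\<And>t. 0 < t \<Longrightarrow> t \<le> \<delta> \<Longrightarrow> a \<le> K * t powr e"
  shows "a \<le> 0"
proof (rule ccontr)
  assume "\<not> a \<le> 0"
  then have a: "a > 0" by simp
  define K' where "K' = max K 1"
  have K': "K' > 0" "K \<le> K'" by (auto simp: K'_def)
  \<comment> \<open>Chosen such that \<open>K' * t powr e \<le> a / 2\<close>.\<close>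
  define t where "t = min \<delta> ((a / (2 * K')) powr (1 / e))"
  have t: "0 < t" "t \<le> \<delta>" using a K' assms(2) by (auto simp: t_def)
  have "t powr e \<le> ((a / (2 * K')) powr (1 / e)) powr e"
    using t assms(1) by (intro powr_mono2) (auto simp: t_def)
  also have "\<dots> = a / (2 * K')" using a K' assms(1) by (simp add: powr_powr)
  finally have "K' * t powr e \<le> a / 2" using K' by (simp add: field_simps)
  moreover have "K * t powr e \<le> K' * t powr e" using K' by (intro mult_right_mono) auto
  ultimately show False using assms(3)[OF t] a by linarith
qed

lemma box_bound_scaled:
  assumes "box_bound g v w M" "0 < v" "0 < w"
  shows "\<exists>C \<delta>. 0 < \<delta> \<and> (\<forall>t x y. 0 < t \<longrightarrow> t \<le> \<delta> \<longrightarrow> \<bar>x\<bar> \<le> K * t powr v \<longrightarrow> \<bar>y\<bar> \<le> K * t powr w \<longrightarrow>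
        \<bar>g (x, y)\<bar> \<le> C * t powr M)"
proof -
  obtain C \<delta> where \<delta>: "0 < \<delta>"
    and C: "\<And>t x y. 0 < t \<Longrightarrow> t \<le> \<delta> \<Longrightarrow> \<bar>x\<bar> \<le> t powr v \<Longrightarrow> \<bar>y\<bar> \<le> t powr w \<Longrightarrow> \<bar>g (x, y)\<bar> \<le> C * t powr M"
    using assms(1) unfolding box_bound_def by blast
  define K' where "K' = max K 1"
  have K': "K' \<ge> K" "K' \<ge> 1" by (auto simp: K'_def)
  define l where "l = max (K' powr (1 / v)) (K' powr (1 / w))"
  have l: "l > 0" using K' by (auto simp: l_def less_max_iff_disj)
  have lv: "K' \<le> l powr v"
  proof -
    have "K' = (K' powr (1 / v)) powr v" using K' assms by (simp add: powr_powr)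
    also have "\<dots> \<le> l powr v" using assms K' by (intro powr_mono2) (auto simp: l_def)
    finally show ?thesis .
  qed
  have lw: "K' \<le> l powr w"
  proof -
    have "K' = (K' powr (1 / w)) powr w" using K' assms by (simp add: powr_powr)
    also have "\<dots> \<le> l powr w" using assms K' by (intro powr_mono2) (auto simp: l_def)
    finally show ?thesis .
  qed
  have "\<bar>g (x, y)\<bar> \<le> (C * l powr M) * t powr M"
    if t: "0 < t" "t \<le> \<delta> / l" and x: "\<bar>x\<bar> \<le> K * t powr v" and y: "\<bar>y\<bar> \<le> K * t powr w" for t x y
  proof -
    have "K * t powr v \<le> l powr v * t powr v" "K * t powr w \<le> l powr w * t powr w"
      using lv lw K' by (auto intro!: mult_right_mono)
    then have "\<bar>x\<bar> \<le> l powr v * t powr v" "\<bar>y\<bar> \<le> l powr w * t powr w"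
      using x y by linarith+
    then have "\<bar>x\<bar> \<le> (l * t) powr v" "\<bar>y\<bar> \<le> (l * t) powr w"
      using t l by (auto simp: powr_mult)
    then have "\<bar>g (x, y)\<bar> \<le> C * (l * t) powr M"
      using t l by (intro C) (auto simp: field_simps)
    then show ?thesis using t l by (simp add: powr_mult mult.assoc)
  qed
  moreover have "\<delta> / l > 0" using \<delta> l by simp
  ultimately show ?thesis by blast
qed

lemma has_taylor_box:
  assumes "has_taylor g c" "0 < v" "0 < w"
  shows "\<exists>C \<delta>. 0 < \<delta> \<and> 0 \<le> C \<and> \<delta> \<le> 1 \<and> (\<forall>t x y. 0 < t \<longrightarrow> t \<le> \<delta> \<longrightarrow> \<bar>x\<bar> \<le> t powr v \<longrightarrow> \<bar>y\<bar> \<le> t powr w \<longrightarrow>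
        \<bar>g (x, y) - (\<Sum>j<N. \<Sum>k<N. c j k * x ^ j * y ^ k)\<bar> \<le> C * (t powr (v * N) + t powr (w * N)))"
proof -
  obtain C \<delta> where \<delta>: "0 < \<delta>"
    and C: "\<And>x y. \<bar>x\<bar> \<le> \<delta> \<Longrightarrow> \<bar>y\<bar> \<le> \<delta> \<Longrightarrow>
       \<bar>g (x, y) - (\<Sum>j<N. \<Sum>k<N. c j k * x ^ j * y ^ k)\<bar> \<le> C * (\<bar>x\<bar> ^ N + \<bar>y\<bar> ^ N)"
    using assms(1) unfolding has_taylor_def by blast
  define \<epsilon> where "\<epsilon> = min 1 (min (\<delta> powr (1 / v)) (\<delta> powr (1 / w)))"
  have \<epsilon>: "\<epsilon> > 0" "\<epsilon> \<le> 1" using \<delta> by (auto simp: \<epsilon>_def)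
  have "\<bar>g (x, y) - (\<Sum>j<N. \<Sum>k<N. c j k * x ^ j * y ^ k)\<bar> \<le> max C 0 * (t powr (v * N) + t powr (w * N))"
    if t: "0 < t" "t \<le> \<epsilon>" and x: "\<bar>x\<bar> \<le> t powr v" and y: "\<bar>y\<bar> \<le> t powr w" for t x y
  proof -
    have "t powr v \<le> (\<delta> powr (1 / v)) powr v" "t powr w \<le> (\<delta> powr (1 / w)) powr w"
      using t assms by (auto intro!: powr_mono2 simp: \<epsilon>_def)
    then have "\<bar>x\<bar> \<le> \<delta>" "\<bar>y\<bar> \<le> \<delta>" using x y \<delta> assms by (auto simp: powr_powr)
    note C[OF this]
    also have "C * (\<bar>x\<bar> ^ N + \<bar>y\<bar> ^ N) \<le> max C 0 * ((t powr v) ^ N + (t powr w) ^ N)"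
      using x y by (intro mult_mono add_mono power_mono) auto
    also have "(t powr v) ^ N + (t powr w) ^ N = t powr (v * N) + t powr (w * N)"
      using t by (simp add: powr_powr[symmetric] powr_realpow)
    finally show ?thesis .
  qed
  moreover have "0 \<le> max C 0" by simp
  ultimately show ?thesis using \<epsilon> by blast
qed

lemma box_bound_if_weight_ge:
  assumes "has_taylor g c" "weight_ge c v w M" "0 < v" "0 < w"
  shows "box_bound g v w M"
proof -
  obtain N1 N2 :: nat where N12: "M / v \<le> N1" "M / w \<le> N2" using real_arch_simple by metis
  define N where "N = max N1 N2"
  have "M / v \<le> N" "M / w \<le> N" using N12 by (auto simp: N_def)
  then have N: "M \<le> v * N" "M \<le> w * N" using assms by (auto simp: field_simps)
  obtain C \<delta> where C: "0 < \<delta>" "0 \<le> C" "\<delta> \<le> 1"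
    "\<And>t x y. 0 < t \<Longrightarrow> t \<le> \<delta> \<Longrightarrow> \<bar>x\<bar> \<le> t powr v \<Longrightarrow> \<bar>y\<bar> \<le> t powr w \<Longrightarrow>
        \<bar>g (x, y) - (\<Sum>j<N. \<Sum>k<N. c j k * x ^ j * y ^ k)\<bar> \<le> C * (t powr (v * N) + t powr (w * N))"
    using has_taylor_box[OF assms(1,3,4), of N] by blast
  define S where "S = (\<Sum>j<N. \<Sum>k<N. \<bar>c j k\<bar>)"
  have "\<bar>g (x, y)\<bar> \<le> (S + C * 2) * t powr M"
    if t: "0 < t" "t \<le> \<delta>" and x: "\<bar>x\<bar> \<le> t powr v" and y: "\<bar>y\<bar> \<le> t powr w" for t x y
  proof -
    have t1: "t \<le> 1" using t C by simp
    have mono: "t powr a \<le> t powr M" if "M \<le> a" for a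
      using t t1 that by (intro powr_mono') auto
    have trm: "\<bar>c j k * x ^ j * y ^ k\<bar> \<le> \<bar>c j k\<bar> * t powr M" for j k
    proof (cases "c j k = 0")
      case False
      have "\<bar>x\<bar> ^ j * \<bar>y\<bar> ^ k \<le> (t powr v) ^ j * (t powr w) ^ k"
        using x y by (intro mult_mono power_mono) auto
      also have "\<dots> = t powr (v * j + w * k)"
        using t by (simp add: powr_add powr_powr[symmetric] powr_realpow)
      also have "\<dots> \<le> t powr M" using assms(2) False by (intro mono) (auto simp: weight_ge_def)
      finally show ?thesis by (simp add: abs_mult power_abs mult.assoc mult_left_mono)
    qed simp
    have "\<bar>\<Sum>j<N. \<Sum>k<N. c j k * x ^ j * y ^ k\<bar> \<le> (\<Sum>j<N. \<Sum>k<N. \<bar>c j k\<bar> * t powr M)"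
      by (intro order.trans[OF sum_abs] sum_mono trm)
    also have "\<dots> = S * t powr M" by (simp add: S_def sum_distrib_right)
    finally have "\<bar>\<Sum>j<N. \<Sum>k<N. c j k * x ^ j * y ^ k\<bar> \<le> S * t powr M" .
    moreover have "C * (t powr (v * N) + t powr (w * N)) \<le> C * (t powr M + t powr M)"
      using C(2) N by (intro mult_left_mono add_mono mono) auto
    ultimately show ?thesis using C(4)[OF t x y] by (simp only: distrib_right mult_2_right distrib_left)
  qed
  then show ?thesis unfolding box_bound_def using C(1) by blast
qed

text \<open>After the substitution \<open>x = t powr v * s\<close>, \<open>y = t powr w * u\<close> a Taylor polynomial becomes a
  polynomial in \<open>s\<close> and \<open>u\<close> on the unit square. A bound of the values bounds each coefficient
  \<open>c j k * t powr (v j + w k)\<close> by a multiple of \<open>t powr M\<close>, which for \<open>t\<close> tending to \<open>0\<close>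
  leaves only exponents that are at least \<open>M\<close>.\<close>

lemma weight_ge_if_box_bound:
  assumes "has_taylor g c" "box_bound g v w M" "0 < v" "0 < w"
  shows "weight_ge c v w M"
  unfolding weight_ge_def
proof (intro allI impI)
  fix j k assume nz: "c j k \<noteq> 0"
  obtain N1 N2 :: nat where N12: "M / v \<le> N1" "M / w \<le> N2" using real_arch_simple by metis
  \<comment> \<open>Large enough for the remainder to be of order \<open>M\<close> and for the polynomial to contain the
    coefficient \<open>c j k\<close>.\<close>
  define N where "N = max (max N1 N2) (Suc (max j k))"
  have "real N1 \<le> N" "real N2 \<le> N" and jk: "j < N" "k < N" by (auto simp: N_def)
  then have "M / v \<le> N" "M / w \<le> N" using N12 by linarith+
  then have N: "M \<le> v * N" "M \<le> w * N" using assms by (auto simp: field_simps)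
  obtain C \<delta> where C: "0 < \<delta>" "0 \<le> C" "\<delta> \<le> 1"
    "\<And>t x y. 0 < t \<Longrightarrow> t \<le> \<delta> \<Longrightarrow> \<bar>x\<bar> \<le> t powr v \<Longrightarrow> \<bar>y\<bar> \<le> t powr w \<Longrightarrow>
        \<bar>g (x, y) - (\<Sum>j<N. \<Sum>k<N. c j k * x ^ j * y ^ k)\<bar> \<le> C * (t powr (v * N) + t powr (w * N))"
    using has_taylor_box[OF assms(1,3,4), of N] by blast
  obtain C' \<delta>' where C': "0 < \<delta>'"
    "\<And>t x y. 0 < t \<Longrightarrow> t \<le> \<delta>' \<Longrightarrow> \<bar>x\<bar> \<le> t powr v \<Longrightarrow> \<bar>y\<bar> \<le> t powr w \<Longrightarrow> \<bar>g (x, y)\<bar> \<le> C' * t powr M"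
    using assms(2) unfolding box_bound_def by blast
  obtain B where B: "B \<ge> 0" "\<forall>(c :: nat \<Rightarrow> nat \<Rightarrow> real) C. (\<forall>s u. 0 \<le> s \<longrightarrow> s \<le> 1 \<longrightarrow> 0 \<le> u \<longrightarrow> u \<le> 1 \<longrightarrow> \<bar>\<Sum>j<N. \<Sum>k<N. c j k * s ^ j * u ^ k\<bar> \<le> C)
      \<longrightarrow> (\<forall>j<N. \<forall>k<N. \<bar>c j k\<bar> \<le> B * C)"
    using poly2_coeff_bound[of N] by blast
  show "M \<le> v * real j + w * real k"
  proof (rule ccontr)
    assume "\<not> ?thesis"
    then have e: "0 < M - (v * real j + w * real k)" by simp
    have "\<bar>c j k\<bar> \<le> (B * (C' + C * 2)) * t powr (M - (v * real j + w * real k))"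
      if t: "0 < t" "t \<le> min \<delta> \<delta>'" for t
    proof -
      have t1: "t \<le> 1" using t C by simp
      have mono: "t powr a \<le> t powr M" if "M \<le> a" for a
        using t t1 that by (intro powr_mono') auto
      have "\<bar>c j k * t powr (v * real j + w * real k)\<bar> \<le> B * ((C' + C * 2) * t powr M)"
      proof (rule B(2)[rule_format, OF _ jk])
        fix s u :: real assume s: "0 \<le> s" "s \<le> 1" "0 \<le> u" "u \<le> 1"
        let ?x = "t powr v * s" and ?y = "t powr w * u"
        have xy: "\<bar>?x\<bar> \<le> t powr v" "\<bar>?y\<bar> \<le> t powr w"
          using s by (auto simp: abs_mult intro!: mult_left_le)
        have "C * (t powr (v * N) + t powr (w * N)) \<le> C * (t powr M + t powr M)"
          using C(2) N by (intro mult_left_mono add_mono mono) auto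
        with C(4)[OF _ _ xy] C'(2)[OF _ _ xy] t
        have "\<bar>\<Sum>j<N. \<Sum>k<N. c j k * ?x ^ j * ?y ^ k\<bar> \<le> C' * t powr M + C * (t powr M + t powr M)"
          by simp
        also have "\<dots> = (C' + C * 2) * t powr M" by (simp add: algebra_simps)
        also have "(\<Sum>j<N. \<Sum>k<N. c j k * ?x ^ j * ?y ^ k)
            = (\<Sum>j<N. \<Sum>k<N. c j k * t powr (v * real j + w * real k) * s ^ j * u ^ k)"
          using t by (intro sum.cong refl)
            (simp add: powr_add powr_powr[symmetric] powr_realpow power_mult_distrib mult_ac)
        finally show "\<bar>\<Sum>j<N. \<Sum>k<N. c j k * t powr (v * real j + w * real k) * s ^ j * u ^ k\<bar>
            \<le> (C' + C * 2) * t powr M" .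
      qed
      then have "\<bar>c j k\<bar> * t powr (v * real j + w * real k) \<le> B * ((C' + C * 2) * t powr M)"
        by (simp add: abs_mult)
      then show ?thesis using t by (simp add: powr_diff field_simps)
    qed
    moreover have "0 < min \<delta> \<delta>'" using C(1) C'(1) by simp
    ultimately have "\<bar>c j k\<bar> \<le> 0" using le_zero_if_le_small_powr[OF e] by blast
    then show False using nz by simp
  qed
qed

section \<open>Initial forms\<close>

lemma weight_ge_nat: "weight_ge c 1 (real q) (real m) \<longleftrightarrow> (\<forall>j k. c j k \<noteq> 0 \<longrightarrow> m \<le> j + q * k)"
  unfolding weight_ge_def mult_1_left of_nat_mult[symmetric] of_nat_add[symmetric] of_nat_le_iff ..

text \<open>The part of weight \<open>m\<close> for the weights \<open>(1, q)\<close>, with the first variable set to \<open>1\<close>. It is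
  the initial form when \<open>m\<close> is the order.\<close>

definition init_poly :: "(nat \<Rightarrow> nat \<Rightarrow> real) \<Rightarrow> nat \<Rightarrow> nat \<Rightarrow> real poly" where
  "init_poly c q m = (\<Sum>k | k \<le> m \<and> q * k \<le> m. monom (c (m - q * k) k) k)"

lemma coeff_init_poly: "coeff (init_poly c q m) k = (if k \<le> m \<and> q * k \<le> m then c (m - q * k) k else 0)"
proof -
  have "coeff (init_poly c q m) k = (\<Sum>i | i \<le> m \<and> q * i \<le> m. if i = k then c (m - q * i) i else 0)"
    unfolding init_poly_def coeff_sum coeff_monom ..
  also have "\<dots> = (if k \<le> m \<and> q * k \<le> m then c (m - q * k) k else 0)"
    by (subst sum.delta) auto
  finally show ?thesis .
qed

lemma poly_init_poly:
  assumes "1 \<le> q"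
  shows "poly (init_poly c q m) s = (\<Sum>j<Suc m. \<Sum>k<Suc m. c j k * s ^ k * of_bool (j + q * k = m))"
proof -
  have "(\<Sum>j<Suc m. \<Sum>k<Suc m. c j k * s ^ k * of_bool (j + q * k = m))
      = (\<Sum>k<Suc m. \<Sum>j<Suc m. c j k * s ^ k * of_bool (j + q * k = m))"
    by (rule sum.swap)
  also have "\<dots> = (\<Sum>k<Suc m. if q * k \<le> m then c (m - q * k) k * s ^ k else 0)"
  proof (intro sum.cong refl)
    fix k
    have "(\<Sum>j<Suc m. c j k * s ^ k * of_bool (j + q * k = m))
        = (\<Sum>j<Suc m. if j = m - q * k then (if q * k \<le> m then c j k * s ^ k else 0) else 0)"
      by (intro sum.cong refl) auto
    also have "\<dots> = (if q * k \<le> m then c (m - q * k) k * s ^ k else 0)"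
      by (subst sum.delta) auto
    finally show "(\<Sum>j<Suc m. c j k * s ^ k * of_bool (j + q * k = m))
        = (if q * k \<le> m then c (m - q * k) k * s ^ k else 0)" .
  qed
  also have "\<dots> = (\<Sum>k | k \<le> m \<and> q * k \<le> m. c (m - q * k) k * s ^ k)"
    by (subst sum.inter_filter[symmetric]) (auto intro!: sum.cong)
  also have "\<dots> = poly (init_poly c q m) s"
    by (simp add: init_poly_def poly_sum poly_monom)
  finally show ?thesis by simp
qed

text \<open>A function is approximated by its initial form on every curve \<open>(a, b)\<close> that follows
  \<open>y = \<sigma> x\<^sup>q\<close> to leading order.\<close>

lemma init_limit:
  fixes a b :: "real \<Rightarrow> real"
  assumes g: "has_taylor g c" and q: "1 \<le> q" and w: "weight_ge c 1 (real q) (real m)"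
    and a: "((\<lambda>t. a t / t) \<longlongrightarrow> 1) (at_right 0)"
    and b: "((\<lambda>t. b t / t ^ q) \<longlongrightarrow> \<sigma>) (at_right 0)"
  shows "((\<lambda>t. g (a t, b t) / t ^ m) \<longlongrightarrow> poly (init_poly c q m) \<sigma>) (at_right 0)"
proof -
  define N where "N = Suc m"
  have pos: "\<forall>\<^sub>F t in at_right (0::real). 0 < t" by (rule eventually_at_right_less)
  have t0: "((\<lambda>t. t) \<longlongrightarrow> 0) (at_right (0::real))" by (rule tendsto_ident_at)
  have tp: "((\<lambda>t. t ^ n) \<longlongrightarrow> 0) (at_right (0::real))" if "n > 0" for n
    using tendsto_power[OF t0, of n] that by simp
  obtain C \<delta> where \<delta>: "0 < \<delta>"
    and C: "\<And>x y. \<bar>x\<bar> \<le> \<delta> \<Longrightarrow> \<bar>y\<bar> \<le> \<delta> \<Longrightarrow>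
       \<bar>g (x, y) - (\<Sum>j<N. \<Sum>k<N. c j k * x ^ j * y ^ k)\<bar> \<le> C * (\<bar>x\<bar> ^ N + \<bar>y\<bar> ^ N)"
    using g unfolding has_taylor_def by blast
  let ?T = "\<lambda>t. \<Sum>j<N. \<Sum>k<N. c j k * a t ^ j * b t ^ k"
  have lim0: "(a \<longlongrightarrow> 0) (at_right 0)" "(b \<longlongrightarrow> 0) (at_right 0)"
  proof -
    have "((\<lambda>t. a t / t * t) \<longlongrightarrow> 1 * 0) (at_right 0)" by (intro tendsto_mult a t0)
    moreover have "\<forall>\<^sub>F t in at_right 0. a t / t * t = a t" using pos by eventually_elim simp
    ultimately show "(a \<longlongrightarrow> 0) (at_right 0)" using Lim_transform_eventually by fastforce
  next
    have "((\<lambda>t. b t / t ^ q * t ^ q) \<longlongrightarrow> \<sigma> * 0) (at_right 0)" using q by (intro tendsto_mult b tp) auto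
    moreover have "\<forall>\<^sub>F t in at_right 0. b t / t ^ q * t ^ q = b t" using pos by eventually_elim simp
    ultimately show "(b \<longlongrightarrow> 0) (at_right 0)" using Lim_transform_eventually by fastforce
  qed
  have E: "((\<lambda>t. (g (a t, b t) - ?T t) / t ^ m) \<longlongrightarrow> 0) (at_right 0)"
  proof (rule Lim_null_comparison)
    let ?B = "\<lambda>t. C * (\<bar>a t / t\<bar> ^ N * t + \<bar>b t / t ^ q\<bar> ^ N * t ^ (q * N - m))"
    have "1 * N \<le> q * N" using q by (rule mult_le_mono1)
    then have m: "m < q * N" by (simp add: N_def)
    have "\<forall>\<^sub>F t in at_right 0. \<bar>a t\<bar> < \<delta>" "\<forall>\<^sub>F t in at_right 0. \<bar>b t\<bar> < \<delta>"
      using tendstoD[OF lim0(1) \<delta>] tendstoD[OF lim0(2) \<delta>] by (simp_all add: dist_norm)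
    then show "\<forall>\<^sub>F t in at_right 0. norm ((g (a t, b t) - ?T t) / t ^ m) \<le> ?B t"
      using pos
    proof eventually_elim
      case (elim t)
      have e1: "\<bar>a t\<bar> ^ N = \<bar>a t / t\<bar> ^ N * t * t ^ m"
        using elim by (simp add: N_def power_divide)
      have "t ^ (q * N) = t ^ (q * N - m) * t ^ m"
        using m by (simp add: power_add[symmetric])
      then have e2: "\<bar>b t\<bar> ^ N = \<bar>b t / t ^ q\<bar> ^ N * t ^ (q * N - m) * t ^ m"
        using elim by (simp add: power_divide power_mult[symmetric] mult.assoc)
      have "\<bar>g (a t, b t) - ?T t\<bar> \<le> C * (\<bar>a t\<bar> ^ N + \<bar>b t\<bar> ^ N)"
        using elim by (intro C) auto
      also have "\<dots> = ?B t * t ^ m"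
        unfolding e1 e2 by (simp add: algebra_simps)
      finally show ?case using elim by (simp add: field_simps)
    qed
    have "(?B \<longlongrightarrow> C * (\<bar>1\<bar> ^ N * 0 + \<bar>\<sigma>\<bar> ^ N * 0)) (at_right 0)"
      using m by (intro tendsto_intros a b t0 tp) auto
    then show "(?B \<longlongrightarrow> 0) (at_right 0)" by simp
  qed
  have "((\<lambda>t. c j k * (a t / t) ^ j * (b t / t ^ q) ^ k * t ^ (j + q * k - m)) \<longlongrightarrow>
      c j k * \<sigma> ^ k * of_bool (j + q * k = m)) (at_right 0)" for j k
  proof (cases "c j k = 0")
    case False
    then have m: "m \<le> j + q * k" using w weight_ge_nat by blast
    have "((\<lambda>t. t ^ (j + q * k - m)) \<longlongrightarrow> of_bool (j + q * k = m)) (at_right (0::real))"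
      using m tp[of "j + q * k - m"] by (cases "j + q * k = m") auto
    then have "((\<lambda>t. c j k * (a t / t) ^ j * (b t / t ^ q) ^ k * t ^ (j + q * k - m)) \<longlongrightarrow>
      c j k * 1 ^ j * \<sigma> ^ k * of_bool (j + q * k = m)) (at_right 0)"
      by (intro tendsto_intros a b)
    then show ?thesis by simp
  qed simp
  then have "((\<lambda>t. (g (a t, b t) - ?T t) / t ^ m + (\<Sum>j<N. \<Sum>k<N. c j k * (a t / t) ^ j * (b t / t ^ q) ^ k * t ^ (j + q * k - m)))
      \<longlongrightarrow> 0 + (\<Sum>j<N. \<Sum>k<N. c j k * \<sigma> ^ k * of_bool (j + q * k = m))) (at_right 0)"
    by (intro tendsto_add E tendsto_sum)
  moreover have "\<forall>\<^sub>F t in at_right 0. (g (a t, b t) - ?T t) / t ^ m + (\<Sum>j<N. \<Sum>k<N. c j k * (a t / t) ^ j * (b t / t ^ q) ^ k * t ^ (j + q * k - m))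
      = g (a t, b t) / t ^ m"
    using pos
  proof eventually_elim
    case (elim t)
    have "c j k * (a t / t) ^ j * (b t / t ^ q) ^ k * t ^ (j + q * k - m) = c j k * a t ^ j * b t ^ k / t ^ m" for j k
    proof (cases "c j k = 0")
      case False
      then have m: "m \<le> j + q * k" using w weight_ge_nat by blast
      have "t ^ (j + q * k - m) = t ^ j * (t ^ q) ^ k / t ^ m"
        using elim m by (simp add: power_diff power_add power_mult)
      then show ?thesis using elim by (simp add: power_divide)
    qed simp
    then show ?case by (simp add: diff_divide_distrib sum_divide_distrib)
  qed
  ultimately show ?thesis
    using poly_init_poly[OF q, of c m \<sigma>] by (simp add: N_def tendsto_cong)
qed

lemma init_exists:
  assumes "c j0 k0 \<noteq> 0" "1 \<le> q"
  shows "\<exists>m. weight_ge c 1 (real q) (real m) \<and> init_poly c q m \<noteq> 0"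
proof -
  define P where "P m \<longleftrightarrow> (\<exists>j k. c j k \<noteq> 0 \<and> j + q * k = m)" for m
  define m where "m = (LEAST m. P m)"
  have "P (j0 + q * k0)" using assms by (auto simp: P_def)
  then have Pm: "P m" unfolding m_def by (rule LeastI)
  have "weight_ge c 1 (real q) (real m)"
    unfolding weight_ge_nat
  proof (intro allI impI)
    fix j k assume "c j k \<noteq> 0"
    then have "P (j + q * k)" by (auto simp: P_def)
    then show "m \<le> j + q * k" unfolding m_def by (rule Least_le)
  qed
  moreover obtain j k where jk: "c j k \<noteq> 0" "j + q * k = m" using Pm by (auto simp: P_def)
  have "1 * k \<le> q * k" using assms(2) by (rule mult_le_mono1)
  then have "k \<le> m" using jk by linarith
  then have "coeff (init_poly c q m) k \<noteq> 0" using jk by (auto simp: coeff_init_poly)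
  then have "init_poly c q m \<noteq> 0" by auto
  ultimately show ?thesis by blast
qed

text \<open>A substitution that, to leading order, translates the slope \<open>s\<close> of the curve \<open>y = s x\<^sup>q\<close> by
  \<open>\<beta>\<close> acts on the initial form as the same translation, since both initial forms are the limits
  along these curves. The orders agree as well: if the order after the substitution were smaller,
  these limits would be infinite for all but finitely many \<open>s\<close>.\<close>

lemma init_transfer:
  assumes g: "has_taylor g c" and G: "has_taylor G e" and q: "1 \<le> q"
    and w: "weight_ge c 1 (real q) (real m)"
    and sub: "\<And>s. \<exists>a b. ((\<lambda>t. a t / t) \<longlongrightarrow> 1) (at_right 0) \<and> ((\<lambda>t. b t / t ^ q) \<longlongrightarrow> s + \<beta>) (at_right 0)
       \<and> (\<forall>\<^sub>F t in at_right 0. G (t, s * t ^ q) = g (a t, b t))"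
  shows "weight_ge e 1 (real q) (real m)" "init_poly e q m = pcompose (init_poly c q m) [:\<beta>, 1:]"
proof -
  have limG: "((\<lambda>t. G (t, s * t ^ q) / t ^ m) \<longlongrightarrow> poly (init_poly c q m) (s + \<beta>)) (at_right 0)" for s
  proof -
    obtain a b where a: "((\<lambda>t. a t / t) \<longlongrightarrow> 1) (at_right 0)" and b: "((\<lambda>t. b t / t ^ q) \<longlongrightarrow> s + \<beta>) (at_right 0)"
      and eq: "\<forall>\<^sub>F t in at_right 0. G (t, s * t ^ q) = g (a t, b t)"
      using sub by blast
    have "\<forall>\<^sub>F t in at_right 0. g (a t, b t) / t ^ m = G (t, s * t ^ q) / t ^ m"
      using eq by eventually_elim simp
    from Lim_transform_eventually[OF init_limit[OF g q w a b] this] show ?thesis .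
  qed
  have pos: "\<forall>\<^sub>F t in at_right (0::real). 0 < t" by (rule eventually_at_right_less)
  have lim1: "((\<lambda>t. t / t) \<longlongrightarrow> 1) (at_right (0::real))" "((\<lambda>t. s * t ^ q / t ^ q) \<longlongrightarrow> s) (at_right 0)" for s :: real
    by (rule tendsto_eventually, use pos in \<open>eventually_elim\<close>, simp)+
  have lime: "((\<lambda>t. G (t, s * t ^ q) / t ^ n) \<longlongrightarrow> poly (init_poly e q n) s) (at_right 0)"
    if "weight_ge e 1 (real q) (real n)" for s n
    by (rule init_limit[OF G q that lim1])
  show we: "weight_ge e 1 (real q) (real m)"
  proof (rule ccontr)
    assume not: "\<not> ?thesis"
    then obtain j k where "e j k \<noteq> 0" by (auto simp: weight_ge_def)
    then obtain n where n: "weight_ge e 1 (real q) (real n)" "init_poly e q n \<noteq> 0"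
      using init_exists q by blast
    have "n < m"
    proof (rule ccontr)
      assume "\<not> n < m"
      then have "weight_ge e 1 (real q) (real m)" using n(1) unfolding weight_ge_nat by fastforce
      then show False using not by simp
    qed
    have "\<exists>s. poly (init_poly e q n) s \<noteq> 0"
      using n(2) poly_all_0_iff_0 by blast
    then obtain s where s: "poly (init_poly e q n) s \<noteq> 0" by blast
    have "((\<lambda>t. G (t, s * t ^ q) / t ^ m * t ^ (m - n)) \<longlongrightarrow> poly (init_poly c q m) (s + \<beta>) * 0 ^ (m - n)) (at_right 0)"
      by (intro tendsto_mult limG tendsto_power tendsto_ident_at)
    moreover have "\<forall>\<^sub>F t in at_right 0. G (t, s * t ^ q) / t ^ m * t ^ (m - n) = G (t, s * t ^ q) / t ^ n"
      using pos by eventually_elim (use \<open>n < m\<close> in \<open>simp add: power_diff\<close>)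
    ultimately have "((\<lambda>t. G (t, s * t ^ q) / t ^ n) \<longlongrightarrow> poly (init_poly c q m) (s + \<beta>) * 0 ^ (m - n)) (at_right 0)"
      by (rule Lim_transform_eventually)
    then have "((\<lambda>t. G (t, s * t ^ q) / t ^ n) \<longlongrightarrow> 0) (at_right 0)"
      using \<open>n < m\<close> by (simp add: power_0_left)
    then show False using tendsto_unique[OF _ lime[OF n(1)]] s by fastforce
  qed
  have "poly (init_poly e q m) s = poly (pcompose (init_poly c q m) [:\<beta>, 1:]) s" for s
    using tendsto_unique[OF _ lime[OF we] limG, of s] by (simp add: poly_pcompose add.commute)
  then show "init_poly e q m = pcompose (init_poly c q m) [:\<beta>, 1:]"
    using poly_eq_poly_eq_iff by blast
qed

section \<open>Orders along a smooth curve\<close>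

lemma Ck_on_real_SucI:
  fixes f :: "real \<Rightarrow> real"
  assumes "open S" "\<And>x. x \<in> S \<Longrightarrow> (f has_field_derivative f' x) (at x)" "Ck_on n S f'"
  shows "Ck_on (Suc n) S f"
proof (rule Ck_on_SucI[OF assms(1)])
  show "(f has_derivative (*) (f' x)) (at x)" if "x \<in> S" for x
    using assms(2)[OF that] by (simp add: has_field_derivative_def)
  show "Ck_on n S (\<lambda>x. f' x * v)" for v
    by (rule Ck_on_bounded_linear[OF assms(1) bounded_linear_mult_left assms(3)])
qed

lemma smooth_on_poly: "smooth_on UNIV (poly (p :: real poly))"
  unfolding smooth_on_def
proof
  fix n show "Ck_on n UNIV (poly p)"
  proof (induction n arbitrary: p)
    case (Suc n)
    show ?case by (rule Ck_on_real_SucI[OF open_UNIV poly_DERIV Suc.IH])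
  qed (simp add: continuous_at_imp_continuous_on)
qed

lemma smooth_germ_shear_poly:
  "smooth_germ g \<Longrightarrow> poly p 0 = 0 \<Longrightarrow> smooth_germ (\<lambda>(x, y). g (x, poly p x + y))"
  using smooth_germ_shear[OF _ open_UNIV _ smooth_on_poly] by auto

lemma shear_transfer:
  assumes "has_taylor g c" "has_taylor (\<lambda>(x, y). g (x, \<eta> x + y)) e" "1 \<le> q"
    and "weight_ge c 1 (real q) (real m)" "((\<lambda>t. \<eta> t / t ^ q) \<longlongrightarrow> \<beta>) (at_right 0)"
  shows "weight_ge e 1 (real q) (real m)" "init_poly e q m = pcompose (init_poly c q m) [:\<beta>, 1:]"
proof -
  have pos: "\<forall>\<^sub>F t in at_right (0::real). 0 < t" by (rule eventually_at_right_less)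
  have "\<exists>a b. ((\<lambda>t. a t / t) \<longlongrightarrow> 1) (at_right 0) \<and> ((\<lambda>t. b t / t ^ q) \<longlongrightarrow> s + \<beta>) (at_right 0)
       \<and> (\<forall>\<^sub>F t in at_right 0. (\<lambda>(x, y). g (x, \<eta> x + y)) (t, s * t ^ q) = g (a t, b t))" for s
  proof (intro exI conjI)
    show "((\<lambda>t. t / t) \<longlongrightarrow> 1) (at_right (0::real))"
      by (rule tendsto_eventually, use pos in \<open>eventually_elim\<close>, simp)
    have "((\<lambda>t. s + \<eta> t / t ^ q) \<longlongrightarrow> s + \<beta>) (at_right 0)" by (intro tendsto_intros assms)
    moreover have "\<forall>\<^sub>F t in at_right 0. s + \<eta> t / t ^ q = (\<eta> t + s * t ^ q) / t ^ q"
      using pos by eventually_elim (simp add: add_divide_distrib)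
    ultimately show "((\<lambda>t. (\<eta> t + s * t ^ q) / t ^ q) \<longlongrightarrow> s + \<beta>) (at_right 0)"
      by (rule Lim_transform_eventually)
  qed simp
  from init_transfer[OF assms(1-4) this]
  show "weight_ge e 1 (real q) (real m)" "init_poly e q m = pcompose (init_poly c q m) [:\<beta>, 1:]" by auto
qed

text \<open>The zero curve of a function with \<open>\<partial>\<^sub>2\<theta>(0) \<noteq> 0\<close>, to any finite order, as the graph of a
  polynomial. The next coefficient is the root of the initial form of weight \<open>(1, q)\<close>, which is
  linear; shearing by it removes the term \<open>x\<^sup>q\<close> and alters no lower one. When \<open>\<partial>\<^sub>1\<theta>(0) = 0\<close>
  the curve is tangent to the first axis, which is recorded as the vanishing of the linear
  coefficient.\<close>

lemma approx_implicit:
  assumes sm: "smooth_germ \<theta>" and T: "has_taylor \<theta> c" and c: "c 0 0 = 0" "c 0 1 \<noteq> 0"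
  shows "\<exists>\<eta> e. poly \<eta> 0 = 0 \<and> (c 1 0 = 0 \<longrightarrow> coeff \<eta> 1 = 0) \<and>
     has_taylor (\<lambda>(x, y). \<theta> (x, poly \<eta> x + y)) e \<and> (\<forall>j < Suc N. e j 0 = 0)"
proof -
  have "\<exists>\<eta> e. poly \<eta> 0 = 0 \<and> (c 1 0 = 0 \<longrightarrow> coeff \<eta> 1 = 0) \<and>
     has_taylor (\<lambda>(x, y). \<theta> (x, poly \<eta> x + y)) e \<and> (\<forall>j < Suc N. e j 0 = 0) \<and> e 0 1 \<noteq> 0 \<and> (N = 0 \<longrightarrow> e = c)"
  proof (induction N)
    case 0
    have "(\<lambda>(x, y). \<theta> (x, poly 0 x + y)) = \<theta>" by auto
    then show ?case using T c by (intro exI[of _ 0] exI[of _ c]) simp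
  next
    case (Suc N)
    define q where "q = Suc N"
    from Suc obtain \<eta> e where \<eta>: "poly \<eta> 0 = 0" "c 1 0 = 0 \<longrightarrow> coeff \<eta> 1 = 0"
      and e: "has_taylor (\<lambda>(x, y). \<theta> (x, poly \<eta> x + y)) e" "\<forall>j < q. e j 0 = 0" "e 0 1 \<noteq> 0" "N = 0 \<longrightarrow> e = c"
      unfolding q_def by blast
    let ?H = "\<lambda>(x, y). \<theta> (x, poly \<eta> x + y)"
    define \<beta> where "\<beta> = - e q 0 / e 0 1"
    define \<eta>' where "\<eta>' = \<eta> + monom \<beta> q"
    have \<eta>'0: "poly \<eta>' 0 = 0" using \<eta>(1) by (simp add: \<eta>'_def q_def poly_monom)
    have H': "(\<lambda>(x, y). ?H (x, \<beta> * x ^ q + y)) = (\<lambda>(x, y). \<theta> (x, poly \<eta>' x + y))"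
      by (auto simp: \<eta>'_def poly_monom add.assoc)
    define e' where "e' = taylor_coeff (\<lambda>(x, y). \<theta> (x, poly \<eta>' x + y))"
    have e': "has_taylor (\<lambda>(x, y). \<theta> (x, poly \<eta>' x + y)) e'"
      unfolding e'_def by (intro has_taylor_smooth smooth_germ_shear_poly sm \<eta>'0)
    have w: "weight_ge e 1 (real q) (real q)"
      unfolding weight_ge_nat
    proof (intro allI impI)
      fix j k assume "e j k \<noteq> 0"
      then show "q \<le> j + q * k" using e(2) by (cases k) (auto simp: not_less[symmetric])
    qed
    have pos: "\<forall>\<^sub>F t in at_right (0::real). 0 < t" by (rule eventually_at_right_less)
    have "((\<lambda>t. \<beta> * t ^ q / t ^ q) \<longlongrightarrow> \<beta>) (at_right 0)"
      by (rule tendsto_eventually, use pos in \<open>eventually_elim\<close>, simp)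
    note tr = shear_transfer[OF e(1), of "\<lambda>t. \<beta> * t ^ q" e' q q \<beta>, unfolded H', OF e' _ w this]
    have q1: "1 \<le> q" by (simp add: q_def)
    have ip: "init_poly f q q = [:f q 0, f 0 1:]" for f
    proof (rule poly_eqI)
      fix k
      have "\<not> q * k \<le> q" if "k \<ge> 2"
      proof -
        have "q * 2 \<le> q * k" using that by (rule mult_le_mono2)
        then show ?thesis using q1 by linarith
      qed
      then show "coeff (init_poly f q q) k = coeff [:f q 0, f 0 1:] k"
        using q1 by (cases k rule: nat.exhaust; cases "k - 1") (auto simp: coeff_init_poly coeff_pCons split: nat.splits)
    qed
    have "[:e' q 0, e' 0 1:] = [:e q 0 + e 0 1 * \<beta>, e 0 1:]"
      using tr(2)[OF q1] unfolding ip by (simp add: pcompose_pCons)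
    then have e'q: "e' q 0 = 0" "e' 0 1 \<noteq> 0" using e(3) by (auto simp: \<beta>_def)
    have "e' j 0 = 0" if "j < Suc q" for j
    proof (cases "j = q")
      case False
      then show ?thesis using tr(1)[OF q1] that unfolding weight_ge_nat by fastforce
    qed (use e'q in simp)
    moreover have "coeff \<eta>' 1 = 0" if "c 1 0 = 0"
      using that \<eta>(2) e(4) by (cases "N = 0") (auto simp: \<eta>'_def \<beta>_def q_def)
    ultimately show ?case using \<eta>'0 e' e'q unfolding q_def by blast
  qed
  then show ?thesis by blast
qed

text \<open>Translating a root of multiplicity \<open>n\<close> to the origin leaves \<open>x\<^sup>n\<close> as the lowest term.\<close>

lemma coeff_pcompose_shift_order:
  fixes P :: "real poly"
  assumes "P \<noteq> 0"
  shows "coeff (pcompose P [:\<beta>, 1:]) (order \<beta> P) \<noteq> 0"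
proof -
  obtain R where R: "P = [:-\<beta>, 1:] ^ order \<beta> P * R" "\<not> [:-\<beta>, 1:] dvd R"
    using order_decomp[OF assms] by blast
  let ?n = "order \<beta> P"
  have base: "pcompose [:-\<beta>, 1:] [:\<beta>, 1:] = [:0, 1:]" by (simp add: pcompose_pCons)
  have "pcompose ([:-\<beta>, 1:] ^ n) [:\<beta>, 1:] = monom 1 n" for n
  proof (induction n)
    case (Suc n)
    then show ?case by (simp only: power_Suc pcompose_mult base) (simp add: monom_Suc)
  qed (simp add: pcompose_1)
  then have "pcompose P [:\<beta>, 1:] = monom 1 ?n * pcompose R [:\<beta>, 1:]"
    using arg_cong[OF R(1), of "\<lambda>p. pcompose p [:\<beta>, 1:]"] by (simp add: pcompose_mult)
  then have "coeff (pcompose P [:\<beta>, 1:]) ?n = coeff (pcompose R [:\<beta>, 1:]) 0"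
    by (simp add: coeff_monom_mult)
  also have "\<dots> = poly R \<beta>"
    by (simp add: poly_0_coeff_0[symmetric] poly_pcompose)
  finally show ?thesis using R(2) by (simp add: poly_eq_0_iff_dvd)
qed

lemma poly_abs_le:
  fixes p :: "real poly"
  obtains K where "K \<ge> 0" "\<And>x. \<bar>x\<bar> \<le> 1 \<Longrightarrow> \<bar>poly p x\<bar> \<le> K"
proof -
  have "compact (poly p ` {-1..1})" by (intro compact_continuous_image continuous_intros) auto
  then obtain K where K: "\<And>z. z \<in> poly p ` {-1..1} \<Longrightarrow> \<bar>z\<bar> \<le> K"
    using compact_imp_bounded bounded_iff by (metis real_norm_def)
  have "\<bar>poly p x\<bar> \<le> max K 0" if "\<bar>x\<bar> \<le> 1" for x
    using K[of "poly p x"] that by (auto simp: abs_le_iff)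
  then show ?thesis using that[of "max K 0"] by simp
qed

lemma box_bound_Lipschitz:
  assumes "has_taylor u c" "c 0 0 = 0"
  shows "box_bound u 1 1 1"
proof (rule box_bound_if_weight_ge[OF assms(1)])
  show "weight_ge c 1 1 1"
    unfolding weight_ge_def
  proof (intro allI impI)
    fix j k assume "c j k \<noteq> 0"
    then have "1 \<le> j + k" using assms(2) by (cases j; cases k) auto
    then have "real 1 \<le> real (j + k)" by (simp only: of_nat_le_iff)
    then show "1 \<le> 1 * real j + 1 * real k" by simp
  qed
qed auto

text \<open>The estimate on which the theorem rests: \<open>g\<close> is the composition of \<open>h\<close> with the map
  \<open>(\<Theta>1, \<Theta>2)\<close>, and the order of \<open>h\<close> for the weight \<open>(1, r)\<close> is at most
  \<open>D (1 + r)\<close> when \<open>D\<close> is such a bound for the monomial orders of \<open>g\<close> and no nonzero root of an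
  initial form of \<open>g\<close> is too multiple. The curve \<open>\<Theta>2 = 0\<close> is replaced by a polynomial graph
  \<open>\<eta>\<close> up to order \<open>r\<close>, so that \<open>G (x, y) = g (x, \<eta> x + y)\<close> inherits the bound on
  \<open>h\<close>. If \<open>\<eta>\<close> vanishes to order at least \<open>r\<close>, then \<open>g\<close> itself has this order. Otherwise
  \<open>\<eta> \<approx> \<beta> x\<^sup>q\<close> with \<open>q < r\<close>, and the initial form of \<open>G\<close> contains a monomial
  \<open>x\<^bsup>m - q n\<^esup> y\<^sup>n\<close>, \<open>n\<close> being the multiplicity of \<open>\<beta>\<close>; hence the order is at most
  \<open>m + (r - q) n \<le> D (1 + q) + (r - q) D\<close>. A linear term of \<open>\<eta>\<close> is present only if
  \<open>\<partial>\<^sub>1\<Theta>2(0) \<noteq> 0\<close>, so for \<open>q = 1\<close> the condition on roots is required only then.\<close>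

lemma weighted_order_le:
  fixes g h \<Theta>1 \<Theta>2 :: "real \<times> real \<Rightarrow> real" and r M D :: real
  assumes g: "smooth_germ g" "has_taylor g c" "c j0 k0 \<noteq> 0"
    and D: "\<And>r M. r \<ge> 1 \<Longrightarrow> weight_ge c 1 r M \<Longrightarrow> M \<le> D * (1 + r)"
    and noroot: "\<And>q m b. 1 \<le> q \<Longrightarrow> weight_ge c 1 (real q) (real m) \<Longrightarrow> init_poly c q m \<noteq> 0 \<Longrightarrow> b \<noteq> 0 \<Longrightarrow>
       (q = 1 \<Longrightarrow> \<theta>2 1 0 \<noteq> 0) \<Longrightarrow> order b (init_poly c q m) * (1 + q) \<le> m"
    and \<Theta>1: "has_taylor \<Theta>1 \<theta>1" "\<theta>1 0 0 = 0"
    and \<Theta>2: "smooth_germ \<Theta>2" "has_taylor \<Theta>2 \<theta>2" "\<theta>2 0 0 = 0" "\<theta>2 0 1 \<noteq> 0"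
    and r: "r \<ge> 1" and box: "box_bound h 1 r M"
    and eq: "\<forall>\<^sub>F z in nhds (0, 0). g z = h (\<Theta>1 z, \<Theta>2 z)"
  shows "M \<le> D * (1 + r)"
proof -
  obtain N :: nat where "r \<le> real N" using real_arch_simple by blast
  then have N: "r \<le> real (Suc N)" by simp
  obtain \<eta> e where \<eta>: "poly \<eta> 0 = 0" "\<theta>2 1 0 = 0 \<longrightarrow> coeff \<eta> 1 = 0"
    and e: "has_taylor (\<lambda>(x, y). \<Theta>2 (x, poly \<eta> x + y)) e" "\<forall>j < Suc N. e j 0 = 0"
    using approx_implicit[OF \<Theta>2, of N] by blast
  let ?H = "\<lambda>(x, y). \<Theta>2 (x, poly \<eta> x + y)"
  define G where "G = (\<lambda>(x, y). g (x, poly \<eta> x + y))"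
  obtain \<rho> where \<rho>: "\<eta> = [:0, 1:] * \<rho>"
    using \<eta>(1) poly_eq_0_iff_dvd[of \<eta> 0] by (auto elim: dvdE)
  obtain L where L: "L \<ge> 0" "\<And>x. \<bar>x\<bar> \<le> 1 \<Longrightarrow> \<bar>poly \<rho> x\<bar> \<le> L" using poly_abs_le by blast
  have boxG: "box_bound G 1 r M"
  proof -
    have "weight_ge e 1 r r"
      unfolding weight_ge_def
    proof (intro allI impI)
      fix j k assume jk: "e j k \<noteq> 0"
      show "r \<le> 1 * real j + r * real k"
      proof (cases k)
        case 0
        then have "Suc N \<le> j" using jk e(2) by (meson not_less)
        then show ?thesis using N 0 by simp
      next
        case (Suc k')
        have "r * 1 \<le> r * real k" using r Suc by (intro mult_left_mono) auto
        then show ?thesis by simp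
      qed
    qed
    then have "box_bound ?H 1 r r" using box_bound_if_weight_ge[OF e(1)] r by simp
    then obtain C2 \<delta>2 where C2: "0 < \<delta>2"
      "\<And>t x y. 0 < t \<Longrightarrow> t \<le> \<delta>2 \<Longrightarrow> \<bar>x\<bar> \<le> t powr 1 \<Longrightarrow> \<bar>y\<bar> \<le> t powr r \<Longrightarrow> \<bar>?H (x, y)\<bar> \<le> C2 * t powr r"
      unfolding box_bound_def by blast
    have "box_bound \<Theta>1 1 1 1" by (rule box_bound_Lipschitz[OF \<Theta>1])
    from box_bound_scaled[OF this zero_less_one zero_less_one, of "L + 1"] obtain C1 \<delta>1 where C1: "0 < \<delta>1"
      "\<And>t x y. 0 < t \<Longrightarrow> t \<le> \<delta>1 \<Longrightarrow> \<bar>x\<bar> \<le> (L + 1) * t powr 1 \<Longrightarrow> \<bar>y\<bar> \<le> (L + 1) * t powr 1 \<Longrightarrow> \<bar>\<Theta>1 (x, y)\<bar> \<le> C1 * t powr 1"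
      by blast
    define K where "K = max C1 C2"
    have r0: "0 < r" using r by simp
    from box_bound_scaled[OF box zero_less_one r0, of K] obtain C3 \<delta>3 where C3: "0 < \<delta>3"
      "\<And>t x y. 0 < t \<Longrightarrow> t \<le> \<delta>3 \<Longrightarrow> \<bar>x\<bar> \<le> K * t powr 1 \<Longrightarrow> \<bar>y\<bar> \<le> K * t powr r \<Longrightarrow> \<bar>h (x, y)\<bar> \<le> C3 * t powr M"
      by blast
    obtain \<epsilon> where \<epsilon>: "\<epsilon> > 0" "\<And>z. dist z (0, 0) < \<epsilon> \<Longrightarrow> g z = h (\<Theta>1 z, \<Theta>2 z)"
      using eq unfolding eventually_nhds_metric by blast
    define \<delta> where "\<delta> = min (min \<delta>1 \<delta>2) (min \<delta>3 (min 1 (\<epsilon> / (2 * (L + 2)))))"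
    have \<delta>: "\<delta> > 0" using C1 C2 C3 \<epsilon> L by (simp add: \<delta>_def)
    have "\<bar>G (x, y)\<bar> \<le> C3 * t powr M"
      if t: "0 < t" "t \<le> \<delta>" and x: "\<bar>x\<bar> \<le> t powr 1" and y: "\<bar>y\<bar> \<le> t powr r" for t x y
    proof -
      have td: "t \<le> \<delta>1" "t \<le> \<delta>2" "t \<le> \<delta>3" "t \<le> 1" "t \<le> \<epsilon> / (2 * (L + 2))" using t by (auto simp: \<delta>_def)
      have xt: "\<bar>x\<bar> \<le> t" using x t by simp
      have "t powr r \<le> t powr 1" using r t td by (intro powr_mono') auto
      then have yt: "\<bar>y\<bar> \<le> t" using y t by simp
      have "\<bar>poly \<eta> x\<bar> \<le> t * L"
        unfolding \<rho> using L(2)[of x] xt td by (auto simp: abs_mult intro!: mult_mono)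
      then have cy: "\<bar>poly \<eta> x + y\<bar> \<le> (L + 1) * t" using yt by (simp add: algebra_simps)
      have "0 \<le> L * t" using L(1) t by simp
      then have xt': "\<bar>x\<bar> \<le> (L + 1) * t" using xt by (simp add: algebra_simps)
      let ?z = "(x, poly \<eta> x + y)"
      have "dist ?z (0, 0) \<le> \<bar>x\<bar> + \<bar>poly \<eta> x + y\<bar>"
        using norm_Pair_le[of x "poly \<eta> x + y"] by (simp add: dist_norm)
      also have "\<dots> \<le> (L + 2) * t" using xt cy by (simp add: algebra_simps)
      also have "\<dots> \<le> \<epsilon> / 2" using td(5) L(1) by (simp add: field_simps)
      also have "\<dots> < \<epsilon>" using \<epsilon> by simp
      finally have gz: "g ?z = h (\<Theta>1 ?z, \<Theta>2 ?z)" by (rule \<epsilon>(2))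
      have "\<bar>\<Theta>1 ?z\<bar> \<le> C1 * t powr 1" using t xt' cy td by (intro C1(2)) auto
      also have "\<dots> \<le> K * t powr 1" by (intro mult_right_mono) (auto simp: K_def)
      finally have T1: "\<bar>\<Theta>1 ?z\<bar> \<le> K * t powr 1" .
      have "\<bar>\<Theta>2 ?z\<bar> \<le> C2 * t powr r" using C2(2)[OF t(1) td(2) x y] by simp
      also have "\<dots> \<le> K * t powr r" by (intro mult_right_mono) (auto simp: K_def)
      finally have T2: "\<bar>\<Theta>2 ?z\<bar> \<le> K * t powr r" .
      show ?thesis using C3(2)[OF t(1) td(3) T1 T2] by (simp add: G_def gz)
    qed
    then show ?thesis unfolding box_bound_def using \<delta> by blast
  qed
  show ?thesis
  proof (cases "\<eta> = 0 \<or> r \<le> real (order 0 \<eta>)")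
    case True
    have "\<exists>K\<ge>0. \<forall>t x. 0 < t \<longrightarrow> t \<le> 1 \<longrightarrow> \<bar>x\<bar> \<le> t \<longrightarrow> \<bar>poly \<eta> x\<bar> \<le> K * t powr r"
    proof (cases "\<eta> = 0")
      case False
      then have q: "r \<le> real (order 0 \<eta>)" using True by simp
      obtain \<sigma> where \<sigma>: "\<eta> = [:0, 1:] ^ order 0 \<eta> * \<sigma>"
        using order_decomp[OF False, of 0] by auto
      obtain K where K: "K \<ge> 0" "\<And>x. \<bar>x\<bar> \<le> 1 \<Longrightarrow> \<bar>poly \<sigma> x\<bar> \<le> K" using poly_abs_le by blast
      have "\<bar>poly \<eta> x\<bar> \<le> K * t powr r" if "0 < t" "t \<le> 1" "\<bar>x\<bar> \<le> t" for t x
      proof -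
        have "\<bar>poly \<eta> x\<bar> = \<bar>x\<bar> ^ order 0 \<eta> * \<bar>poly \<sigma> x\<bar>"
          by (subst \<sigma>) (simp add: abs_mult power_abs)
        also have "\<dots> \<le> t ^ order 0 \<eta> * K"
          using that K by (intro mult_mono power_mono) auto
        also have "t ^ order 0 \<eta> = t powr (order 0 \<eta>)" using that by (simp add: powr_realpow)
        also have "t powr (order 0 \<eta>) * K \<le> t powr r * K"
          using that q K by (intro mult_right_mono powr_mono') auto
        finally show ?thesis by (simp add: mult.commute)
      qed
      then show ?thesis using K by blast
    qed auto
    then obtain K where K: "K \<ge> 0" "\<And>t x. 0 < t \<Longrightarrow> t \<le> 1 \<Longrightarrow> \<bar>x\<bar> \<le> t \<Longrightarrow> \<bar>poly \<eta> x\<bar> \<le> K * t powr r" by blast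
    have r0: "0 < r" using r by simp
    from box_bound_scaled[OF boxG zero_less_one r0, of "K + 1"] obtain C \<delta> where C: "0 < \<delta>"
      "\<And>t x y. 0 < t \<Longrightarrow> t \<le> \<delta> \<Longrightarrow> \<bar>x\<bar> \<le> (K + 1) * t powr 1 \<Longrightarrow> \<bar>y\<bar> \<le> (K + 1) * t powr r \<Longrightarrow> \<bar>G (x, y)\<bar> \<le> C * t powr M"
      by blast
    have "\<bar>g (x, y)\<bar> \<le> C * t powr M"
      if t: "0 < t" "t \<le> min \<delta> 1" and x: "\<bar>x\<bar> \<le> t powr 1" and y: "\<bar>y\<bar> \<le> t powr r" for t x y
    proof -
      have "\<bar>x\<bar> \<le> t" using x t by simp
      then have "\<bar>poly \<eta> x\<bar> \<le> K * t powr r" using K(2) t by auto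
      then have "\<bar>y - poly \<eta> x\<bar> \<le> (K + 1) * t powr r" using y by (simp add: algebra_simps)
      moreover have "1 * t powr 1 \<le> (K + 1) * t powr 1" using K(1) by (intro mult_right_mono) auto
      then have "\<bar>x\<bar> \<le> (K + 1) * t powr 1" using x by linarith
      ultimately have "\<bar>G (x, y - poly \<eta> x)\<bar> \<le> C * t powr M" using t by (intro C(2)) auto
      then show ?thesis by (simp add: G_def)
    qed
    moreover have "0 < min \<delta> 1" using C(1) by simp
    ultimately have "box_bound g 1 r M" unfolding box_bound_def by blast
    then have "weight_ge c 1 r M" using weight_ge_if_box_bound[OF g(2)] r by simp
    then show ?thesis using D r by blast
  next
    case False
    define q where "q = order 0 \<eta>"
    have \<eta>0: "\<eta> \<noteq> 0" and qr: "real q < r" using False by (auto simp: q_def)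
    have q1: "1 \<le> q" using \<eta>(1) \<eta>0 order_root[of \<eta> 0] by (simp add: q_def)
    obtain \<sigma> where \<sigma>: "\<eta> = [:0, 1:] ^ q * \<sigma>" "poly \<sigma> 0 \<noteq> 0"
      using order_decomp[OF \<eta>0, of 0] by (auto simp: q_def poly_eq_0_iff_dvd)
    define \<beta> where "\<beta> = poly \<sigma> 0"
    have \<beta>: "\<beta> \<noteq> 0" using \<sigma> by (simp add: \<beta>_def)
    have q2: "\<theta>2 1 0 \<noteq> 0" if "q = 1"
    proof -
      have "coeff \<eta> 1 = \<beta>" unfolding \<sigma>(1) that by (simp add: \<beta>_def poly_0_coeff_0)
      then show ?thesis using \<eta>(2) \<beta> by auto
    qed
    obtain m where m: "weight_ge c 1 (real q) (real m)" "init_poly c q m \<noteq> 0"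
      using init_exists[of c, OF g(3) q1] by blast
    have smG: "smooth_germ G" unfolding G_def by (intro smooth_germ_shear_poly g \<eta>)
    define e' where "e' = taylor_coeff G"
    have e': "has_taylor G e'" unfolding e'_def by (rule has_taylor_smooth[OF smG])
    have "(poly \<sigma> \<longlongrightarrow> \<beta>) (at_right 0)"
      unfolding \<beta>_def by (rule tendsto_eq_intros | simp)+
    moreover have "\<forall>\<^sub>F t in at_right 0. poly \<sigma> t = poly \<eta> t / t ^ q"
      using eventually_at_right_less[of "0::real"] by eventually_elim (simp add: \<sigma>(1))
    ultimately have "((\<lambda>t. poly \<eta> t / t ^ q) \<longlongrightarrow> \<beta>) (at_right 0)"
      by (rule Lim_transform_eventually)
    note tr = shear_transfer[OF g(2) e'[unfolded G_def] q1 m(1) this]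
    define n where "n = order \<beta> (init_poly c q m)"
    have "coeff (init_poly e' q m) n \<noteq> 0"
      unfolding tr(2) n_def by (rule coeff_pcompose_shift_order[OF m(2)])
    then have n: "q * n \<le> m" "e' (m - q * n) n \<noteq> 0" by (auto simp: coeff_init_poly split: if_splits)
    have "weight_ge e' 1 r M" using weight_ge_if_box_bound[OF e' boxG] r by simp
    then have "M \<le> real (m - q * n) + r * real n" using n(2) unfolding weight_ge_def by force
    also have "\<dots> = real m + (r - real q) * real n" using n(1) by (simp add: of_nat_diff algebra_simps)
    finally have M: "M \<le> real m + (r - real q) * real n" .
    have mD: "real m \<le> D * (1 + real q)" using D m(1) q1 by simp
    have "n * (1 + q) \<le> m" unfolding n_def by (rule noroot[OF q1 m \<beta> q2])
    then have "real (n * (1 + q)) \<le> real m" by (simp only: of_nat_le_iff)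
    then have "real n * (1 + real q) \<le> real m" by (simp only: of_nat_mult of_nat_add of_nat_1)
    then have "real n * (1 + real q) \<le> D * (1 + real q)" using mD by linarith
    then have "real n \<le> D" by (rule mult_right_le_imp_le) simp
    then have "(r - real q) * real n \<le> (r - real q) * D" using qr by (intro mult_left_mono) auto
    then show ?thesis using M mD by (simp add: algebra_simps)
  qed
qed

section \<open>Smooth functions with a prescribed expansion\<close>

abbreviation I1 :: "real set" where "I1 \<equiv> {-1<..<1}"

text \<open>The derivatives of orders \<open>0, \<dots>, n\<close> exist on \<open>(-1, 1)\<close> and are bounded by \<open>C\<close>. The
  derivatives are witnesses instead of values of \<open>deriv\<close>, so that linear combinations and
  series can be treated without computing iterated derivatives.\<close>

primrec deriv_bounded :: "nat \<Rightarrow> real \<Rightarrow> (real \<Rightarrow> real) \<Rightarrow> bool" where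
  "deriv_bounded 0 C f \<longleftrightarrow> (\<forall>x\<in>I1. \<bar>f x\<bar> \<le> C)"
| "deriv_bounded (Suc n) C f \<longleftrightarrow> (\<forall>x\<in>I1. \<bar>f x\<bar> \<le> C) \<and>
     (\<exists>f'. (\<forall>x\<in>I1. (f has_field_derivative f' x) (at x)) \<and> deriv_bounded n C f')"

lemma deriv_bounded_SucI:
  assumes "\<And>x. x \<in> I1 \<Longrightarrow> \<bar>f x\<bar> \<le> C"
    and "\<And>x. x \<in> I1 \<Longrightarrow> (f has_field_derivative f' x) (at x)"
    and "deriv_bounded n C f'"
  shows "deriv_bounded (Suc n) C f"
  using assms unfolding deriv_bounded.simps by (intro conjI exI[of _ f']) blast+

lemma deriv_bounded_0: "deriv_bounded n C f \<Longrightarrow> x \<in> I1 \<Longrightarrow> \<bar>f x\<bar> \<le> C"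
  by (cases n) auto

lemma deriv_bounded_mono: "deriv_bounded n C f \<Longrightarrow> C \<le> D \<Longrightarrow> deriv_bounded n D f"
proof (induction n arbitrary: f)
  case (Suc n)
  then show ?case by simp (meson order_trans)
qed auto

lemma deriv_bounded_Suc_le: "deriv_bounded (Suc n) C f \<Longrightarrow> deriv_bounded n C f"
proof (induction n arbitrary: f)
  case (Suc n)
  then obtain f' where "\<forall>x\<in>I1. (f has_field_derivative f' x) (at x)" "deriv_bounded (Suc n) C f'"
    "\<forall>x\<in>I1. \<bar>f x\<bar> \<le> C" by auto
  then show ?case using Suc.IH[of f'] by auto
qed auto

lemma deriv_bounded_le: "deriv_bounded n C f \<Longrightarrow> m \<le> n \<Longrightarrow> deriv_bounded m C f"
proof (induction n)
  case (Suc n)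
  then show ?case using deriv_bounded_Suc_le by (cases "m = Suc n") auto
qed simp

lemma deriv_bounded_add:
  "deriv_bounded n C f \<Longrightarrow> deriv_bounded n D g \<Longrightarrow> deriv_bounded n (C + D) (\<lambda>x. f x + g x)"
proof (induction n arbitrary: f g)
  case 0
  then show ?case by (auto intro: order_trans[OF abs_triangle_ineq add_mono])
next
  case (Suc n)
  obtain f' where f': "\<forall>x\<in>I1. (f has_field_derivative f' x) (at x)" "deriv_bounded n C f'"
    using Suc.prems(1) by auto
  obtain g' where g': "\<forall>x\<in>I1. (g has_field_derivative g' x) (at x)" "deriv_bounded n D g'"
    using Suc.prems(2) by auto
  show ?case
  proof (rule deriv_bounded_SucI)
    show "((\<lambda>x. f x + g x) has_field_derivative f' x + g' x) (at x)" if "x \<in> I1" for x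
      using f' g' that by (auto intro: DERIV_add)
    show "\<bar>f x + g x\<bar> \<le> C + D" if "x \<in> I1" for x
      using Suc.prems that by (auto intro: order_trans[OF abs_triangle_ineq add_mono])
    show "deriv_bounded n (C + D) (\<lambda>x. f' x + g' x)" by (rule Suc.IH[OF f'(2) g'(2)])
  qed
qed

lemma deriv_bounded_cmult:
  "deriv_bounded n C f \<Longrightarrow> deriv_bounded n (\<bar>a\<bar> * C) (\<lambda>x. a * f x)"
proof (induction n arbitrary: f)
  case 0
  then show ?case by (auto simp: abs_mult intro: mult_left_mono)
next
  case (Suc n)
  obtain f' where f': "\<forall>x\<in>I1. (f has_field_derivative f' x) (at x)" "deriv_bounded n C f'"
    using Suc.prems by auto
  show ?case
  proof (rule deriv_bounded_SucI)
    show "((\<lambda>x. a * f x) has_field_derivative a * f' x) (at x)" if "x \<in> I1" for x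
      using f' that by (auto intro: DERIV_cmult)
    show "\<bar>a * f x\<bar> \<le> \<bar>a\<bar> * C" if "x \<in> I1" for x
      using Suc.prems that by (auto simp: abs_mult intro: mult_left_mono)
    show "deriv_bounded n (\<bar>a\<bar> * C) (\<lambda>x. a * f' x)" by (rule Suc.IH[OF f'(2)])
  qed
qed

lemma deriv_bounded_Ck: "deriv_bounded (Suc n) C f \<Longrightarrow> Ck_on n I1 f"
proof (induction n arbitrary: f)
  case 0
  then obtain f' where "\<forall>x\<in>I1. (f has_field_derivative f' x) (at x)" by auto
  then show ?case using DERIV_isCont by (metis Ck_on.simps(1) continuous_at_imp_continuous_on)
next
  case (Suc n)
  then obtain f' where f': "\<forall>x\<in>I1. (f has_field_derivative f' x) (at x)" "deriv_bounded (Suc n) C f'"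
    by auto
  show ?case by (rule Ck_on_real_SucI[of _ _ f']) (use f' Suc.IH in auto)
qed

text \<open>The Weierstrass test for all derivatives up to order \<open>n\<close> at once.\<close>

lemma deriv_bounded_series:
  "(\<And>i. deriv_bounded n (C i) (f i)) \<Longrightarrow> summable C \<Longrightarrow> deriv_bounded n (suminf C) (\<lambda>x. \<Sum>i. f i x)"
proof (induction n arbitrary: f)
  have bd: "summable (\<lambda>i. f i x)" "\<bar>\<Sum>i. f i x\<bar> \<le> suminf C"
    if "\<And>i. deriv_bounded n (C i) (f i)" "summable C" "x \<in> I1" for f :: "nat \<Rightarrow> real \<Rightarrow> real" and x n
  proof -
    have le: "\<bar>f i x\<bar> \<le> C i" for i using deriv_bounded_0 that by blast
    have ab: "summable (\<lambda>i. \<bar>f i x\<bar>)"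
      by (rule summable_comparison_test_ev[OF _ that(2)]) (simp add: le)
    then show "summable (\<lambda>i. f i x)" by (rule summable_rabs_cancel)
    have "\<bar>\<Sum>i. f i x\<bar> \<le> (\<Sum>i. \<bar>f i x\<bar>)" by (rule summable_rabs[OF ab])
    also have "\<dots> \<le> suminf C" by (rule suminf_le[OF le ab that(2)])
    finally show "\<bar>\<Sum>i. f i x\<bar> \<le> suminf C" .
  qed
  {
    case 0
    then show ?case using bd(2)[of 0 f] by auto
  next
    case (Suc n)
    have "\<forall>i. \<exists>f'. (\<forall>x\<in>I1. (f i has_field_derivative f' x) (at x)) \<and> deriv_bounded n (C i) f'"
      using Suc.prems(1) by auto
    from choice[OF this] obtain f' where f': "\<And>i x. x \<in> I1 \<Longrightarrow> (f i has_field_derivative f' i x) (at x)"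
      "\<And>i. deriv_bounded n (C i) (f' i)" by blast
    have unif: "uniformly_convergent_on I1 (\<lambda>k x. \<Sum>i<k. f' i x)"
    proof (rule Weierstrass_m_test'[OF _ Suc.prems(2)])
      fix i x assume "x \<in> I1"
      then show "norm (f' i x) \<le> C i" using deriv_bounded_0[OF f'(2)] by simp
    qed
    have der: "((\<lambda>x. \<Sum>i. f i x) has_field_derivative (\<Sum>i. f' i x)) (at x)" if x: "x \<in> I1" for x
    proof (rule has_field_derivative_series'(2)[OF _ _ unif])
      show "convex I1" by simp
      show "(f i has_field_derivative f' i x) (at x within I1)" if "x \<in> I1" for i x
        using f'(1)[OF that] has_field_derivative_at_within by blast
      show "0 \<in> I1" by simp
      show "summable (\<lambda>i. f i 0)" using bd(1)[OF Suc.prems, of 0] by simp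
      show "x \<in> interior I1" using x by (simp add: interior_open)
    qed
    show ?case
    proof (rule deriv_bounded_SucI)
      show "\<bar>\<Sum>i. f i x\<bar> \<le> suminf C" if "x \<in> I1" for x by (rule bd(2)[OF Suc.prems that])
      show "((\<lambda>x. \<Sum>i. f i x) has_field_derivative (\<Sum>i. f' i x)) (at x)" if "x \<in> I1" for x
        by (rule der[OF that])
      show "deriv_bounded n (suminf C) (\<lambda>x. \<Sum>i. f' i x)" by (rule Suc.IH[OF f'(2) Suc.prems(2)])
    qed
  }
qed

text \<open>Peano's functions \<open>c x\<^sup>i / (1 + x\<^sup>2 / s)\<close> agree with \<open>c x\<^sup>i\<close> up to order \<open>i + 1\<close>, and
  their low derivatives become arbitrarily small with \<open>s\<close>. The exponent \<open>p\<close> makes the family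
  closed under differentiation.\<close>

definition peano_frac :: "real \<Rightarrow> nat \<Rightarrow> nat \<Rightarrow> real \<Rightarrow> real" where
  "peano_frac s k p x = x ^ k / (s + x\<^sup>2) ^ p"

lemma DERIV_peano_frac:
  assumes "s > 0"
  shows "(peano_frac s k p has_field_derivative
     real k * peano_frac s (k - 1) p x + (- 2 * real p) * peano_frac s (k + 1) (p + 1) x) (at x)"
proof -
  define u where "u = s + x\<^sup>2"
  have "u > 0" using assms by (simp add: u_def add_pos_nonneg)
  then have u: "u \<noteq> 0" by simp
  have "((\<lambda>x. s + x\<^sup>2) has_field_derivative 2 * x) (at x)" by (auto intro!: derivative_eq_intros)
  from DERIV_divide[OF DERIV_pow[of k x] DERIV_power[OF this, of p]]
  have "(peano_frac s k p has_field_derivative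
     (real k * x ^ (k - 1) * u ^ p - x ^ k * (real p * u ^ (p - 1) * (2 * x))) / (u ^ p * u ^ p)) (at x)"
    using u unfolding peano_frac_def u_def by (simp add: mult_ac)
  moreover have "(real k * x ^ (k - 1) * u ^ p - x ^ k * (real p * u ^ (p - 1) * (2 * x))) / (u ^ p * u ^ p)
     = real k * (x ^ (k - 1) / u ^ p) + (- 2 * real p) * (x ^ (k + 1) / u ^ (p + 1))"
    using u by (cases p) (simp_all add: field_simps power_add)
  ultimately show ?thesis by (simp add: peano_frac_def u_def)
qed

lemma deriv_bounded_peano_frac_step:
  assumes "s > 0" "deriv_bounded n C1 (peano_frac s (k - 1) p)" "deriv_bounded n C2 (peano_frac s (k + 1) (p + 1))"
    and "\<And>x. x \<in> I1 \<Longrightarrow> \<bar>peano_frac s k p x\<bar> \<le> C0"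
  shows "deriv_bounded (Suc n) (max C0 (real k * C1 + 2 * real p * C2)) (peano_frac s k p)"
proof -
  have "deriv_bounded n (\<bar>real k\<bar> * C1 + \<bar>- 2 * real p\<bar> * C2)
     (\<lambda>x. real k * peano_frac s (k - 1) p x + (- 2 * real p) * peano_frac s (k + 1) (p + 1) x)"
    by (intro deriv_bounded_add deriv_bounded_cmult assms)
  then have bd: "deriv_bounded n (max C0 (real k * C1 + 2 * real p * C2))
     (\<lambda>x. real k * peano_frac s (k - 1) p x + (- 2 * real p) * peano_frac s (k + 1) (p + 1) x)"
    by (rule deriv_bounded_mono) simp
  show ?thesis
    by (rule deriv_bounded_SucI[OF _ DERIV_peano_frac[OF assms(1)] bd])
      (use assms(4) in \<open>simp add: le_max_iff_disj\<close>)
qed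

lemma abs_peano_frac_le:
  assumes "s > 0" "\<bar>x\<bar> \<le> 1" "2 * p \<le> k"
  shows "\<bar>peano_frac s k p x\<bar> \<le> \<bar>x\<bar> ^ (k - 2 * p)"
proof -
  have pos: "s + x\<^sup>2 > 0" using assms by (simp add: add_pos_nonneg)
  have "\<bar>x\<bar> ^ k = \<bar>x\<bar> ^ (k - 2 * p) * \<bar>x\<bar> ^ (2 * p)"
    using assms by (simp add: power_add[symmetric])
  also have "\<dots> = \<bar>x\<bar> ^ (k - 2 * p) * (x\<^sup>2) ^ p"
    by (simp only: power_mult power2_abs)
  also have "\<dots> \<le> \<bar>x\<bar> ^ (k - 2 * p) * (s + x\<^sup>2) ^ p"
    using assms by (intro mult_left_mono power_mono) auto
  finally show ?thesis using pos by (simp add: peano_frac_def abs_mult power_abs field_simps)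
qed

text \<open>A derivative lowers \<open>k - 2 p\<close> by one, and as long as this difference is nonnegative the
  function is bounded by \<open>1\<close> on the interval for every \<open>s\<close>.\<close>

lemma deriv_bounded_peano_frac_uniform:
  "2 * p + n \<le> k \<Longrightarrow> \<exists>C. \<forall>s>0. deriv_bounded n C (peano_frac s k p)"
proof (induction n arbitrary: k p)
  have le1: "\<bar>peano_frac s k p x\<bar> \<le> 1" if "s > 0" "2 * p \<le> k" "x \<in> I1" for s k p x
    using abs_peano_frac_le[of s x p k] that power_le_one[of "\<bar>x\<bar>" "k - 2 * p"] by (auto simp: abs_le_iff intro: order_trans)
  {
    case 0
    then show ?case using le1 by (intro exI[of _ 1]) simp
  next
    case (Suc n)
    have k: "2 * p + n \<le> k - 1" "2 * (p + 1) + n \<le> k + 1" using Suc.prems by simp_all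
    obtain C1 where C1: "\<forall>s>0. deriv_bounded n C1 (peano_frac s (k - 1) p)"
      using Suc.IH[OF k(1)] by blast
    obtain C2 where C2: "\<forall>s>0. deriv_bounded n C2 (peano_frac s (k + 1) (p + 1))"
      using Suc.IH[OF k(2)] by blast
    show ?case
      using deriv_bounded_peano_frac_step[OF _ C1[rule_format] C2[rule_format] le1] Suc.prems by (meson add_leD1)
  }
qed

lemma deriv_bounded_peano_frac: "s > 0 \<Longrightarrow> \<exists>C. deriv_bounded n C (peano_frac s k p)"
proof (induction n arbitrary: k p)
  assume s: "s > 0"
  have le: "\<bar>peano_frac s k p x\<bar> \<le> 1 / s ^ p" if "x \<in> I1" for k p x
  proof -
    have "\<bar>x\<bar> ^ k \<le> 1" using that by (intro power_le_one) auto
    moreover have "s ^ p \<le> (s + x\<^sup>2) ^ p" using s by (intro power_mono) auto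
    ultimately show ?thesis using s by (auto simp: peano_frac_def power_abs intro!: frac_le)
  qed
  {
    case 0
    show ?case using le by (intro exI[of _ "1 / s ^ p"]) simp
  next
    case (Suc n)
    show ?case using Suc.IH[OF s, of "k - 1" p] Suc.IH[OF s, of "k + 1" "p + 1"]
        deriv_bounded_peano_frac_step[OF s _ _ le] by blast
  }
qed

text \<open>Borel's theorem in a form suited to coefficients that are chosen one after another: \<open>T i c\<close>
  is a smooth function with leading term \<open>c x\<^sup>i\<close>, the series over \<open>i\<close> is smooth for every
  sequence of coefficients, and its remainder from \<open>q\<close> on has leading term \<open>c q * x\<^sup>q\<close>. As
  the terms are not pure powers, the coefficients are meant to be chosen by a recursion that reads
  off the next one from the actual partial sum.\<close>

lemma borel_summation:
  obtains T :: "nat \<Rightarrow> real \<Rightarrow> real \<Rightarrow> real" where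
    "\<And>i c. smooth_on I1 (T i c)" "\<And>i c. 1 \<le> i \<Longrightarrow> T i c 0 = 0" "\<And>i x. T i 0 x = 0"
    "\<And>c. smooth_on I1 (\<lambda>x. \<Sum>i. T i (c i) x)"
    "\<And>c q. ((\<lambda>t. ((\<Sum>i. T i (c i) t) - (\<Sum>i<q. T i (c i) t)) / t ^ q) \<longlongrightarrow> c q) (at_right 0)"
proof -
  have "\<exists>A. 2 \<le> i \<longrightarrow> (\<forall>s>0. deriv_bounded (i - 2) A (peano_frac s i 1))" for i
    using deriv_bounded_peano_frac_uniform[of 1 "i - 2" i] by auto
  then have "\<forall>i. \<exists>A. 2 \<le> i \<longrightarrow> (\<forall>s>0. deriv_bounded (i - 2) A (peano_frac s i 1))" by blast
  from choice[OF this] obtain A where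
    A: "\<And>i s. 2 \<le> i \<Longrightarrow> 0 < s \<Longrightarrow> deriv_bounded (i - 2) (A i) (peano_frac s i 1)" by blast
  \<comment> \<open>This makes all derivatives of the \<open>i\<close>-th term up to order \<open>i - 2\<close> at most \<open>2\<^sup>-\<^sup>i\<close>.\<close>
  define S where "S i c = 1 / (1 + 2 ^ i * \<bar>c\<bar> * (\<bar>A i\<bar> + 1))" for i :: nat and c :: real
  have S: "S i c > 0" for i c
    unfolding S_def by (intro divide_pos_pos add_pos_nonneg mult_nonneg_nonneg) auto
  have S_le: "\<bar>c\<bar> * S i c * (\<bar>A i\<bar> + 1) \<le> (1 / 2) ^ i" for i c
  proof -
    have "0 < 1 + 2 ^ i * \<bar>c\<bar> * (\<bar>A i\<bar> + 1)" by (intro add_pos_nonneg mult_nonneg_nonneg) auto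
    then show ?thesis by (simp add: S_def divide_simps)
  qed
  have cS_le: "\<bar>c * S i c\<bar> \<le> (1 / 2) ^ i" for i c
  proof -
    have "\<bar>c * S i c\<bar> * 1 \<le> \<bar>c\<bar> * S i c * (\<bar>A i\<bar> + 1)"
      using S[of i c] unfolding abs_mult by (intro mult_mono) auto
    then show ?thesis using S_le[of c i] by linarith
  qed
  define T where "T i c x = (c * S i c) * peano_frac (S i c) i 1 x" for i c x
  have smT: "Ck_on n I1 (T i c)" for n i c
  proof -
    obtain C where "deriv_bounded (Suc n) C (peano_frac (S i c) i 1)"
      using deriv_bounded_peano_frac[OF S] by blast
    then have "deriv_bounded (Suc n) (\<bar>c * S i c\<bar> * C) (T i c)"
      unfolding T_def by (rule deriv_bounded_cmult)
    then show ?thesis by (rule deriv_bounded_Ck)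
  qed
  have dbT: "deriv_bounded (i - 2) ((1 / 2) ^ i) (T i c)" if "2 \<le> i" for i c
  proof (rule deriv_bounded_mono)
    show "deriv_bounded (i - 2) (\<bar>c * S i c\<bar> * A i) (T i c)"
      unfolding T_def by (rule deriv_bounded_cmult[OF A[OF that S]])
    have "\<bar>c * S i c\<bar> * A i \<le> \<bar>c * S i c\<bar> * (\<bar>A i\<bar> + 1)"
      by (intro mult_left_mono) auto
    also have "\<dots> = \<bar>c\<bar> * S i c * (\<bar>A i\<bar> + 1)" using S[of i c] by (simp add: abs_mult)
    finally show "\<bar>c * S i c\<bar> * A i \<le> (1 / 2) ^ i" using S_le[of c i] by linarith
  qed
  have T_le: "\<bar>T i c x\<bar> \<le> (1 / 2) ^ i * \<bar>x\<bar> ^ (i - 2)" if "2 \<le> i" "\<bar>x\<bar> \<le> 1" for i c x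
    unfolding T_def abs_mult[of "c * S i c"]
    using abs_peano_frac_le[OF S that(2), of 1 i] that cS_le by (intro mult_mono) auto
  have summ: "summable (\<lambda>i. T i (c i) x)" if "\<bar>x\<bar> \<le> 1" for c x
  proof (rule summable_comparison_test[OF _ summable_geometric[of "1 / 2 :: real"]])
    have "norm (T i (c i) x) \<le> (1 / 2) ^ i" if "2 \<le> i" for i
    proof -
      have "\<bar>x\<bar> ^ (i - 2) \<le> 1" using \<open>\<bar>x\<bar> \<le> 1\<close> by (intro power_le_one) auto
      then have "(1 / 2) ^ i * \<bar>x\<bar> ^ (i - 2) \<le> (1 / 2) ^ i * 1" by (intro mult_left_mono) auto
      then show ?thesis using T_le[OF that \<open>\<bar>x\<bar> \<le> 1\<close>, of "c i"] unfolding real_norm_def by linarith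
    qed
    then show "\<exists>N. \<forall>n\<ge>N. norm (T n (c n) x) \<le> (1 / 2) ^ n" by blast
  qed simp
  have smooth: "Ck_on n I1 (\<lambda>x. \<Sum>i. T i (c i) x)" for n c
  proof (rule Ck_on_cong)
    \<comment> \<open>From this index on all terms have \<open>n + 1\<close> controlled derivatives.\<close>
    define N where "N = n + 3"
    have "deriv_bounded (Suc n) (\<Sum>i. (1 / 2) ^ (i + N)) (\<lambda>x. \<Sum>i. T (i + N) (c (i + N)) x)"
    proof (rule deriv_bounded_series)
      show "deriv_bounded (Suc n) ((1 / 2) ^ (i + N)) (T (i + N) (c (i + N)))" for i
        by (rule deriv_bounded_le[OF dbT]) (simp_all add: N_def)
      show "summable (\<lambda>i. (1 / 2 :: real) ^ (i + N))"
        by (simp add: summable_iff_shift summable_geometric)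
    qed
    then show "Ck_on n I1 (\<lambda>x. (\<Sum>i. T (i + N) (c (i + N)) x) + (\<Sum>i<N. T i (c i) x))"
      by (intro Ck_on_add[OF _ deriv_bounded_Ck Ck_on_sum] smT) auto
    show "(\<Sum>i. T (i + N) (c (i + N)) x) + (\<Sum>i<N. T i (c i) x) = (\<Sum>i. T i (c i) x)" if "x \<in> I1" for x
      using suminf_split_initial_segment[OF summ[of x c], of N] that by (simp add: abs_le_iff)
  qed simp
  have lim: "((\<lambda>t. ((\<Sum>i. T i (c i) t) - (\<Sum>i<q. T i (c i) t)) / t ^ q) \<longlongrightarrow> c q) (at_right 0)" for c q
  proof -
    let ?R = "\<lambda>t. \<Sum>i. T (i + (q + 3)) (c (i + (q + 3))) t"
    have ev: "\<forall>\<^sub>F t in at_right (0::real). 0 < t \<and> t < 1"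
      unfolding eventually_at_right[OF zero_less_one] by (intro exI[of _ 1]) auto
    have t0: "((\<lambda>t. t) \<longlongrightarrow> 0) (at_right (0::real))" by (rule tendsto_ident_at)
    have R: "((\<lambda>t. ?R t / t ^ q) \<longlongrightarrow> 0) (at_right 0)"
    proof (rule Lim_null_comparison)
      show "\<forall>\<^sub>F t in at_right 0. norm (?R t / t ^ q) \<le> 2 * t"
        using ev
      proof eventually_elim
        case (elim t)
        have le: "\<bar>T (i + (q + 3)) (c (i + (q + 3))) t\<bar> \<le> (1 / 2) ^ i * t ^ (q + 1)" for i
        proof -
          have "\<bar>T (i + (q + 3)) (c (i + (q + 3))) t\<bar> \<le> (1 / 2) ^ (i + (q + 3)) * t ^ (i + (q + 1))"
            using T_le[of "i + (q + 3)" t "c (i + (q + 3))"] elim by simp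
          also have "\<dots> \<le> (1 / 2) ^ i * t ^ (q + 1)"
            using elim by (intro mult_mono power_decreasing) auto
          finally show ?thesis .
        qed
        have sg: "summable (\<lambda>i. (1 / 2) ^ i * t ^ (q + 1))"
          by (intro summable_mult2 summable_geometric) simp
        have ab: "summable (\<lambda>i. \<bar>T (i + (q + 3)) (c (i + (q + 3))) t\<bar>)"
          by (rule summable_comparison_test_ev[OF _ sg]) (use le in simp)
        have "\<bar>?R t\<bar> \<le> (\<Sum>i. \<bar>T (i + (q + 3)) (c (i + (q + 3))) t\<bar>)" by (rule summable_rabs[OF ab])
        also have "\<dots> \<le> (\<Sum>i. (1 / 2) ^ i * t ^ (q + 1))" by (rule suminf_le[OF le ab sg])
        also have "\<dots> = 2 * t ^ (q + 1)"
          by (subst suminf_mult2[symmetric]) (simp_all add: suminf_geometric summable_geometric)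
        finally show ?case using elim by (simp add: field_simps)
      qed
      show "((\<lambda>t. 2 * t) \<longlongrightarrow> 0) (at_right (0::real))" using tendsto_mult[OF tendsto_const t0, of 2] by simp
    qed
    have term_lim: "((\<lambda>t. c i * S i (c i) * t ^ n / (S i (c i) + t\<^sup>2)) \<longlongrightarrow> c i * S i (c i) * 0 ^ n / (S i (c i) + 0\<^sup>2)) (at_right 0)" for i n
      using S[of i "c i"] by (intro tendsto_intros t0) auto
    have L: "((\<lambda>t. (c q * S q (c q) * t ^ 0 / (S q (c q) + t\<^sup>2)) + (c (q + 1) * S (q + 1) (c (q + 1)) * t ^ 1 / (S (q + 1) (c (q + 1)) + t\<^sup>2))
        + (c (q + 2) * S (q + 2) (c (q + 2)) * t ^ 2 / (S (q + 2) (c (q + 2)) + t\<^sup>2)) + ?R t / t ^ q) \<longlongrightarrow>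
       c q * S q (c q) * 0 ^ 0 / (S q (c q) + 0\<^sup>2) + c (q + 1) * S (q + 1) (c (q + 1)) * 0 ^ 1 / (S (q + 1) (c (q + 1)) + 0\<^sup>2)
        + c (q + 2) * S (q + 2) (c (q + 2)) * 0 ^ 2 / (S (q + 2) (c (q + 2)) + 0\<^sup>2) + 0) (at_right 0)"
      by (intro tendsto_add term_lim R)
    have l: "c q * S q (c q) * 0 ^ 0 / (S q (c q) + 0\<^sup>2) + c (q + 1) * S (q + 1) (c (q + 1)) * 0 ^ 1 / (S (q + 1) (c (q + 1)) + 0\<^sup>2)
        + c (q + 2) * S (q + 2) (c (q + 2)) * 0 ^ 2 / (S (q + 2) (c (q + 2)) + 0\<^sup>2) + 0 = c q"
      using S[of q "c q"] by simp
    have ev_eq: "\<forall>\<^sub>F t in at_right 0. (c q * S q (c q) * t ^ 0 / (S q (c q) + t\<^sup>2)) + (c (q + 1) * S (q + 1) (c (q + 1)) * t ^ 1 / (S (q + 1) (c (q + 1)) + t\<^sup>2))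
        + (c (q + 2) * S (q + 2) (c (q + 2)) * t ^ 2 / (S (q + 2) (c (q + 2)) + t\<^sup>2)) + ?R t / t ^ q
        = ((\<Sum>i. T i (c i) t) - (\<Sum>i<q. T i (c i) t)) / t ^ q"
      using ev
    proof eventually_elim
      case (elim t)
      have Tq: "T (q + n) (c (q + n)) t / t ^ q = c (q + n) * S (q + n) (c (q + n)) * t ^ n / (S (q + n) (c (q + n)) + t\<^sup>2)" for n
        using elim by (simp add: T_def peano_frac_def power_add)
      have "(\<Sum>i. T i (c i) t) = ?R t + (\<Sum>i<q + 3. T i (c i) t)"
        using elim by (intro suminf_split_initial_segment summ) simp
      also have "(\<Sum>i<q + 3. T i (c i) t) = (\<Sum>i<q. T i (c i) t) + T q (c q) t + T (q + 1) (c (q + 1)) t + T (q + 2) (c (q + 2)) t"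
        by (simp add: numeral_3_eq_3)
      finally have "((\<Sum>i. T i (c i) t) - (\<Sum>i<q. T i (c i) t)) / t ^ q
          = T (q + 0) (c (q + 0)) t / t ^ q + T (q + 1) (c (q + 1)) t / t ^ q + T (q + 2) (c (q + 2)) t / t ^ q + ?R t / t ^ q"
        by (simp add: add_divide_distrib diff_divide_distrib)
      then show ?case unfolding Tq by simp
    qed
    show ?thesis by (rule Lim_transform_eventually[OF L[unfolded l] ev_eq])
  qed
  have "T i c 0 = 0" if "1 \<le> i" for i c using that by (simp add: T_def peano_frac_def)
  moreover have "T i 0 x = 0" for i x by (simp add: T_def)
  ultimately show ?thesis using that[of T] smT smooth lim unfolding smooth_on_def by blast
qed

section \<open>Geometry of the Newton polyhedron\<close>

lemma newton_polyhedron_upward: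
  assumes "(a, b) \<in> newton_polyhedron f" "a \<le> a'" "b \<le> b'"
  shows "(a', b') \<in> newton_polyhedron f"
proof -
  let ?A = "\<Union>(j, k)\<in>taylor_support f. {(t1, t2). real j \<le> t1 \<and> real k \<le> t2}"
  let ?v = "(a' - a, b' - b)"
  have "(+) ?v ` ?A \<subseteq> ?A" using assms by fastforce
  then have "(+) ?v ` (convex hull ?A) \<subseteq> convex hull ?A"
    unfolding convex_hull_translation[symmetric] by (rule hull_mono)
  moreover have "(a', b') = ?v + (a, b)" by simp
  ultimately show ?thesis using assms(1) unfolding newton_polyhedron_def by blast
qed

lemma newton_polyhedron_halfplane:
  assumes "weight_ge (taylor_coeff f) v w M" "0 \<le> v" "0 \<le> w" "(a, b) \<in> newton_polyhedron f"
  shows "M \<le> v * a + w * b"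
proof -
  have "newton_polyhedron f \<subseteq> {z. inner (v, w) z \<ge> M}"
    unfolding newton_polyhedron_def
  proof (rule hull_minimal)
    show "(\<Union>(j, k)\<in>taylor_support f. {(t1, t2). real j \<le> t1 \<and> real k \<le> t2}) \<subseteq> {z. inner (v, w) z \<ge> M}"
    proof clarsimp
      fix t1 t2 j k assume "(j, k) \<in> taylor_support f" and t: "real j \<le> t1" "real k \<le> t2"
      then have "M \<le> v * real j + w * real k"
        using assms(1) by (auto simp: taylor_support_def weight_ge_def)
      also have "\<dots> \<le> v * t1 + w * t2" using t assms by (intro add_mono mult_left_mono) auto
      finally show "M \<le> v * t1 + w * t2" .
    qed
  qed (rule convex_halfspace_ge)
  then show ?thesis using assms(4) by auto
qed

lemma taylor_support_in_newton_polyhedron: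
  assumes "taylor_coeff f j k \<noteq> 0"
  shows "(real j, real k) \<in> newton_polyhedron f"
proof -
  have "(real j, real k) \<in> (\<Union>(j, k)\<in>taylor_support f. {(t1, t2). real j \<le> t1 \<and> real k \<le> t2})"
    using assms by (auto simp: taylor_support_def)
  then show ?thesis unfolding newton_polyhedron_def by (rule hull_inc)
qed

text \<open>The polyhedron is stable under adding vectors of the closed quadrant. Hence a diagonal point
  beyond another point of the closure is interior, and only one diagonal point lies on the
  frontier.\<close>

lemma newton_distance_eq_Inf:
  assumes "taylor_coeff f j0 k0 \<noteq> 0"
  defines "D \<equiv> {d. (d, d) \<in> newton_polyhedron f}"
  shows "D \<noteq> {}" "bdd_below D" "newton_distance f = Inf D"
proof -
  let ?N = "newton_polyhedron f"
  have "(real (max j0 k0), real (max j0 k0)) \<in> ?N"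
    using newton_polyhedron_upward[OF taylor_support_in_newton_polyhedron[OF assms(1)]] by simp
  then show ne: "D \<noteq> {}" by (auto simp: D_def)
  have "0 \<le> d" if "d \<in> D" for d
    using newton_polyhedron_halfplane[of f 1 0 0 d d] that by (simp add: weight_ge_def D_def)
  then show bd: "bdd_below D" by (rule bdd_belowI)
  have uniq: "\<not> d < d'" if d: "(d, d) \<in> frontier ?N" and d': "(d', d') \<in> frontier ?N" for d d'
  proof
    assume less: "d < d'"
    have "(d, d) \<in> closure ?N" using d by (simp add: frontier_def)
    then obtain z where z: "z \<in> ?N" "dist z (d, d) < d' - d"
      using less closure_approachable by (metis diff_gt_0_iff_gt)
    obtain a b where ab: "z = (a, b)" by force
    have "a < d'" "b < d'"
      using z(2) dist_fst_le[of z "(d, d)"] dist_snd_le[of z "(d, d)"] by (auto simp: ab dist_real_def)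
    then have "(d', d') \<in> {a<..} \<times> {b<..}" by simp
    moreover have "{a<..} \<times> {b<..} \<subseteq> ?N"
      using newton_polyhedron_upward[of a b f] z(1) ab by auto
    ultimately have "(d', d') \<in> interior ?N"
      by (intro interiorI[of "{a<..} \<times> {b<..}"] open_Times open_greaterThan)
    then show False using d' by (simp add: frontier_def)
  qed
  have "(Inf D, Inf D) \<in> frontier ?N"
  proof -
    have "(Inf D, Inf D) \<in> closure ?N"
      unfolding closure_approachable
    proof (intro allI impI)
      fix e :: real assume "e > 0"
      then obtain d where d: "d \<in> D" "d < Inf D + e / 2"
        using cInf_less_iff[OF ne bd, of "Inf D + e / 2"] by auto
      have "Inf D \<le> d" by (rule cInf_lower[OF d(1) bd])
      moreover have "dist (d, d) (Inf D, Inf D) \<le> \<bar>d - Inf D\<bar> + \<bar>d - Inf D\<bar>"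
        using norm_Pair_le[of "d - Inf D" "d - Inf D"] by (simp add: dist_norm)
      ultimately have "dist (d, d) (Inf D, Inf D) < e" using d(2) by simp
      then show "\<exists>y\<in>?N. dist y (Inf D, Inf D) < e" using d(1) by (auto simp: D_def)
    qed
    moreover have "(Inf D, Inf D) \<notin> interior ?N"
    proof
      assume "(Inf D, Inf D) \<in> interior ?N"
      then obtain e where e: "e > 0" "ball (Inf D, Inf D) e \<subseteq> ?N"
        by (meson mem_interior)
      let ?d = "Inf D - e / 4"
      have "dist (Inf D, Inf D) (?d, ?d) \<le> e / 4 + e / 4"
        using norm_Pair_le[of "e / 4" "e / 4"] e(1) by (simp add: dist_norm)
      then have "(?d, ?d) \<in> ?N" using e by auto
      then have "Inf D \<le> ?d" by (intro cInf_lower bd) (simp add: D_def)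
      then show False using e(1) by simp
    qed
    ultimately show ?thesis by (simp add: frontier_def)
  qed
  note fr = this
  show "newton_distance f = Inf D"
    unfolding newton_distance_def
  proof (rule the_equality)
    show "(Inf D, Inf D) \<in> frontier ?N" by (rule fr)
    fix d assume "(d, d) \<in> frontier ?N"
    then show "d = Inf D" using uniq[OF _ fr] uniq[OF fr] by (meson linorder_neqE)
  qed
qed

lemma newton_distance_ge:
  assumes "taylor_coeff f j0 k0 \<noteq> 0" "weight_ge (taylor_coeff f) v w M" "0 \<le> v" "0 \<le> w"
  shows "M \<le> newton_distance f * (v + w)"
proof -
  let ?D = "{d. (d, d) \<in> newton_polyhedron f}"
  note nd = newton_distance_eq_Inf[OF assms(1)]
  have le: "M \<le> d * (v + w)" if "d \<in> ?D" for d
    using newton_polyhedron_halfplane[OF assms(2-4), of d d] that by (simp add: algebra_simps)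
  show ?thesis
  proof (cases "v + w = 0")
    case True
    then show ?thesis using le nd(1) by fastforce
  next
    case False
    then have pos: "v + w > 0" using assms by linarith
    have "M / (v + w) \<le> Inf ?D"
      by (rule cInf_greatest[OF nd(1)]) (use le pos in \<open>simp add: field_simps\<close>)
    then show ?thesis using pos nd(3) by (simp add: field_simps)
  qed
qed

lemma newton_distance_le:
  assumes "(d, d) \<in> newton_polyhedron f" "taylor_coeff f j0 k0 \<noteq> 0"
  shows "newton_distance f \<le> d"
  using newton_distance_eq_Inf[OF assms(2)] assms(1) by (simp add: cInf_lower)

text \<open>The quadrant strictly below the diagonal frontier point misses the polyhedron, and a line
  separating the two has a nonnegative normal vector.\<close>

lemma newton_distance_supporting_weight:
  assumes "taylor_coeff f j0 k0 \<noteq> 0"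
  obtains v w where "0 \<le> v" "0 \<le> w" "0 < v + w"
    "weight_ge (taylor_coeff f) v w (newton_distance f * (v + w))"
proof -
  let ?d = "newton_distance f"
  have S: "{..<?d} \<times> {..<?d} \<inter> newton_polyhedron f = {}"
  proof (rule ccontr)
    assume "\<not> ?thesis"
    then obtain x y where xy: "x < ?d" "y < ?d" "(x, y) \<in> newton_polyhedron f" by auto
    have "(max x y, max x y) \<in> newton_polyhedron f" by (rule newton_polyhedron_upward[OF xy(3)]) auto
    then have "?d \<le> max x y" by (rule newton_distance_le[OF _ assms])
    then show False using xy by auto
  qed
  have "convex ({..<?d} \<times> {..<?d})" by (intro convex_Times) auto
  moreover have "convex (newton_polyhedron f)" by (simp add: newton_polyhedron_def)
  moreover have "(?d - 1, ?d - 1) \<in> {..<?d} \<times> {..<?d}" by simp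
  moreover have "newton_polyhedron f \<noteq> {}" using taylor_support_in_newton_polyhedron[OF assms] by blast
  ultimately obtain a b where ab: "a \<noteq> 0" "\<forall>x\<in>{..<?d} \<times> {..<?d}. inner a x \<le> b" "\<forall>x\<in>newton_polyhedron f. inner a x \<ge> b"
    using separating_hyperplane_sets[OF _ _ _ _ S] by (metis empty_iff)
  obtain v w where vw: "a = (v, w)" by force
  have low: "v * x + w * y \<le> b" if "x < ?d" "y < ?d" for x y
    using ab(2) that by (auto simp: vw)
  have v: "0 \<le> v"
  proof (rule ccontr)
    assume "\<not> 0 \<le> v"
    then have v: "v < 0" by simp
    define x where "x = min (?d - 1) ((b + 1 - w * (?d - 1)) / v)"
    have "v * ((b + 1 - w * (?d - 1)) / v) \<le> v * x"
      using v by (intro mult_left_mono_neg) (auto simp: x_def)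
    then have "b + 1 \<le> v * x + w * (?d - 1)" using v by simp
    moreover have "v * x + w * (?d - 1) \<le> b" by (rule low) (auto simp: x_def)
    ultimately show False by linarith
  qed
  have w: "0 \<le> w"
  proof (rule ccontr)
    assume "\<not> 0 \<le> w"
    then have w: "w < 0" by simp
    define y where "y = min (?d - 1) ((b + 1 - v * (?d - 1)) / w)"
    have "w * ((b + 1 - v * (?d - 1)) / w) \<le> w * y"
      using w by (intro mult_left_mono_neg) (auto simp: y_def)
    then have "b + 1 \<le> v * (?d - 1) + w * y" using w by simp
    moreover have "v * (?d - 1) + w * y \<le> b" by (rule low) (auto simp: y_def)
    ultimately show False by linarith
  qed
  have pos: "0 < v + w" using v w ab(1) vw by (cases "v = 0"; cases "w = 0") (auto simp: zero_prod_def)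
  have "?d * (v + w) \<le> b"
  proof (rule field_le_epsilon)
    fix e :: real assume e: "e > 0"
    define s where "s = e / (v + w)"
    have "s > 0" using e pos by (simp add: s_def)
    then have "v * (?d - s) + w * (?d - s) \<le> b" by (intro low) auto
    moreover have "v * (?d - s) + w * (?d - s) = ?d * (v + w) - e"
    proof -
      have "s * (v + w) = e" using pos by (simp add: s_def)
      then show ?thesis by (simp add: algebra_simps)
    qed
    ultimately show "?d * (v + w) \<le> b + e" by linarith
  qed
  moreover have "b \<le> v * real j + w * real k" if "taylor_coeff f j k \<noteq> 0" for j k
    using ab(3) taylor_support_in_newton_polyhedron[OF that] by (auto simp: vw)
  ultimately have "weight_ge (taylor_coeff f) v w (?d * (v + w))"
    unfolding weight_ge_def by (meson order_trans)
  then show ?thesis using that v w pos by blast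
qed

text \<open>If the bisectrix meets the polyhedron in an inner point of a segment of a supporting line, then
  every face through this point contains the segment. So vertices are excluded and the edge cut
  out by the line is the only face to choose from.\<close>

lemma principal_face_edge:
  fixes P1 P2 :: "real \<times> real"
  assumes nz: "taylor_coeff f j0 k0 \<noteq> 0"
    and w: "weight_ge (taylor_coeff f) v w M" "0 < v" "0 < w"
    and P: "P1 \<in> newton_polyhedron f" "P2 \<in> newton_polyhedron f" "P1 \<noteq> P2"
    and line: "inner (v, w) P1 = M" "inner (v, w) P2 = M"
    and seg: "(p, p) \<in> open_segment P1 P2"
  shows "P1 \<in> principal_face f" "P2 \<in> principal_face f"
proof -
  let ?N = "newton_polyhedron f"
  define E where "E = ?N \<inter> {z. inner (v, w) z = M}"
  have conv: "convex ?N" by (simp add: newton_polyhedron_def)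
  have "open_segment P1 P2 \<subseteq> E"
  proof -
    have "convex E" unfolding E_def by (intro convex_Int conv convex_hyperplane)
    moreover have "P1 \<in> E" "P2 \<in> E" using P line by (auto simp: E_def)
    ultimately show ?thesis by (meson convex_contains_open_segment)
  qed
  then have pE: "(p, p) \<in> E" using seg by blast
  have nd: "newton_distance f = p"
  proof (rule antisym)
    show "newton_distance f \<le> p" using pE newton_distance_le[OF _ nz] by (auto simp: E_def)
    have "M \<le> newton_distance f * (v + w)" using newton_distance_ge[OF nz w(1)] w by simp
    moreover have "M = p * (v + w)" using pE by (auto simp: E_def algebra_simps)
    ultimately show "p \<le> newton_distance f" using w by (simp add: mult_le_cancel_right)
  qed
  have Eface: "E face_of ?N"
    unfolding E_def
  proof (rule face_of_Int_supporting_hyperplane_ge[OF conv])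
    fix z assume "z \<in> ?N"
    then show "M \<le> inner (v, w) z"
      using newton_polyhedron_halfplane[OF w(1), of "fst z" "snd z"] w by (cases z) auto
  qed
  have two: "aff_dim {P1, P2} = 1" using P(3) by (simp add: aff_dim_2)
  have PE: "P1 \<in> E" "P2 \<in> E" using P line by (auto simp: E_def)
  have dimE: "aff_dim E = 1"
  proof (rule antisym)
    have "(v, w) \<noteq> (0 :: real \<times> real)" using w by (simp add: zero_prod_def)
    then have "aff_dim {z. inner (v, w) z = M} = 1" using aff_dim_hyperplane[of "(v, w)" M] by simp
    moreover have "aff_dim E \<le> aff_dim {z. inner (v, w) z = M}" by (rule aff_dim_subset) (auto simp: E_def)
    ultimately show "aff_dim E \<le> 1" by simp
    show "1 \<le> aff_dim E" using aff_dim_subset[of "{P1, P2}" E] PE two by simp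
  qed
  have faces: "F edge_of ?N" if "newton_face f F" "(p, p) \<in> F" for F
    using that seg P by (auto simp: newton_face_def extreme_point_of_def)
  have eq: "F = E" if "newton_face f F" "(p, p) \<in> F" for F
  proof -
    have F: "F face_of ?N" "aff_dim F = 1" using faces[OF that] by (auto simp: edge_of_def)
    have PF: "P1 \<in> F" "P2 \<in> F" using face_ofD[OF F(1) seg] P that(2) by blast+
    have "aff_dim (F \<inter> E) \<ge> 1" using aff_dim_subset[of "{P1, P2}" "F \<inter> E"] PE PF two by simp
    moreover have FE: "F \<inter> E face_of ?N" by (rule face_of_Int[OF F(1) Eface])
    have "F \<inter> E face_of F" "F \<inter> E face_of E"
      using FE F(1) Eface by (auto intro: face_of_subset[OF FE] dest: face_of_imp_subset)
    ultimately have "F \<inter> E = F" "F \<inter> E = E"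
      using face_of_aff_dim_lt[of F "F \<inter> E"] face_of_aff_dim_lt[of E "F \<inter> E"] F dimE
        face_of_imp_convex[OF F(1)] face_of_imp_convex[OF Eface] by fastforce+
    then show ?thesis by simp
  qed
  have nfE: "newton_face f E" using Eface dimE by (simp add: newton_face_def edge_of_def)
  have "principal_face f = E"
    unfolding principal_face_def nd Let_def
  proof (rule the_equality)
    show "newton_face f E \<and> (p, p) \<in> E \<and> (\<forall>G. newton_face f G \<and> (p, p) \<in> G \<longrightarrow> aff_dim E \<le> aff_dim G)"
      using nfE pE eq by blast
  qed (use eq in blast)
  then show "P1 \<in> principal_face f" "P2 \<in> principal_face f" using PE by auto
qed

section \<open>Bad roots and changes of coordinates\<close>

lemma order_add_order_le_degree:
  fixes P :: "real poly"
  assumes "P \<noteq> 0" "a \<noteq> b"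
  shows "order a P + order b P \<le> degree P"
proof -
  obtain R where R: "P = [:-a, 1:] ^ order a P * R" "\<not> [:-a, 1:] dvd R"
    using order_decomp[OF assms(1)] by blast
  have nz: "[:-a, 1:] ^ order a P \<noteq> 0" "R \<noteq> 0" using R assms(1) by auto
  have "order b P = order b ([:-a, 1:] ^ order a P) + order b R"
    using R(1) assms(1) order_mult[of "[:-a, 1:] ^ order a P" R b] by metis
  also have "order b ([:-a, 1:] ^ order a P) = 0"
    using assms(2) by (intro order_0I) (simp add: poly_power)
  finally have "order b P \<le> degree R" using order_degree[OF nz(2), of b] by simp
  moreover have "degree P = order a P + degree R"
    using degree_mult_eq[OF nz] R(1) by (simp add: degree_linear_power)
  ultimately show ?thesis by simp
qed

lemma order_pcompose_shift_le:
  fixes P :: "real poly"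
  assumes "P \<noteq> 0"
  shows "order b (pcompose P [:\<beta>, 1:]) \<le> order (b + \<beta>) P"
proof -
  let ?n = "order b (pcompose P [:\<beta>, 1:])"
  have "[:-b, 1:] ^ ?n dvd pcompose P [:\<beta>, 1:]" by (rule order_1)
  then obtain R where R: "pcompose P [:\<beta>, 1:] = [:-b, 1:] ^ ?n * R"
    unfolding dvd_def by blast
  have base: "pcompose [:-b, 1:] [:-\<beta>, 1:] = [:-(b + \<beta>), 1:]" by (simp add: pcompose_pCons)
  have pow: "pcompose ([:-b, 1:] ^ n) [:-\<beta>, 1:] = [:-(b + \<beta>), 1:] ^ n" for n
    by (induction n) (simp_all only: power_Suc power_0 pcompose_mult pcompose_1 base)
  have "P = pcompose (pcompose P [:\<beta>, 1:]) [:-\<beta>, 1:]"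
    by (simp add: pcompose_assoc[symmetric] pcompose_pCons pcompose_idR)
  also have "\<dots> = [:-(b + \<beta>), 1:] ^ ?n * pcompose R [:-\<beta>, 1:]"
    by (subst R) (simp only: pcompose_mult pow)
  finally have "[:-(b + \<beta>), 1:] ^ ?n dvd P" by (metis dvd_triv_left)
  then show ?thesis using assms order_divides by blast
qed

lemma init_weight_unique:
  assumes "weight_ge c 1 (real q) (real m)" "init_poly c q m \<noteq> 0"
    and "weight_ge c 1 (real q) (real m')" "init_poly c q m' \<noteq> 0"
  shows "m = m'"
proof -
  have "m2 \<le> m1" if w: "weight_ge c 1 (real q) (real m2)" and nz: "init_poly c q m1 \<noteq> 0" for m1 m2
  proof -
    obtain k where "coeff (init_poly c q m1) k \<noteq> 0" using nz leading_coeff_0_iff by blast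
    then have "q * k \<le> m1" "c (m1 - q * k) k \<noteq> 0" by (auto simp: coeff_init_poly split: if_splits)
    then show ?thesis using w unfolding weight_ge_nat by fastforce
  qed
  then show ?thesis using assms by (metis antisym)
qed

lemma degree_init_poly: "init_poly c q m \<noteq> 0 \<Longrightarrow> q * degree (init_poly c q m) \<le> m"
proof -
  assume "init_poly c q m \<noteq> 0"
  then have "coeff (init_poly c q m) (degree (init_poly c q m)) \<noteq> 0" by simp
  then show ?thesis by (auto simp: coeff_init_poly split: if_splits)
qed

text \<open>Equivalently, the multiplicity of \<open>\<beta>\<close> exceeds the value \<open>m / (1 + q)\<close> at which the line
  \<open>t\<^sub>1 + q t\<^sub>2 = m\<close> meets the bisectrix. Measuring against this value instead of the Newton
  distance makes the notion depend on a single initial form.\<close>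

definition bad_root :: "(nat \<Rightarrow> nat \<Rightarrow> real) \<Rightarrow> nat \<Rightarrow> real \<Rightarrow> bool" where
  "bad_root c q \<beta> \<longleftrightarrow> (\<exists>m. weight_ge c 1 (real q) (real m) \<and> init_poly c q m \<noteq> 0 \<and>
     m < order \<beta> (init_poly c q m) * (1 + q))"

text \<open>The initial form has degree at most \<open>m / q \<le> 2 m / (1 + q)\<close>, too little for two bad
  roots.\<close>

lemma bad_root_unique:
  assumes "bad_root c q \<beta>" "bad_root c q \<gamma>" "1 \<le> q"
  shows "\<beta> = \<gamma>"
proof (rule ccontr)
  assume ne: "\<beta> \<noteq> \<gamma>"
  obtain m where m: "weight_ge c 1 (real q) (real m)" "init_poly c q m \<noteq> 0"
    "m < order \<beta> (init_poly c q m) * (1 + q)" using assms(1) unfolding bad_root_def by blast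
  obtain m' where m': "weight_ge c 1 (real q) (real m')" "init_poly c q m' \<noteq> 0"
    "m' < order \<gamma> (init_poly c q m') * (1 + q)" using assms(2) unfolding bad_root_def by blast
  have [simp]: "m' = m" using init_weight_unique[OF m'(1,2) m(1,2)] .
  let ?n = "order \<beta> (init_poly c q m) + order \<gamma> (init_poly c q m)"
  have "?n \<le> degree (init_poly c q m)" by (rule order_add_order_le_degree[OF m(2) ne])
  then have "q * ?n \<le> q * degree (init_poly c q m)" by (rule mult_le_mono2)
  then have "q * ?n \<le> m" using degree_init_poly[OF m(2)] by linarith
  moreover have "2 * m < ?n * (1 + q)" using m(3) m'(3) by (simp add: algebra_simps)
  moreover have "?n * (1 + q) \<le> ?n * (2 * q)" using assms(3) by (intro mult_le_mono2) simp
  ultimately show False by (simp add: algebra_simps)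
qed

lemma has_taylor_swap:
  assumes "has_taylor g c"
  shows "has_taylor (\<lambda>(x, y). g (y, x)) (\<lambda>j k. c k j)"
  unfolding has_taylor_def
proof
  fix N
  obtain C \<delta> where \<delta>: "0 < \<delta>"
    and C: "\<And>x y. \<bar>x\<bar> \<le> \<delta> \<Longrightarrow> \<bar>y\<bar> \<le> \<delta> \<Longrightarrow>
       \<bar>g (x, y) - (\<Sum>j<N. \<Sum>k<N. c j k * x ^ j * y ^ k)\<bar> \<le> C * (\<bar>x\<bar> ^ N + \<bar>y\<bar> ^ N)"
    using assms unfolding has_taylor_def by blast
  have "\<bar>(case (x, y) of (x, y) \<Rightarrow> g (y, x)) - (\<Sum>j<N. \<Sum>k<N. c k j * x ^ j * y ^ k)\<bar> \<le> C * (\<bar>x\<bar> ^ N + \<bar>y\<bar> ^ N)"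
    if "\<bar>x\<bar> \<le> \<delta>" "\<bar>y\<bar> \<le> \<delta>" for x y
  proof -
    have "(\<Sum>j<N. \<Sum>k<N. c k j * x ^ j * y ^ k) = (\<Sum>j<N. \<Sum>k<N. c j k * y ^ j * x ^ k)"
      by (subst sum.swap) (simp only: mult_ac)
    then show ?thesis using C[OF that(2,1)] by (simp add: add.commute)
  qed
  then show "\<exists>C \<delta>. 0 < \<delta> \<and> (\<forall>x y. \<bar>x\<bar> \<le> \<delta> \<longrightarrow> \<bar>y\<bar> \<le> \<delta> \<longrightarrow>
      \<bar>(case (x, y) of (x, y) \<Rightarrow> g (y, x)) - (\<Sum>j<N. \<Sum>k<N. c k j * x ^ j * y ^ k)\<bar> \<le> C * (\<bar>x\<bar> ^ N + \<bar>y\<bar> ^ N))"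
    using \<delta> by blast
qed

lemma weight_ge_swap: "weight_ge (\<lambda>j k. c k j) v w M \<longleftrightarrow> weight_ge c w v M"
  unfolding weight_ge_def by (auto simp: add.commute)

lemma smooth_germ_swap: "smooth_germ g \<Longrightarrow> smooth_germ (\<lambda>(x, y). g (y, x))"
proof -
  assume "smooth_germ g"
  moreover have "smooth_germ (\<lambda>z :: real \<times> real. (snd z, fst z))"
    by (intro smooth_germ_linear bounded_linear_Pair bounded_linear_fst bounded_linear_snd)
  ultimately show ?thesis using smooth_germ_compose[of g "\<lambda>z. (snd z, fst z)"]
    by (simp add: case_prod_unfold)
qed

text \<open>For equal weights the order is invariant under changes of coordinates.\<close>

lemma box_bound_compose:
  assumes h: "box_bound h 1 1 M"
    and u: "has_taylor u \<theta>1" "\<theta>1 0 0 = 0" and v: "has_taylor v \<theta>2" "\<theta>2 0 0 = 0"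
    and eq: "\<forall>\<^sub>F z in nhds (0, 0). g z = h (u z, v z)"
  shows "box_bound g 1 1 M"
proof -
  obtain C1 \<delta>1 where C1: "0 < \<delta>1"
    "\<And>t x y. 0 < t \<Longrightarrow> t \<le> \<delta>1 \<Longrightarrow> \<bar>x\<bar> \<le> t powr 1 \<Longrightarrow> \<bar>y\<bar> \<le> t powr 1 \<Longrightarrow> \<bar>u (x, y)\<bar> \<le> C1 * t powr 1"
    using box_bound_Lipschitz[OF u] unfolding box_bound_def by blast
  obtain C2 \<delta>2 where C2: "0 < \<delta>2"
    "\<And>t x y. 0 < t \<Longrightarrow> t \<le> \<delta>2 \<Longrightarrow> \<bar>x\<bar> \<le> t powr 1 \<Longrightarrow> \<bar>y\<bar> \<le> t powr 1 \<Longrightarrow> \<bar>v (x, y)\<bar> \<le> C2 * t powr 1"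
    using box_bound_Lipschitz[OF v] unfolding box_bound_def by blast
  define K where "K = max C1 C2"
  from box_bound_scaled[OF h zero_less_one zero_less_one, of K] obtain C3 \<delta>3 where C3: "0 < \<delta>3"
    "\<And>t x y. 0 < t \<Longrightarrow> t \<le> \<delta>3 \<Longrightarrow> \<bar>x\<bar> \<le> K * t powr 1 \<Longrightarrow> \<bar>y\<bar> \<le> K * t powr 1 \<Longrightarrow> \<bar>h (x, y)\<bar> \<le> C3 * t powr M"
    by blast
  obtain \<epsilon> where \<epsilon>: "\<epsilon> > 0" "\<And>z. dist z (0, 0) < \<epsilon> \<Longrightarrow> g z = h (u z, v z)"
    using eq unfolding eventually_nhds_metric by blast
  define \<delta> where "\<delta> = min (min \<delta>1 \<delta>2) (min \<delta>3 (\<epsilon> / 4))"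
  have \<delta>: "\<delta> > 0" using C1 C2 C3 \<epsilon> by (simp add: \<delta>_def)
  have "\<bar>g (x, y)\<bar> \<le> C3 * t powr M"
    if t: "0 < t" "t \<le> \<delta>" and x: "\<bar>x\<bar> \<le> t powr 1" and y: "\<bar>y\<bar> \<le> t powr 1" for t x y
  proof -
    have td: "t \<le> \<delta>1" "t \<le> \<delta>2" "t \<le> \<delta>3" "t \<le> \<epsilon> / 4" using t by (auto simp: \<delta>_def)
    have "dist (x, y) (0, 0) \<le> \<bar>x\<bar> + \<bar>y\<bar>" using norm_Pair_le[of x y] by (simp add: dist_norm)
    also have "\<dots> \<le> \<epsilon> / 4 + \<epsilon> / 4" using x y t td by simp
    also have "\<dots> < \<epsilon>" using \<epsilon> by simp
    finally have gz: "g (x, y) = h (u (x, y), v (x, y))" by (rule \<epsilon>(2))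
    have "\<bar>u (x, y)\<bar> \<le> C1 * t powr 1" by (rule C1(2)[OF t(1) td(1) x y])
    also have "\<dots> \<le> K * t powr 1" by (intro mult_right_mono) (auto simp: K_def)
    finally have 1: "\<bar>u (x, y)\<bar> \<le> K * t powr 1" .
    have "\<bar>v (x, y)\<bar> \<le> C2 * t powr 1" by (rule C2(2)[OF t(1) td(2) x y])
    also have "\<dots> \<le> K * t powr 1" by (intro mult_right_mono) (auto simp: K_def)
    finally have 2: "\<bar>v (x, y)\<bar> \<le> K * t powr 1" .
    show ?thesis unfolding gz by (rule C3(2)[OF t(1) td(3) 1 2])
  qed
  then show ?thesis unfolding box_bound_def using \<delta> by blast
qed

lemma taylor_coeff_0_0: "taylor_coeff f 0 0 = f (0, 0)"
  by (simp add: taylor_coeff_def)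

definition germ_inverse :: "(real \<times> real \<Rightarrow> real \<times> real) \<Rightarrow> (real \<times> real \<Rightarrow> real \<times> real) \<Rightarrow> bool" where
  "germ_inverse \<Phi> \<Theta> \<longleftrightarrow> smooth_germ \<Phi> \<and> smooth_germ \<Theta> \<and> \<Phi> (0, 0) = (0, 0) \<and> \<Theta> (0, 0) = (0, 0) \<and>
     (\<forall>\<^sub>F z in nhds (0, 0). \<Theta> (\<Phi> z) = z) \<and> (\<forall>\<^sub>F z in nhds (0, 0). \<Phi> (\<Theta> z) = z)"

lemma germ_inverse_sym: "germ_inverse \<Phi> \<Theta> \<Longrightarrow> germ_inverse \<Theta> \<Phi>"
  by (simp add: germ_inverse_def)

lemma smooth_germ_tendsto:
  assumes "smooth_germ \<Phi>"
  shows "filterlim \<Phi> (nhds (\<Phi> (0, 0))) (nhds (0, 0))"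
proof -
  obtain U where U: "open U" "(0, 0) \<in> U" "smooth_on U \<Phi>" using assms by (auto simp: smooth_germ_def)
  have "Ck_on 0 U \<Phi>" using U(3) unfolding smooth_on_def by blast
  then have "isCont \<Phi> (0, 0)" using U by (simp add: continuous_on_eq_continuous_at)
  then show ?thesis by (simp add: isCont_def tendsto_at_iff_tendsto_nhds)
qed

lemma germ_inverse_compose:
  assumes "germ_inverse \<Phi> \<Theta>" "germ_inverse \<Phi>' \<Theta>'"
  shows "germ_inverse (\<lambda>z. \<Phi> (\<Phi>' z)) (\<lambda>z. \<Theta>' (\<Theta> z))"
proof -
  have aux: "\<forall>\<^sub>F z in nhds (0, 0). \<Theta>' (\<Theta> (\<Phi> (\<Phi>' z))) = z"
    if "germ_inverse \<Phi> \<Theta>" "germ_inverse \<Phi>' \<Theta>'" for \<Phi> \<Theta> \<Phi>' \<Theta>'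
  proof -
    have "filterlim \<Phi>' (nhds (0, 0)) (nhds (0, 0))"
      using smooth_germ_tendsto[of \<Phi>'] that(2) by (simp add: germ_inverse_def)
    moreover have "\<forall>\<^sub>F z in nhds (0, 0). \<Theta> (\<Phi> z) = z" using that(1) by (simp add: germ_inverse_def)
    ultimately have "\<forall>\<^sub>F z in nhds (0, 0). \<Theta> (\<Phi> (\<Phi>' z)) = \<Phi>' z"
      using eventually_compose_filterlim by blast
    moreover have "\<forall>\<^sub>F z in nhds (0, 0). \<Theta>' (\<Phi>' z) = z" using that(2) by (simp add: germ_inverse_def)
    ultimately show ?thesis by eventually_elim simp
  qed
  show ?thesis unfolding germ_inverse_def
    using assms aux[OF assms] aux[OF germ_inverse_sym[OF assms(2)] germ_inverse_sym[OF assms(1)]]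
    by (auto simp: germ_inverse_def intro: smooth_germ_compose)
qed

lemma local_coordinates_germ_inverse:
  assumes "local_coordinates \<Phi>"
  obtains \<Theta> where "germ_inverse \<Phi> \<Theta>"
proof -
  obtain U V \<Theta> where U: "open U" "(0, 0) \<in> U" "open V" "homeomorphism U V \<Phi> \<Theta>"
    and sm: "smooth_on U \<Phi>" "smooth_on V \<Theta>" and \<Phi>0: "\<Phi> (0, 0) = (0, 0)"
    using assms unfolding local_coordinates_def by blast
  have V0: "(0, 0) \<in> V" using U \<Phi>0 by (metis homeomorphism_image1 imageI)
  have "\<Theta> (0, 0) = (0, 0)" using homeomorphism_apply1[OF U(4) U(2)] \<Phi>0 by simp
  moreover have "\<forall>\<^sub>F z in nhds (0, 0). \<Theta> (\<Phi> z) = z"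
    using eventually_nhds_in_open[OF U(1,2)] homeomorphism_apply1[OF U(4)] by (auto elim: eventually_mono)
  moreover have "\<forall>\<^sub>F z in nhds (0, 0). \<Phi> (\<Theta> z) = z"
    using eventually_nhds_in_open[OF U(3) V0] homeomorphism_apply2[OF U(4)] by (auto elim: eventually_mono)
  moreover have "smooth_germ \<Phi>" "smooth_germ \<Theta>" using U V0 sm by (auto simp: smooth_germ_def)
  ultimately have "germ_inverse \<Phi> \<Theta>" using \<Phi>0 by (simp add: germ_inverse_def)
  then show ?thesis using that by blast
qed

lemma smooth_germ_fst: "smooth_germ \<Theta> \<Longrightarrow> smooth_germ (\<lambda>z. fst (\<Theta> z :: real \<times> real))"
  by (rule smooth_germ_bounded_linear[OF bounded_linear_fst])

lemma smooth_germ_snd: "smooth_germ \<Theta> \<Longrightarrow> smooth_germ (\<lambda>z. snd (\<Theta> z :: real \<times> real))"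
  by (rule smooth_germ_bounded_linear[OF bounded_linear_snd])

lemma box_bound_germ_inverse:
  assumes "germ_inverse \<Phi> \<Theta>" "box_bound h 1 1 M" "\<forall>\<^sub>F z in nhds (0, 0). g z = h (\<Theta> z)"
  shows "box_bound g 1 1 M"
  using assms by (intro box_bound_compose[OF assms(2)
      has_taylor_smooth[of "\<lambda>z. fst (\<Theta> z)"] _ has_taylor_smooth[of "\<lambda>z. snd (\<Theta> z)"]])
    (simp_all add: germ_inverse_def smooth_germ_fst smooth_germ_snd taylor_coeff_0_0)

text \<open>A germ is of infinite type when it is \<open>O(t powr M)\<close> on squares for all \<open>M\<close>, a condition that
  passes through the inverse coordinates.\<close>

lemma taylor_nonzero_compose:
  assumes "germ_inverse \<Phi> \<Theta>" "smooth_germ f" "taylor_coeff f j0 k0 \<noteq> 0"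
  shows "\<exists>j k. taylor_coeff (\<lambda>z. f (\<Phi> z)) j k \<noteq> 0"
proof (rule ccontr)
  assume "\<not> ?thesis"
  then have w: "weight_ge (taylor_coeff (\<lambda>z. f (\<Phi> z))) 1 1 M" for M by (simp add: weight_ge_def)
  have "smooth_germ (\<lambda>z. f (\<Phi> z))"
    using smooth_germ_compose[OF assms(2), of \<Phi>] assms(1) by (simp add: germ_inverse_def)
  then have bb: "box_bound (\<lambda>z. f (\<Phi> z)) 1 1 M" for M
    using box_bound_if_weight_ge[OF has_taylor_smooth w] by simp
  have eq: "\<forall>\<^sub>F z in nhds (0, 0). f z = (\<lambda>z. f (\<Phi> z)) (\<Theta> z)"
  proof -
    have "\<forall>\<^sub>F z in nhds (0, 0). \<Phi> (\<Theta> z) = z" using assms(1) by (simp add: germ_inverse_def)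
    then show ?thesis by eventually_elim simp
  qed
  have "box_bound f 1 1 M" for M by (rule box_bound_germ_inverse[OF assms(1) bb eq])
  then have "weight_ge (taylor_coeff f) 1 1 M" for M
    using weight_ge_if_box_bound[OF has_taylor_smooth[OF assms(2)]] by simp
  from this[of "real j0 + real k0 + 1"] assms(3) show False by (force simp: weight_ge_def)
qed

text \<open>Here \<open>u\<close> is a component of the inverse coordinates and \<open>u'\<close> the corresponding projection.
  If \<open>u\<close> had no linear part, then the projection, being \<open>u\<close> in the coordinates \<open>\<Phi>\<close>, would
  be of order \<open>2\<close>, although it is the identity on an axis.\<close>

lemma nonzero_linear_part:
  assumes "germ_inverse \<Phi> \<Theta>" "smooth_germ u" "u (0, 0) = 0"
    and id: "\<And>y. \<exists>z. z \<in> {(y, 0), (0, y)} \<and> u' z = y"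
    and eq: "\<forall>\<^sub>F z in nhds (0, 0). u' z = u (\<Phi> z)"
  shows "taylor_coeff u 1 0 \<noteq> 0 \<or> taylor_coeff u 0 1 \<noteq> 0"
proof (rule ccontr)
  assume not: "\<not> ?thesis"
  have "weight_ge (taylor_coeff u) 1 1 2"
    unfolding weight_ge_def
  proof (intro allI impI)
    fix j k assume jk: "taylor_coeff u j k \<noteq> 0"
    have "\<not> (j = 0 \<and> k = 0) \<and> \<not> (j = 1 \<and> k = 0) \<and> \<not> (j = 0 \<and> k = 1)"
      using jk not assms(3) taylor_coeff_0_0[of u] by metis
    then have "2 \<le> j + k" by arith
    then have "real 2 \<le> real (j + k)" by (simp only: of_nat_le_iff)
    then show "2 \<le> 1 * real j + 1 * real k" by simp
  qed
  then have "box_bound u 1 1 2" using box_bound_if_weight_ge[OF has_taylor_smooth[OF assms(2)]] by simp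
  from box_bound_germ_inverse[OF germ_inverse_sym[OF assms(1)] this eq]
  have "box_bound u' 1 1 2" .
  then obtain C \<delta> where C: "0 < \<delta>"
    "\<And>t x y. 0 < t \<Longrightarrow> t \<le> \<delta> \<Longrightarrow> \<bar>x\<bar> \<le> t powr 1 \<Longrightarrow> \<bar>y\<bar> \<le> t powr 1 \<Longrightarrow> \<bar>u' (x, y)\<bar> \<le> C * t powr 2"
    unfolding box_bound_def by blast
  have "1 \<le> C * t powr 1" if t: "0 < t" "t \<le> \<delta>" for t
  proof -
    obtain z where z: "z \<in> {(t, 0), (0, t)}" "u' z = t" using id by blast
    have "\<bar>u' z\<bar> \<le> C * t powr 2"
      using z(1) C(2)[OF t, of t 0] C(2)[OF t, of 0 t] t by auto
    then have "t * 1 \<le> t * (C * t powr 1)" using z(2) t by (simp add: powr_numeral power2_eq_square mult_ac)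
    then show ?thesis using t by (simp only: mult_le_cancel_left_pos)
  qed
  from le_zero_if_le_small_powr[OF zero_less_one C(1) this] show False by simp
qed

section \<open>The adapting shear\<close>

lemma shear_coordinates:
  assumes "open I" "0 \<in> I" "smooth_on I \<psi>" "\<psi> 0 = 0"
  shows "local_coordinates (\<lambda>(x, y). (x, y + \<psi> x))"
    "germ_inverse (\<lambda>(x, y). (x, y + \<psi> x)) (\<lambda>(x, y). (x, y - \<psi> x))"
proof -
  let ?U = "I \<times> (UNIV :: real set)"
  have op: "open ?U" using assms by (simp add: open_Times)
  have neg: "smooth_on I (\<lambda>x. - \<psi> x)"
    using assms(3) unfolding smooth_on_def
    by (intro allI Ck_on_bounded_linear[OF assms(1) bounded_linear_minus[OF bounded_linear_ident]]) simp
  have sm: "smooth_on ?U (\<lambda>(x, y). (x, y + \<psi> x))" "smooth_on ?U (\<lambda>(x, y). (x, y - \<psi> x))"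
    using smooth_on_shear[OF assms(1,3)] smooth_on_shear[OF assms(1) neg] by (simp_all add: case_prod_unfold)
  have cont: "continuous_on ?U f" if "smooth_on ?U f" for f :: "real \<times> real \<Rightarrow> real \<times> real"
  proof -
    have "Ck_on 0 ?U f" using that unfolding smooth_on_def by blast
    then show ?thesis by simp
  qed
  have "homeomorphism ?U ?U (\<lambda>(x, y). (x, y + \<psi> x)) (\<lambda>(x, y). (x, y - \<psi> x))"
    by (rule homeomorphismI) (auto intro: cont sm)
  then show "local_coordinates (\<lambda>(x, y). (x, y + \<psi> x))"
    unfolding local_coordinates_def using op sm assms
    by (intro conjI exI[of _ ?U] exI[of _ "\<lambda>(x, y). (x, y - \<psi> x)"]) auto
  have "smooth_germ (\<lambda>(x, y). (x, y + \<psi> x))" "smooth_germ (\<lambda>(x, y). (x, y - \<psi> x))"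
    unfolding smooth_germ_def using op sm assms(2) by (intro exI[of _ ?U]; simp)+
  then show "germ_inverse (\<lambda>(x, y). (x, y + \<psi> x)) (\<lambda>(x, y). (x, y - \<psi> x))"
    using assms(4) by (simp add: germ_inverse_def case_prod_unfold)
qed

lemma taylor_nonzero_shear:
  assumes "smooth_germ f" "taylor_coeff f j0 k0 \<noteq> 0"
    and "open I" "0 \<in> I" "smooth_on I \<psi>" "\<psi> 0 = 0"
  shows "\<exists>j k. taylor_coeff (\<lambda>(x, y). f (x, \<psi> x + y)) j k \<noteq> 0"
proof -
  have "(\<lambda>z. f (case z of (x, y) \<Rightarrow> (x, y + \<psi> x))) = (\<lambda>(x, y). f (x, \<psi> x + y))"
    by (simp add: fun_eq_iff add.commute)
  then show ?thesis
    using taylor_nonzero_compose[OF shear_coordinates(2)[OF assms(3-6)] assms(1,2)] by simp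
qed

text \<open>The coefficient \<open>c q\<close> is the bad root at \<open>q\<close> of the function sheared by the partial sum
  \<open>\<Psi> q\<close>, or \<open>0\<close> if there is none. The full shear differs from this one by a function with
  leading term \<open>c q * x\<^sup>q\<close>, so a bad root \<open>b\<close> of the result comes from a bad root \<open>b + c q\<close>.
  Its existence makes \<open>c q\<close> a bad root too, and uniqueness gives \<open>b = 0\<close>.\<close>

lemma adapting_shear:
  assumes f: "smooth_germ f" "taylor_coeff f j0 k0 \<noteq> 0"
  obtains \<psi> where "smooth_on I1 \<psi>" "\<psi> 0 = 0"
    "\<And>q b. 1 \<le> q \<Longrightarrow> b \<noteq> 0 \<Longrightarrow> \<not> bad_root (taylor_coeff (\<lambda>(x, y). f (x, \<psi> x + y))) q b"
proof -
  obtain T where T: "\<And>i c. smooth_on I1 (T i c)" "\<And>i c. 1 \<le> i \<Longrightarrow> T i c 0 = 0" "\<And>i x. T i 0 x = 0"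
    "\<And>c. smooth_on I1 (\<lambda>x. \<Sum>i. T i (c i) x)"
    "\<And>c q. ((\<lambda>t. ((\<Sum>i. T i (c i) t) - (\<Sum>i<q. T i (c i) t)) / t ^ q) \<longlongrightarrow> c q) (at_right 0)"
    by (rule borel_summation) blast
  define G where "G p = (\<lambda>(x, y). f (x, p x + y))" for p :: "real \<Rightarrow> real"
  define B where "B q p = (if 1 \<le> q \<and> (\<exists>\<beta>. bad_root (taylor_coeff (G p)) q \<beta>)
     then SOME \<beta>. bad_root (taylor_coeff (G p)) q \<beta> else 0)" for q p
  define \<Psi> where "\<Psi> = rec_nat (\<lambda>_. 0) (\<lambda>q p x. p x + T q (B q p) x)"
  define c where "c q = B q (\<Psi> q)" for q
  have \<Psi>: "\<Psi> q = (\<lambda>x. \<Sum>i<q. T i (c i) x)" for q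
    by (induction q) (simp_all add: \<Psi>_def c_def)
  define \<psi> where "\<psi> x = (\<Sum>i. T i (c i) x)" for x
  have Ti0: "T i (c i) 0 = 0" for i
  proof (cases i)
    case 0
    have "c 0 = 0" by (simp add: c_def B_def)
    then show ?thesis using T(3) 0 by simp
  qed (use T(2) in simp)
  have \<psi>0: "\<psi> 0 = 0" by (simp add: \<psi>_def Ti0)
  have \<Psi>0: "\<Psi> q 0 = 0" for q by (simp add: \<Psi> Ti0)
  have sm\<psi>: "smooth_on I1 \<psi>" unfolding \<psi>_def by (rule T(4))
  have sm\<Psi>: "smooth_on I1 (\<Psi> q)" for q
    using T(1) unfolding smooth_on_def \<Psi> by (intro allI Ck_on_sum) auto
  have opI: "open I1" "0 \<in> I1" by auto
  have smG: "smooth_germ (G p)" if "smooth_on I1 p" "p 0 = 0" for p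
    unfolding G_def by (rule smooth_germ_shear[OF f(1) opI that])
  have "\<not> bad_root (taylor_coeff (G \<psi>)) q b" if q: "1 \<le> q" and b: "b \<noteq> 0" for q b
  proof
    let ?e = "taylor_coeff (G (\<Psi> q))"
    assume "bad_root (taylor_coeff (G \<psi>)) q b"
    then obtain m where m: "weight_ge (taylor_coeff (G \<psi>)) 1 (real q) (real m)" "init_poly (taylor_coeff (G \<psi>)) q m \<noteq> 0"
      "m < order b (init_poly (taylor_coeff (G \<psi>)) q m) * (1 + q)" unfolding bad_root_def by blast
    obtain j k where "?e j k \<noteq> 0"
      using taylor_nonzero_shear[OF f opI sm\<Psi> \<Psi>0, of q] unfolding G_def by blast
    then obtain m0 where m0: "weight_ge ?e 1 (real q) (real m0)" "init_poly ?e q m0 \<noteq> 0"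
      using init_exists q by blast
    have sh: "(\<lambda>(x, y). G (\<Psi> q) (x, (\<psi> x - \<Psi> q x) + y)) = G \<psi>" by (auto simp: G_def)
    have lim: "((\<lambda>t. (\<psi> t - \<Psi> q t) / t ^ q) \<longlongrightarrow> c q) (at_right 0)"
      unfolding \<psi>_def \<Psi> by (rule T(5))
    note tr = shear_transfer[where g = "G (\<Psi> q)" and \<eta> = "\<lambda>t. \<psi> t - \<Psi> q t", unfolded sh,
        OF has_taylor_smooth[OF smG[OF sm\<Psi> \<Psi>0]] has_taylor_smooth[OF smG[OF sm\<psi> \<psi>0]] q m0(1) lim]
    have "init_poly (taylor_coeff (G \<psi>)) q m0 \<noteq> 0"
      unfolding tr(2) using m0(2) by (simp add: pcompose_eq_0_iff)
    then have [simp]: "m0 = m" using init_weight_unique[OF tr(1) _ m(1,2)] by blast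
    have "m < order (b + c q) (init_poly ?e q m) * (1 + q)"
    proof -
      have "order b (init_poly (taylor_coeff (G \<psi>)) q m) \<le> order (b + c q) (init_poly ?e q m)"
        using tr(2) order_pcompose_shift_le[OF m0(2), of b "c q"] by simp
      then show ?thesis using m(3) mult_le_mono1 order_less_le_trans by blast
    qed
    then have bad: "bad_root ?e q (b + c q)" using m0 unfolding bad_root_def by auto
    then have "c q = (SOME \<beta>. bad_root ?e q \<beta>)" using q by (auto simp: c_def B_def)
    then have "bad_root ?e q (c q)" using bad someI[of "bad_root ?e q"] by metis
    from bad_root_unique[OF bad this q] show False using b by simp
  qed
  then show ?thesis using that[of \<psi>] sm\<psi> \<psi>0 unfolding G_def by blast
qed

text \<open>A bad root \<open>b \<noteq> 0\<close> makes the lowest and the highest exponent of the initial form lie so far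
  apart that the corresponding points \<open>P1\<close>, \<open>P2\<close> of the support are on different sides of the
  bisectrix. Both belong to the principal face, hence to the \<open>\<kappa>\<close>-line, whence
  \<open>\<kappa>1 = q \<kappa>2\<close>.\<close>

lemma swapped_bad_root_principal_face:
  assumes nz: "taylor_coeff f j0 k0 \<noteq> 0"
    and bad: "bad_root (\<lambda>j k. taylor_coeff f k j) q b" and b: "b \<noteq> 0" and q: "2 \<le> q"
    and \<kappa>: "0 \<le> \<kappa>1" "\<kappa>1 \<le> \<kappa>2" and face: "principal_face f \<subseteq> {(t1, t2). \<kappa>1 * t1 + \<kappa>2 * t2 = 1}"
  shows False
proof -
  let ?c = "\<lambda>j k. taylor_coeff f k j"
  obtain m where m: "weight_ge ?c 1 (real q) (real m)" "init_poly ?c q m \<noteq> 0"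
    "m < order b (init_poly ?c q m) * (1 + q)" using bad unfolding bad_root_def by blast
  let ?P = "init_poly ?c q m"
  define n where "n = order b ?P"
  define k1 where "k1 = degree ?P"
  define k2 where "k2 = order 0 ?P"
  have k12: "k2 + n \<le> k1" using order_add_order_le_degree[OF m(2), of 0 b] b by (simp add: k1_def k2_def n_def)
  have qk1: "q * k1 \<le> m" unfolding k1_def by (rule degree_init_poly[OF m(2)])
  have mn: "m < n * (1 + q)" using m(3) by (simp add: n_def)
  have mk1: "m < k1 * (1 + q)" using mn mult_le_mono1[of n k1 "1 + q"] k12 by linarith
  have k2m: "k2 * (1 + q) < m"
  proof -
    have "q * (k2 + n) \<le> q * k1" using k12 by (rule mult_le_mono2)
    then have "q * (k2 + n) \<le> m" using qk1 by linarith
    moreover have "(k2 + n) * (1 + q) \<le> (k2 + n) * (2 * q)" using q by (intro mult_le_mono2) simp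
    ultimately show ?thesis using mn by (simp add: algebra_simps)
  qed
  have k2k1: "k2 < k1" using k2m mk1 by (meson less_trans mult_less_cancel2)
  have qk2: "q * k2 \<le> m" using k2m by (simp add: algebra_simps)
  have c1: "coeff ?P k1 \<noteq> 0" using m(2) by (simp add: k1_def)
  have c2: "coeff ?P k2 \<noteq> 0"
    using coeff_pcompose_shift_order[OF m(2), of 0] by (simp add: k2_def pcompose_idR)
  define P1 where "P1 = (real k2, real m - real q * real k2)"
  define P2 where "P2 = (real k1, real m - real q * real k1)"
  have supp: "taylor_coeff f k1 (m - q * k1) \<noteq> 0" "taylor_coeff f k2 (m - q * k2) \<noteq> 0"
    using c1 c2 by (auto simp: coeff_init_poly split: if_splits)
  have P1: "P1 \<in> newton_polyhedron f"
    using taylor_support_in_newton_polyhedron[OF supp(2)] qk2 by (simp add: P1_def of_nat_diff)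
  have P2: "P2 \<in> newton_polyhedron f"
    using taylor_support_in_newton_polyhedron[OF supp(1)] qk1 by (simp add: P2_def of_nat_diff)
  define p where "p = real m / (1 + real q)"
  define u where "u = (p - real k2) / (real k1 - real k2)"
  have pk: "real k2 < p" "p < real k1"
  proof -
    have "real (k2 * (1 + q)) < real m" "real m < real (k1 * (1 + q))" using k2m mk1 by (simp_all only: of_nat_less_iff)
    then show "real k2 < p" "p < real k1" by (simp_all add: p_def field_simps)
  qed
  have u: "0 < u" "u < 1" "u * (real k1 - real k2) = p - real k2" using pk k2k1 by (auto simp: u_def field_simps)
  have seg: "(p, p) \<in> open_segment P1 P2"
    unfolding in_segment
  proof (intro conjI exI[of _ u])
    show "P1 \<noteq> P2" using k2k1 by (simp add: P1_def P2_def)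
    have e1: "p = (1 - u) * real k2 + u * real k1"
    proof -
      have "(1 - u) * real k2 + u * real k1 = real k2 + u * (real k1 - real k2)" by (simp add: algebra_simps)
      then show ?thesis using u(3) by simp
    qed
    have "(1 - u) * (real m - real q * real k2) + u * (real m - real q * real k1) = real m - real q * ((1 - u) * real k2 + u * real k1)"
      by (simp add: algebra_simps)
    also have "\<dots> = p" unfolding e1[symmetric] by (simp add: p_def field_simps)
    finally show "(p, p) = (1 - u) *\<^sub>R P1 + u *\<^sub>R P2" using e1 by (simp add: P1_def P2_def)
  qed (use u in auto)
  have w: "weight_ge (taylor_coeff f) (real q) 1 (real m)" using weight_ge_swap[THEN iffD1, OF m(1)] .
  have "P1 \<in> principal_face f" "P2 \<in> principal_face f"
    using principal_face_edge[OF nz w _ _ P1 P2 _ _ _ seg] q k2k1 by (auto simp: P1_def P2_def)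
  then have l: "\<kappa>1 * real k2 + \<kappa>2 * (real m - real q * real k2) = 1" "\<kappa>1 * real k1 + \<kappa>2 * (real m - real q * real k1) = 1"
    using face by (auto simp: P1_def P2_def)
  then have "(\<kappa>1 - \<kappa>2 * real q) * (real k1 - real k2) = 0" by (simp add: algebra_simps)
  then have \<kappa>q: "\<kappa>1 = \<kappa>2 * real q" using k2k1 by simp
  moreover have "\<kappa>2 * 2 \<le> \<kappa>2 * real q" using q \<kappa> by (intro mult_left_mono) auto
  ultimately have "\<kappa>2 = 0" "\<kappa>1 = 0" using \<kappa> by auto
  then show False using l by simp
qed

lemma smooth_on_DERIV_at_0:
  fixes \<psi> :: "real \<Rightarrow> real"
  assumes "smooth_on I \<psi>" "0 \<in> I"
  obtains d where "(\<psi> has_field_derivative d) (at 0)"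
proof -
  have "Ck_on (Suc 0) I \<psi>" using assms(1) unfolding smooth_on_def by blast
  then have "\<psi> differentiable (at 0)" using assms(2) by simp
  then show ?thesis using that by (auto simp: real_differentiable_def)
qed

text \<open>On the curves \<open>x\<^sub>1 = s x\<^sub>2\<^sup>q\<close> with \<open>q \<ge> 2\<close> the shear changes \<open>x\<^sub>2\<close> by
  \<open>\<psi>(x\<^sub>1) = o(x\<^sub>2)\<close>, which has no effect on the initial form of weight \<open>(q, 1)\<close>.\<close>

lemma swapped_bad_root_shear:
  assumes f: "smooth_germ f" and \<psi>: "open I" "0 \<in> I" "smooth_on I \<psi>" "\<psi> 0 = 0" and q: "2 \<le> q"
    and bad: "bad_root (\<lambda>j k. taylor_coeff (\<lambda>(x, y). f (x, \<psi> x + y)) k j) q b"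
  shows "bad_root (\<lambda>j k. taylor_coeff f k j) q b"
proof -
  define g where "g = (\<lambda>(x, y). f (x, \<psi> x + y))"
  have g: "smooth_germ g" unfolding g_def by (rule smooth_germ_shear[OF f \<psi>])
  let ?cg = "\<lambda>j k. taylor_coeff g k j" and ?cf = "\<lambda>j k. taylor_coeff f k j"
  obtain m where m: "weight_ge ?cg 1 (real q) (real m)" "init_poly ?cg q m \<noteq> 0"
    "m < order b (init_poly ?cg q m) * (1 + q)" using bad unfolding bad_root_def g_def by blast
  have pos: "\<forall>\<^sub>F t in at_right (0::real). 0 < t" by (rule eventually_at_right_less)
  have "\<exists>a b. ((\<lambda>t. a t / t) \<longlongrightarrow> 1) (at_right 0) \<and> ((\<lambda>t. b t / t ^ q) \<longlongrightarrow> s + 0) (at_right 0)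
       \<and> (\<forall>\<^sub>F t in at_right 0. (\<lambda>(x, y). f (y, x)) (t, s * t ^ q) = (\<lambda>(x, y). g (y, x)) (a t, b t))" for s
  proof (intro exI conjI)
    obtain d where d: "(\<psi> has_field_derivative d) (at 0)" by (rule smooth_on_DERIV_at_0[OF \<psi>(3,2)])
    have "((\<lambda>t. s * t ^ q) has_field_derivative s * (real q * 0 ^ (q - 1))) (at 0)"
      by (auto intro!: derivative_eq_intros)
    then have der: "((\<lambda>t. s * t ^ q) has_field_derivative 0) (at 0)" using q by (simp add: power_0_left)
    have s0: "s * 0 ^ q = 0" using q by (simp add: power_0_left)
    then have "(\<psi> has_field_derivative d) (at (s * 0 ^ q))" by (simp only: d)
    from DERIV_chain2[OF this der]
    have "((\<lambda>t. \<psi> (s * t ^ q)) has_field_derivative 0) (at 0)" by simp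
    from this[unfolded has_field_derivative_iff s0 \<psi>(4)]
    have "((\<lambda>t. \<psi> (s * t ^ q) / t) \<longlongrightarrow> 0) (at 0)" by simp
    then have "((\<lambda>t. \<psi> (s * t ^ q) / t) \<longlongrightarrow> 0) (at_right 0)"
      by (rule tendsto_mono[rotated]) (simp add: at_le)
    then have "((\<lambda>t. 1 - \<psi> (s * t ^ q) / t) \<longlongrightarrow> 1 - 0) (at_right 0)" by (intro tendsto_intros)
    moreover have "\<forall>\<^sub>F t in at_right 0. 1 - \<psi> (s * t ^ q) / t = (t - \<psi> (s * t ^ q)) / t"
      using pos by eventually_elim (simp add: diff_divide_distrib)
    ultimately have "((\<lambda>t. (t - \<psi> (s * t ^ q)) / t) \<longlongrightarrow> 1 - 0) (at_right 0)"
      by (rule Lim_transform_eventually)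
    then show "((\<lambda>t. (t - \<psi> (s * t ^ q)) / t) \<longlongrightarrow> 1) (at_right 0)" by simp
    show "((\<lambda>t. s * t ^ q / t ^ q) \<longlongrightarrow> s + 0) (at_right 0)"
      by (rule tendsto_eventually, use pos in \<open>eventually_elim\<close>, simp)
  qed (simp add: g_def)
  note tr = init_transfer[OF has_taylor_swap[OF has_taylor_smooth[OF g]] has_taylor_swap[OF has_taylor_smooth[OF f]] _ m(1) this]
  have "init_poly ?cf q m = init_poly ?cg q m" using tr(2) q by (simp add: pcompose_idR)
  then show ?thesis unfolding bad_root_def using tr(1) m q by (intro exI[of _ m]) simp
qed

section \<open>Adaptedness\<close>

text \<open>The curve \<open>v = 0\<close> is a graph over the first axis or tangent to the second one. In the second
  case the estimate along a curve is applied to the function with its variables exchanged; then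
  only \<open>q \<ge> 2\<close> occurs.\<close>

lemma newton_distance_weighted_order_le:
  assumes g: "smooth_germ g" "taylor_coeff g j0 k0 \<noteq> 0"
    and nb: "\<And>q b. 1 \<le> q \<Longrightarrow> b \<noteq> 0 \<Longrightarrow> \<not> bad_root (taylor_coeff g) q b"
    and nbs: "\<And>q b. 2 \<le> q \<Longrightarrow> b \<noteq> 0 \<Longrightarrow> \<not> bad_root (\<lambda>j k. taylor_coeff g k j) q b"
    and u: "smooth_germ u" "u (0, 0) = 0"
    and v: "smooth_germ v" "v (0, 0) = 0" "taylor_coeff v 1 0 \<noteq> 0 \<or> taylor_coeff v 0 1 \<noteq> 0"
    and r: "1 \<le> r" and box: "box_bound h 1 r M"
    and eq: "\<forall>\<^sub>F z in nhds (0, 0). g z = h (u z, v z)"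
  shows "M \<le> newton_distance g * (1 + r)"
proof (cases "taylor_coeff v 0 1 = 0")
  case False
  show ?thesis
  proof (rule weighted_order_le[OF g(1) has_taylor_smooth[OF g(1)] g(2) _ _ has_taylor_smooth[OF u(1)] _
        v(1) has_taylor_smooth[OF v(1)] _ False r box eq])
    show "M \<le> newton_distance g * (1 + r)" if "1 \<le> r" "weight_ge (taylor_coeff g) 1 r M" for r M
      using newton_distance_ge[OF g(2) that(2)] that(1) by simp
    show "order b (init_poly (taylor_coeff g) q m) * (1 + q) \<le> m"
      if "1 \<le> q" "weight_ge (taylor_coeff g) 1 (real q) (real m)" "init_poly (taylor_coeff g) q m \<noteq> 0" "b \<noteq> 0" for q m b
      using nb[OF that(1,4)] that(2,3) unfolding bad_root_def by (meson not_less)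
  qed (simp_all add: taylor_coeff_0_0 u v)
next
  case True
  define gs where "gs = (\<lambda>(x, y). g (y, x))"
  define us where "us = (\<lambda>(x, y). u (y, x))"
  define vs where "vs = (\<lambda>(x, y). v (y, x))"
  have sm: "smooth_germ gs" "smooth_germ vs"
    unfolding gs_def vs_def by (intro smooth_germ_swap g v)+
  have ty: "has_taylor gs (\<lambda>j k. taylor_coeff g k j)" "has_taylor us (\<lambda>j k. taylor_coeff u k j)" "has_taylor vs (\<lambda>j k. taylor_coeff v k j)"
    unfolding gs_def us_def vs_def by (intro has_taylor_swap has_taylor_smooth g u v)+
  have lim: "filterlim (\<lambda>z :: real \<times> real. (snd z, fst z)) (nhds (0, 0)) (nhds (0, 0))"
    using smooth_germ_tendsto[of "\<lambda>z. (snd z, fst z)"]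
      smooth_germ_linear[OF bounded_linear_Pair[OF bounded_linear_snd bounded_linear_fst]] by simp
  have eqs: "\<forall>\<^sub>F z in nhds (0, 0). gs z = h (us z, vs z)"
    using eventually_compose_filterlim[OF eq lim] by (simp add: gs_def us_def vs_def case_prod_unfold)
  show ?thesis
  proof (rule weighted_order_le[OF sm(1) ty(1) _ _ _ ty(2) _ sm(2) ty(3) _ _ r box eqs])
    show "taylor_coeff g j0 k0 \<noteq> 0" by (rule g(2))
    show "M \<le> newton_distance g * (1 + r)" if "1 \<le> r" "weight_ge (\<lambda>j k. taylor_coeff g k j) 1 r M" for r M
      using newton_distance_ge[OF g(2) weight_ge_swap[THEN iffD1, OF that(2)]] that(1) by (simp add: add.commute)
    show "order b (init_poly (\<lambda>j k. taylor_coeff g k j) q m) * (1 + q) \<le> m"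
      if "1 \<le> q" "weight_ge (\<lambda>j k. taylor_coeff g k j) 1 (real q) (real m)"
        "init_poly (\<lambda>j k. taylor_coeff g k j) q m \<noteq> 0" "b \<noteq> 0" "q = 1 \<Longrightarrow> taylor_coeff v 0 1 \<noteq> 0" for q m b
    proof -
      have "2 \<le> q" using that(1,5) True by (cases "q = 1") auto
      from nbs[OF this that(4)] that(2,3) show ?thesis unfolding bad_root_def by (meson not_less)
    qed
    show "taylor_coeff v 1 0 \<noteq> 0" using v(3) True by simp
  qed (simp_all add: taylor_coeff_0_0 u v)
qed

text \<open>The distance of \<open>h\<close> is attained by a supporting weight. If its first entry is the smaller one
  and positive, it can be scaled to \<open>(1, r)\<close> with \<open>r \<ge> 1\<close>; if its second entry is, the roles of
  the two new coordinates are exchanged. A weight with a vanishing entry is a limit of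
  \<open>r\<close> tending to infinity.\<close>

lemma newton_distance_coordinates_le:
  assumes g: "smooth_germ g" "taylor_coeff g j0 k0 \<noteq> 0"
    and nb: "\<And>q b. 1 \<le> q \<Longrightarrow> b \<noteq> 0 \<Longrightarrow> \<not> bad_root (taylor_coeff g) q b"
    and nbs: "\<And>q b. 2 \<le> q \<Longrightarrow> b \<noteq> 0 \<Longrightarrow> \<not> bad_root (\<lambda>j k. taylor_coeff g k j) q b"
    and inv: "germ_inverse \<Phi> \<Theta>" and h: "smooth_germ h" "taylor_coeff h j1 k1 \<noteq> 0"
    and eq: "\<forall>\<^sub>F z in nhds (0, 0). g z = h (\<Theta> z)"
  shows "newton_distance h \<le> newton_distance g"
proof -
  define u where "u = (\<lambda>z. fst (\<Theta> z))"
  define v where "v = (\<lambda>z. snd (\<Theta> z))"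
  have sm: "smooth_germ u" "smooth_germ v" and z: "u (0, 0) = 0" "v (0, 0) = 0"
    using inv unfolding u_def v_def germ_inverse_def by (auto intro: smooth_germ_fst smooth_germ_snd)
  have id: "\<forall>\<^sub>F z in nhds (0, 0). \<Theta> (\<Phi> z) = z" using inv by (simp add: germ_inverse_def)
  have "\<forall>\<^sub>F z in nhds (0, 0). fst z = u (\<Phi> z)" using id by eventually_elim (simp add: u_def)
  then have lu: "taylor_coeff u 1 0 \<noteq> 0 \<or> taylor_coeff u 0 1 \<noteq> 0"
    by (intro nonzero_linear_part[OF inv sm(1) z(1), of fst]) auto
  have "\<forall>\<^sub>F z in nhds (0, 0). snd z = v (\<Phi> z)" using id by eventually_elim (simp add: v_def)
  then have lv: "taylor_coeff v 1 0 \<noteq> 0 \<or> taylor_coeff v 0 1 \<noteq> 0"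
    by (intro nonzero_linear_part[OF inv sm(2) z(2), of snd]) auto
  have guv: "\<forall>\<^sub>F z in nhds (0, 0). g z = h (u z, v z)" using eq by (simp add: u_def v_def)
  then have gvu: "\<forall>\<^sub>F z in nhds (0, 0). g z = (\<lambda>(x, y). h (y, x)) (v z, u z)" by simp
  let ?c = "taylor_coeff h" and ?d = "newton_distance h" and ?D = "newton_distance g"
  have claim1: "M \<le> ?D * (1 + r)" if "1 \<le> r" "weight_ge ?c 1 r M" for r M
    using newton_distance_weighted_order_le[OF g nb nbs sm(1) z(1) sm(2) z(2) lv that(1) _ guv]
      box_bound_if_weight_ge[OF has_taylor_smooth[OF h(1)] that(2)] that(1) by simp
  have claim2: "M \<le> ?D * (1 + r)" if "1 \<le> r" "weight_ge ?c r 1 M" for r M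
  proof -
    have "weight_ge (\<lambda>j k. ?c k j) 1 r M" using weight_ge_swap[THEN iffD2, OF that(2)] .
    then show ?thesis
      using newton_distance_weighted_order_le[OF g nb nbs sm(2) z(2) sm(1) z(1) lu that(1) _ gvu]
        box_bound_if_weight_ge[OF has_taylor_swap[OF has_taylor_smooth[OF h(1)]]] that(1) by simp
  qed
  have unb: "?d \<le> ?D" if *: "\<And>r. 1 \<le> r \<Longrightarrow> ?d * r \<le> ?D * (1 + r)"
  proof (rule ccontr)
    assume "\<not> ?thesis"
    then have pos: "0 < ?d - ?D" by simp
    define r where "r = max 1 ((\<bar>?D\<bar> + 1) / (?d - ?D))"
    have "(\<bar>?D\<bar> + 1) / (?d - ?D) \<le> r" by (simp add: r_def)
    then have "\<bar>?D\<bar> + 1 \<le> r * (?d - ?D)" using pos by (simp add: pos_divide_le_eq)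
    moreover have "?d * r \<le> ?D * (1 + r)" by (rule *) (simp add: r_def)
    ultimately show False by (simp add: algebra_simps)
  qed
  obtain a b where ab: "0 \<le> a" "0 \<le> b" "0 < a + b" "weight_ge ?c a b (?d * (a + b))"
    by (rule newton_distance_supporting_weight[OF h(2)])
  have scale: "weight_ge ?c (s * a) (s * b) (s * (?d * (a + b)))" if "0 \<le> s" for s
    unfolding weight_ge_def
  proof (intro allI impI)
    fix j k assume "?c j k \<noteq> 0"
    then have "s * (?d * (a + b)) \<le> s * (a * real j + b * real k)"
      using ab(4) that by (intro mult_left_mono) (auto simp: weight_ge_def)
    then show "s * (?d * (a + b)) \<le> s * a * real j + s * b * real k" by (simp add: algebra_simps)
  qed
  \<comment> \<open>The weight \<open>(0, b)\<close> says that \<open>h\<close> has order at least \<open>r\<close> times its distance for all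
    weights \<open>(1, r)\<close>, and similarly for \<open>(a, 0)\<close>.\<close>
  consider "a = 0" | "b = 0" | "0 < a" "a \<le> b" | "0 < b" "b \<le> a" using ab by linarith
  then show ?thesis
  proof cases
    case 1
    have w: "?d \<le> real k" if "?c j k \<noteq> 0" for j k
      using scale[of "1 / b"] 1 ab that by (auto simp: weight_ge_def)
    show ?thesis
    proof (rule unb, rule claim1)
      fix r :: real assume r: "1 \<le> r"
      show "weight_ge ?c 1 r (?d * r)"
        unfolding weight_ge_def
      proof (intro allI impI)
        fix j k assume "?c j k \<noteq> 0"
        from mult_left_mono[OF w[OF this], of r] r show "?d * r \<le> 1 * real j + r * real k" by (simp add: mult.commute add_increasing)
      qed
    qed
  next
    case 2
    have w: "?d \<le> real j" if "?c j k \<noteq> 0" for j k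
      using scale[of "1 / a"] 2 ab that by (auto simp: weight_ge_def)
    show ?thesis
    proof (rule unb, rule claim2)
      fix r :: real assume r: "1 \<le> r"
      show "weight_ge ?c r 1 (?d * r)"
        unfolding weight_ge_def
      proof (intro allI impI)
        fix j k assume "?c j k \<noteq> 0"
        from mult_left_mono[OF w[OF this], of r] r show "?d * r \<le> r * real j + 1 * real k" by (simp add: mult.commute add_increasing2)
      qed
    qed
  next
    case 3
    have "weight_ge ?c 1 (b / a) (?d * (1 + b / a))"
      using scale[of "1 / a"] 3 by (simp add: field_simps)
    from claim1[OF _ this] 3 have "?d * (1 + b / a) \<le> ?D * (1 + b / a)" by simp
    moreover have "0 < 1 + b / a" using 3 by (simp add: add_pos_nonneg)
    ultimately show ?thesis by (simp only: mult_le_cancel_right_pos)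
  next
    case 4
    have "weight_ge ?c (a / b) 1 (?d * (1 + a / b))"
      using scale[of "1 / b"] 4 by (simp add: field_simps)
    from claim2[OF _ this] 4 have "?d * (1 + a / b) \<le> ?D * (1 + a / b)" by simp
    moreover have "0 < 1 + a / b" using 4 by (simp add: add_pos_nonneg)
    ultimately show ?thesis by (simp only: mult_le_cancel_right_pos)
  qed
qed

theorem theorem5p1:
  fixes f :: "real \<times> real \<Rightarrow> real" and U :: "(real \<times> real) set" and \<kappa>1 \<kappa>2 :: real
  assumes "open U" and "(0, 0) \<in> U" and "smooth_on U f"
    and "finite_type f"
    and "f (0, 0) = 0" and "GDERIV f (0, 0) :> 0"
    and "\<kappa>1 \<ge> 0" and "\<kappa>2 \<ge> 0"
    and "principal_face f \<subseteq> {(t1, t2). \<kappa>1 * t1 + \<kappa>2 * t2 = 1}"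
    and "\<kappa>2 \<ge> \<kappa>1"
  shows "\<exists>\<psi> :: real \<Rightarrow> real. \<exists>I. open I \<and> 0 \<in> I \<and> smooth_on I \<psi> \<and> \<psi> 0 = 0 \<and>
           adapted f (\<lambda>(y1, y2). (y1, y2 + \<psi> y1))"
proof -
  have f: "smooth_germ f" using assms(1-3) unfolding smooth_germ_def by blast
  obtain j0 k0 where nz: "taylor_coeff f j0 k0 \<noteq> 0"
    using assms(4) by (auto simp: finite_type_def taylor_support_def)
  obtain \<psi> where \<psi>: "smooth_on I1 \<psi>" "\<psi> 0 = 0"
    and nb: "\<And>q b. 1 \<le> q \<Longrightarrow> b \<noteq> 0 \<Longrightarrow> \<not> bad_root (taylor_coeff (\<lambda>(x, y). f (x, \<psi> x + y))) q b"
    using adapting_shear[OF f nz] by blast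
  have opI: "open I1" "0 \<in> I1" by auto
  define g where "g = (\<lambda>(x, y). f (x, \<psi> x + y))"
  let ?\<phi> = "\<lambda>(y1, y2). (y1, y2 + \<psi> y1)" and ?\<theta> = "\<lambda>(y1, y2). (y1, y2 - \<psi> y1)"
  have f\<phi>: "f \<circ> ?\<phi> = g" by (auto simp: g_def fun_eq_iff add.commute)
  note sh = shear_coordinates[OF opI \<psi>]
  have g: "smooth_germ g" unfolding g_def by (rule smooth_germ_shear[OF f opI \<psi>])
  obtain j1 k1 where gnz: "taylor_coeff g j1 k1 \<noteq> 0"
    using taylor_nonzero_shear[OF f nz opI \<psi>] unfolding g_def by blast
  have nbs: "\<not> bad_root (\<lambda>j k. taylor_coeff g k j) q b" if "2 \<le> q" "b \<noteq> 0" for q b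
    using swapped_bad_root_shear[OF f opI \<psi> that(1)]
      swapped_bad_root_principal_face[OF nz _ that(2,1) assms(7,10,9)] unfolding g_def by blast
  have le: "newton_distance (f \<circ> \<Phi>) \<le> newton_distance g" if \<Phi>: "local_coordinates \<Phi>" for \<Phi>
  proof -
    obtain \<Theta> where \<Theta>: "germ_inverse \<Phi> \<Theta>" using local_coordinates_germ_inverse[OF \<Phi>] by blast
    have h: "smooth_germ (\<lambda>z. f (\<Phi> z))"
      using smooth_germ_compose[OF f, of \<Phi>] \<Theta> by (simp add: germ_inverse_def)
    obtain j2 k2 where hnz: "taylor_coeff (\<lambda>z. f (\<Phi> z)) j2 k2 \<noteq> 0"
      using taylor_nonzero_compose[OF \<Theta> f nz] by blast
    have inv: "germ_inverse (\<lambda>z. ?\<theta> (\<Phi> z)) (\<lambda>z. \<Theta> (?\<phi> z))"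
      by (rule germ_inverse_compose[OF germ_inverse_sym[OF sh(2)] \<Theta>])
    have "filterlim ?\<phi> (nhds (0, 0)) (nhds (0, 0))"
      using smooth_germ_tendsto[of ?\<phi>] sh(2) \<psi>(2) by (simp add: germ_inverse_def)
    moreover have "\<forall>\<^sub>F z in nhds (0, 0). \<Phi> (\<Theta> z) = z" using \<Theta> by (simp add: germ_inverse_def)
    ultimately have "\<forall>\<^sub>F z in nhds (0, 0). \<Phi> (\<Theta> (?\<phi> z)) = ?\<phi> z"
      using eventually_compose_filterlim by blast
    then have "\<forall>\<^sub>F z in nhds (0, 0). g z = f (\<Phi> (\<Theta> (?\<phi> z)))"
      by eventually_elim (simp add: f\<phi>[symmetric])
    from newton_distance_coordinates_le[OF g gnz nb[folded g_def] nbs inv h hnz this]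
    show ?thesis by (simp add: comp_def)
  qed
  have "height f = ereal (newton_distance g)"
    unfolding height_def
  proof (rule antisym)
    show "(SUP \<phi>\<in>Collect local_coordinates. ereal (newton_distance (f \<circ> \<phi>))) \<le> ereal (newton_distance g)"
      by (rule SUP_least) (use le in auto)
    show "ereal (newton_distance g) \<le> (SUP \<phi>\<in>Collect local_coordinates. ereal (newton_distance (f \<circ> \<phi>)))"
      by (rule SUP_upper2[of ?\<phi>]) (use sh(1) f\<phi> in auto)
  qed
  then have "adapted f ?\<phi>" using sh(1) f\<phi> by (simp add: adapted_def)
  then show ?thesis using opI \<psi> by blast
qed

end
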